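(* Let $\underline{y}>0$, $n\ge1$ an integer, $0<\varepsilon<\min\{\underline{y}/(n+1),1\}$, and $y\ge\underline{y}$. Let $X$ be a Lévy process with triplet $(\sigma^2,b,\nu)$ such that $\nu$ has a density $s$ satisfying $\sup_{|x|>\delta}|s^{(k)}(x)|<\infty$ for every integer $0\le k\le 2n+1$ and every $\delta>0$. Let $\hat d_k:=\lim_{m\to\infty}(L^kf_m)(0)$ for $1\le k\le n$, let $\mathcal R_n(t,y):=\lim_{m\to\infty}\int_0^1(1-\alpha)^n\,\mathbb{E}[(L^{n+1}f_m)(X_{\alpha t})]\,d\alpha$, and let $$d_k:=\sum_{j=1}^k\binom kj c_j(-\lambda_\varepsilon)^{k-j},\qquad c_j:=\sum_{i=1}^j\binom ji(L_\varepsilon^{j-i}\hat f_i)(0),\qquad \hat f_i(x):=\int_{y-x}^\infty\bar s_\varepsilon^{*i}(u)\,du .$$ Then $$\limsup_{t\to0}|\mathcal R_n(t,y)|<\infty,$$ and, for every $1\le k\le n$, $\hat d_k=d_k$; these constants are independent of $\varepsilon$ and are given by $$\lim_{t\to0}\frac1{t^k}\left\{\mathbb{P}(X_t\ge y)-\sum_{j=1}^{k-1}\hat d_j\frac{t^j}{j!}\right\}=\frac{\hat d_k}{k!},\qquad 1\le k\le n.$$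
   Context: A Lévy process $X=(X_t)_{t\ge0}$ has triplet $(\sigma^2,b,\nu)$ if $X_t=bt+\sigma W_t+\int_0^t\int_{|x|\le1}x\,(\mu-\bar\mu)(dx,ds)+\int_0^t\int_{|x|>1}x\,\mu(dx,ds)$, where $W$ is a standard Brownian motion and $\mu$ is an independent Poisson random measure on $\mathbb{R}_+\times(\mathbb{R}\setminus\{0\})$ with mean measure $\bar\mu(dx,dt)=\nu(dx)\,dt$, $\nu$ being a Lévy measure. Its infinitesimal generator is $$(Lg)(x)=\frac{\sigma^2}{2}g''(x)+bg'(x)+\int\big(g(u+x)-g(x)-ug'(x)\mathbf 1_{\{|u|\le1\}}\big)\nu(du)$$ for $g\in C_b^2$, and $L^k$ is its $k$-th iterate. Mollified indicators: $\varphi\in C^\infty(\mathbb{R})$ is a symmetric nonnegative bump function with support in $[-1,1]$ and $\int\varphi=1$; $\varphi_m(x):=m\varphi(mx)$ and $f_m(x):=\int_{-\infty}^{x-y}\varphi_m(u)\,du$. (Under the hypotheses, the limits in $m$ defining $\hat d_k$ and $\mathcal R_n(t,y)$ exist.) Fix a truncation function $c_\varepsilon\in C^\infty(\mathbb{R})$ with $\mathbf 1_{[-\varepsilon/2,\varepsilon/2]}\le c_\varepsilon\le\mathbf 1_{[-\varepsilon,\varepsilon]}$ and put $\bar c_\varepsilon:=1-c_\varepsilon$, $s_\varepsilon:=c_\varepsilon s$, $\bar s_\varepsilon:=\bar c_\varepsilon s$ (with $\bar s_\varepsilon(0):=0$), $\lambda_\varepsilon:=\int\bar c_\varepsilon(x)\,\nu(dx)$,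 $b_\varepsilon:=b-\int_{|x|\le1}x\,\bar c_\varepsilon(x)\,\nu(dx)$. Convolution powers: $\bar s_\varepsilon^{*1}=\bar s_\varepsilon$, $\bar s_\varepsilon^{*i}(x)=\int\bar s_\varepsilon^{*(i-1)}(x-u)\bar s_\varepsilon(u)\,du$ for $i\ge2$. The operator $L_\varepsilon$ is $$(L_\varepsilon g)(x)=b_\varepsilon g'(x)+\frac{\sigma^2}{2}g''(x)+\int\int_0^1g''(x+\beta w)(1-\beta)\,d\beta\,w^2c_\varepsilon(w)s(w)\,dw,$$ with $L_\varepsilon^0g=g$ and $L_\varepsilon^k$ its $k$-th iterate. *)

theory Defs
  imports "HOL-Probability.Probability"
begin

definition indep_increments :: "'w measure \<Rightarrow> (real \<Rightarrow> 'w \<Rightarrow> real) \<Rightarrow> bool" where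
  "indep_increments M X \<longleftrightarrow>
     (\<forall>(N::nat) (\<tau>::nat \<Rightarrow> real). 0 \<le> \<tau> 0 \<and> (\<forall>i<N. \<tau> i \<le> \<tau> (Suc i)) \<longrightarrow>
        prob_space.indep_vars M (\<lambda>_. borel) (\<lambda>i w. X (\<tau> (Suc i)) w - X (\<tau> i) w) {..<N})"

definition brownian_motion :: "'w measure \<Rightarrow> (real \<Rightarrow> 'w \<Rightarrow> real) \<Rightarrow> bool" where
  "brownian_motion M W \<longleftrightarrow>
     (\<forall>t\<ge>0. W t \<in> borel_measurable M) \<and>
     (AE w in M. W 0 w = 0) \<and>
     indep_increments M W \<and>
     (\<forall>r t. 0 \<le> r \<and> r < t \<longrightarrow>
        distributed M lborel (\<lambda>w. W t w - W r w) (normal_density 0 (sqrt (t - r)))) \<and>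
     (AE w in M. continuous_on {0..} (\<lambda>t. W t w))"

definition levy_process :: "'w measure \<Rightarrow> (real \<Rightarrow> 'w \<Rightarrow> real) \<Rightarrow> bool" where
  "levy_process M X \<longleftrightarrow>
     (\<forall>t\<ge>0. X t \<in> borel_measurable M) \<and>
     (AE w in M. X 0 w = 0) \<and>
     indep_increments M X \<and>
     (\<forall>r\<ge>0. \<forall>h\<ge>0. distr M borel (\<lambda>w. X (r + h) w - X r w) = distr M borel (X h)) \<and>
     (AE w in M. \<forall>t\<ge>0. continuous (at_right t) (\<lambda>r. X r w) \<and>
        (t > 0 \<longrightarrow> (\<exists>l. ((\<lambda>r. X r w) \<longlongrightarrow> l) (at_left t))))"

definition levy_measure :: "real measure \<Rightarrow> bool" where
  "levy_measure \<nu> \<longleftrightarrow>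
     sets \<nu> = sets borel \<and> emeasure \<nu> {0} = 0 \<and>
     (\<integral>\<^sup>+ x. ennreal (min 1 (x\<^sup>2)) \<partial>\<nu>) < \<infinity>"

definition poisson_random_measure ::
  "'w measure \<Rightarrow> 'a measure \<Rightarrow> ('w \<Rightarrow> 'a measure) \<Rightarrow> bool" where
  "poisson_random_measure M m \<mu> \<longleftrightarrow>
     (\<forall>w\<in>space M. sets (\<mu> w) = sets m) \<and>
     (\<forall>A\<in>sets m. (\<lambda>w. emeasure (\<mu> w) A) \<in> borel_measurable M) \<and>
     (\<forall>A\<in>sets m. emeasure m A < \<infinity> \<longrightarrow>
        (\<forall>k::nat. measure M {w \<in> space M. emeasure (\<mu> w) A = of_nat k}
                   = exp (- measure m A) * measure m A ^ k / fact k)) \<and>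
     (\<forall>A\<in>sets m. emeasure m A = \<infinity> \<longrightarrow> (AE w in M. emeasure (\<mu> w) A = \<infinity>)) \<and>
     (\<forall>(N::nat) A. (\<forall>i<N. A i \<in> sets m) \<and> disjoint_family_on A {..<N} \<longrightarrow>
        prob_space.indep_vars M (\<lambda>_. borel) (\<lambda>i w. emeasure (\<mu> w) (A i)) {..<N})"

text \<open>The intensity on \<open>[0,\<infinity>) \<times> (\<real> - {0})\<close>; the first coordinate is time, the second the
  jump size.\<close>

definition jump_intensity :: "real measure \<Rightarrow> (real \<times> real) measure" where
  "jump_intensity \<nu> = restrict_space lborel {0..} \<Otimes>\<^sub>M restrict_space \<nu> (- {0})"

definition indep_process_random_measure ::
  "'w measure \<Rightarrow> (real \<Rightarrow> 'w \<Rightarrow> real) \<Rightarrow> 'a measure \<Rightarrow> ('w \<Rightarrow> 'a measure) \<Rightarrow> bool" where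
  "indep_process_random_measure M W m \<mu> \<longleftrightarrow>
     prob_space.indep_set M
       (sigma_sets (space M) {W t -` B \<inter> space M | t B. 0 \<le> t \<and> B \<in> sets borel})
       (sigma_sets (space M)
          {(\<lambda>w. emeasure (\<mu> w) A) -` B \<inter> space M | A B. A \<in> sets m \<and> B \<in> sets borel})"

text \<open>\<open>J\<close> is (a version of) the compensated integral
  \<open>\<integral>\<^sub>0\<^sup>t \<integral>\<^bsub>|x| \<le> 1\<^esub> x (\<mu> - m)(dx, dr)\<close>. In general \<open>x\<close> is not integrable
  against \<open>m\<close> near \<open>0\<close>, only square integrable, so the integral is the limit in \<open>L\<^sup>2(M)\<close>,
  as \<open>\<delta>\<close> decreases to \<open>0\<close>, of the integrals over \<open>\<delta> < |x| \<le> 1\<close>. The mean square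
  distance is a nonnegative integral, so it is infinite rather than \<open>0\<close> when the
  difference is not square integrable.\<close>

definition compensated_small_jumps ::
  "'w measure \<Rightarrow> (real \<times> real) measure \<Rightarrow> ('w \<Rightarrow> (real \<times> real) measure) \<Rightarrow> real \<Rightarrow> ('w \<Rightarrow> real) \<Rightarrow> bool"
where
  "compensated_small_jumps M m \<mu> t J \<longleftrightarrow>
     J \<in> borel_measurable M \<and>
     ((\<lambda>\<delta>. \<integral>\<^sup>+ w. ennreal
          (((set_lebesgue_integral (\<mu> w) ({0<..t} \<times> {x. \<delta> < \<bar>x\<bar> \<and> \<bar>x\<bar> \<le> 1}) snd
            - set_lebesgue_integral m ({0<..t} \<times> {x. \<delta> < \<bar>x\<bar> \<and> \<bar>x\<bar> \<le> 1}) snd)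
            - J w)\<^sup>2) \<partial>M) \<longlongrightarrow> 0) (at_right 0)"

text \<open>\<open>X\<close> is a Levy process with triplet \<open>(\<sigma>\<^sup>2, b, \<nu>)\<close>. The sign of \<open>\<sigma>\<close> is
  immaterial.\<close>

definition levy_triplet ::
  "'w measure \<Rightarrow> (real \<Rightarrow> 'w \<Rightarrow> real) \<Rightarrow> real \<Rightarrow> real \<Rightarrow> real measure \<Rightarrow> bool" where
  "levy_triplet M X \<sigma> b \<nu> \<longleftrightarrow>
     levy_process M X \<and> levy_measure \<nu> \<and>
     (\<exists>W \<mu> J.
        brownian_motion M W \<and>
        poisson_random_measure M (jump_intensity \<nu>) \<mu> \<and>
        indep_process_random_measure M W (jump_intensity \<nu>) \<mu> \<and>
        (\<forall>t\<ge>0. compensated_small_jumps M (jump_intensity \<nu>) \<mu> t (J t)) \<and>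
        (\<forall>t\<ge>0. AE w in M.
           X t w = b * t + \<sigma> * W t w + J t w
                   + set_lebesgue_integral (\<mu> w) ({0<..t} \<times> {x. 1 < \<bar>x\<bar>}) snd))"

definition levy_generator ::
  "real \<Rightarrow> real \<Rightarrow> real measure \<Rightarrow> (real \<Rightarrow> real) \<Rightarrow> real \<Rightarrow> real" where
  "levy_generator \<sigma> b \<nu> g x =
     \<sigma>\<^sup>2 / 2 * deriv (deriv g) x + b * deriv g x
     + (\<integral>u. g (u + x) - g x - u * deriv g x * indicator {-1..1} u \<partial>\<nu>)"

definition smooth :: "(real \<Rightarrow> real) \<Rightarrow> bool" where
  "smooth f \<longleftrightarrow> (\<forall>k x. (deriv ^^ k) f differentiable (at x))"

definition bump_function :: "(real \<Rightarrow> real) \<Rightarrow> bool" where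
  "bump_function \<phi> \<longleftrightarrow>
     smooth \<phi> \<and> (\<forall>x. \<phi> (- x) = \<phi> x) \<and> (\<forall>x. 0 \<le> \<phi> x) \<and>
     closure {x. \<phi> x \<noteq> 0} \<subseteq> {-1..1} \<and> (LBINT x. \<phi> x) = 1"

definition mollified_indicator :: "(real \<Rightarrow> real) \<Rightarrow> real \<Rightarrow> nat \<Rightarrow> real \<Rightarrow> real" where
  "mollified_indicator \<phi> y m x = (LBINT u:{..x - y}. real m * \<phi> (real m * u))"

definition d_hat_seq ::
  "real \<Rightarrow> real \<Rightarrow> real measure \<Rightarrow> (real \<Rightarrow> real) \<Rightarrow> real \<Rightarrow> nat \<Rightarrow> nat \<Rightarrow> real" where
  "d_hat_seq \<sigma> b \<nu> \<phi> y k m = (levy_generator \<sigma> b \<nu> ^^ k) (mollified_indicator \<phi> y m) 0"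

definition d_hat ::
  "real \<Rightarrow> real \<Rightarrow> real measure \<Rightarrow> (real \<Rightarrow> real) \<Rightarrow> real \<Rightarrow> nat \<Rightarrow> real" where
  "d_hat \<sigma> b \<nu> \<phi> y k = lim (d_hat_seq \<sigma> b \<nu> \<phi> y k)"

definition remainder_seq ::
  "'w measure \<Rightarrow> (real \<Rightarrow> 'w \<Rightarrow> real) \<Rightarrow> real \<Rightarrow> real \<Rightarrow> real measure \<Rightarrow> (real \<Rightarrow> real) \<Rightarrow>
   nat \<Rightarrow> real \<Rightarrow> real \<Rightarrow> nat \<Rightarrow> real" where
  "remainder_seq M X \<sigma> b \<nu> \<phi> n t y m =
     (LBINT \<alpha>:{0..1}. (1 - \<alpha>) ^ n *
        (\<integral>w. (levy_generator \<sigma> b \<nu> ^^ (n + 1)) (mollified_indicator \<phi> y m) (X (\<alpha> * t) w) \<partial>M))"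

definition remainder ::
  "'w measure \<Rightarrow> (real \<Rightarrow> 'w \<Rightarrow> real) \<Rightarrow> real \<Rightarrow> real \<Rightarrow> real measure \<Rightarrow> (real \<Rightarrow> real) \<Rightarrow>
   nat \<Rightarrow> real \<Rightarrow> real \<Rightarrow> real" where
  "remainder M X \<sigma> b \<nu> \<phi> n t y = lim (remainder_seq M X \<sigma> b \<nu> \<phi> n t y)"

text \<open>Below, \<open>c\<close> is the truncation function \<open>c\<^sub>\<epsilon>\<close>, through which alone the constants
  depend on \<open>\<epsilon>\<close>, and \<open>s\<close> is the density of \<open>\<nu>\<close>.\<close>

definition truncation_function :: "real \<Rightarrow> (real \<Rightarrow> real) \<Rightarrow> bool" where
  "truncation_function \<epsilon> c \<longleftrightarrow>
     smooth c \<and>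
     (\<forall>x. indicator {- \<epsilon> / 2..\<epsilon> / 2} x \<le> c x \<and> c x \<le> indicator {- \<epsilon>..\<epsilon>} x)"

definition s_bar :: "(real \<Rightarrow> real) \<Rightarrow> (real \<Rightarrow> real) \<Rightarrow> real \<Rightarrow> real" where
  "s_bar s c x = (if x = 0 then 0 else (1 - c x) * s x)"

definition lambda_trunc :: "real measure \<Rightarrow> (real \<Rightarrow> real) \<Rightarrow> real" where
  "lambda_trunc \<nu> c = (\<integral>x. 1 - c x \<partial>\<nu>)"

definition b_trunc :: "real \<Rightarrow> real measure \<Rightarrow> (real \<Rightarrow> real) \<Rightarrow> real" where
  "b_trunc b \<nu> c = b - set_lebesgue_integral \<nu> {-1..1} (\<lambda>x. x * (1 - c x))"

definition conv_power :: "(real \<Rightarrow> real) \<Rightarrow> nat \<Rightarrow> real \<Rightarrow> real" where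
  "conv_power h i = ((\<lambda>g x. LBINT u. g (x - u) * h u) ^^ (i - 1)) h"  \<comment> \<open>for \<open>i \<ge> 1\<close>\<close>

definition L_trunc ::
  "real \<Rightarrow> real \<Rightarrow> real measure \<Rightarrow> (real \<Rightarrow> real) \<Rightarrow> (real \<Rightarrow> real) \<Rightarrow> (real \<Rightarrow> real) \<Rightarrow> real \<Rightarrow> real"
where
  "L_trunc \<sigma> b \<nu> s c g x =
     b_trunc b \<nu> c * deriv g x + \<sigma>\<^sup>2 / 2 * deriv (deriv g) x
     + (LBINT w. (LBINT \<beta>:{0..1}. deriv (deriv g) (x + \<beta> * w) * (1 - \<beta>)) * w\<^sup>2 * c w * s w)"

definition f_hat :: "(real \<Rightarrow> real) \<Rightarrow> (real \<Rightarrow> real) \<Rightarrow> real \<Rightarrow> nat \<Rightarrow> real \<Rightarrow> real" where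
  "f_hat s c y i x = (LBINT u:{y - x..}. conv_power (s_bar s c) i u)"

definition c_coeff ::
  "real \<Rightarrow> real \<Rightarrow> real measure \<Rightarrow> (real \<Rightarrow> real) \<Rightarrow> (real \<Rightarrow> real) \<Rightarrow> real \<Rightarrow> nat \<Rightarrow> real" where
  "c_coeff \<sigma> b \<nu> s c y j =
     (\<Sum>i=1..j. real (j choose i) * (L_trunc \<sigma> b \<nu> s c ^^ (j - i)) (f_hat s c y i) 0)"

definition d_coeff ::
  "real \<Rightarrow> real \<Rightarrow> real measure \<Rightarrow> (real \<Rightarrow> real) \<Rightarrow> (real \<Rightarrow> real) \<Rightarrow> real \<Rightarrow> nat \<Rightarrow> real" where
  "d_coeff \<sigma> b \<nu> s c y k =
     (\<Sum>j=1..k. real (k choose j) * c_coeff \<sigma> b \<nu> s c y j * (- lambda_trunc \<nu> c) ^ (k - j))"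

end

theory Submission
  imports Defs
begin

text \<open>Let \<open>P\<^sub>t\<close> be the transition operators, \<open>L\<close> the generator, \<open>I\<close> the convolution with the
  truncated density, and \<open>L = L\<^sub>\<epsilon> + I - \<lambda>\<^sub>\<epsilon>\<close>. Dynkin's formula holds for characters by the
  Levy-Khintchine formula, and extends to functions with two bounded derivatives by trigonometric
  approximation. Taylor expansion in time then reduces the whole theorem to a bound
  \<open>P\<^sub>t f\<^sub>m(x) = \<Sum>\<^bsub>p \<le> n\<^esub> t\<^sup>p / p! L\<^sup>p f\<^sub>m(x) + O(t\<^bsup>n+1\<^esup>)\<close> that is uniform in \<open>m\<close> and in \<open>x\<close> near \<open>0\<close>.
  Any power \<open>I\<^sup>i f\<^sub>m\<close> with \<open>i \<ge> 1\<close> is a mollification of the smooth function \<open>f_hat i\<close>, so it can be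
  expanded uniformly, and what is left is \<open>exp (- t I) P\<^sub>t f\<^sub>m\<close>, up to a factor the expectation of
  \<open>f\<^sub>m\<close> when only the small jumps are kept. As this operator is positive, it suffices to
  estimate it for a fixed smooth majorant of all \<open>f\<^sub>m\<close>; the majorant vanishes to the
  left of a point beyond \<open>n \<epsilon>\<close>, hence near \<open>0\<close> so do its images under the first \<open>n\<close> powers of the local operator
  \<open>L\<^sub>\<epsilon> - \<lambda>\<^sub>\<epsilon>\<close>, and Taylor's formula gives \<open>O(t\<^bsup>n+1\<^esup>)\<close>.\<close>

section \<open>Functions with bounded derivatives\<close>

text \<open>The Taylor remainder of order n + 1 cannot be estimated directly: it contains
  \<open>L ^^ Suc n\<close> applied to \<open>fm m\<close>, and the derivatives of
  \<open>fm m\<close> blow up with m. Writing L as a local operator plus the convolution I, every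
  product that contains I is harmless, because I has already smoothed the indicator. Only the purely
  local part is left. It belongs to paths that reach y by small jumps alone, and their contribution
  has to be seen to be O(t^(n+1)). Positivity is what allows one function free of m to stand in for
  all \<open>fm m\<close> there. Each application of the local operator moves a support by at most
  \<epsilon>, so n of them cost n \<epsilon>; since (n + 1) \<epsilon> < y, one further \<epsilon>
  is left for the majorant and the width of the mollifiers. Uniformity in x near 0 is wanted because
  the law of \<open>X t\<close> may charge the point y: evaluated at x = 1 / m, the mollified
  indicators converge to the indicator of the closed half-line at every point, y included.\<close>

primrec Cb :: "nat \<Rightarrow> (real \<Rightarrow> real) \<Rightarrow> bool" where
  "Cb 0 f \<longleftrightarrow> continuous_on UNIV f \<and> bounded (range f)"
| "Cb (Suc r) f \<longleftrightarrow> bounded (range f) \<and> (\<forall>x. f differentiable (at x)) \<and> Cb r (deriv f)"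

lemma Cb_continuous: "Cb r f \<Longrightarrow> continuous_on UNIV f"
  by (cases r) (auto intro!: continuous_at_imp_continuous_on differentiable_imp_continuous_within)

lemma Cb_bounded: "Cb r f \<Longrightarrow> bounded (range f)"
  by (cases r) auto

lemma Cb_bound: "Cb r f \<Longrightarrow> \<exists>B\<ge>0. \<forall>x. \<bar>f x\<bar> \<le> B"
  using Cb_bounded[of r f] unfolding bounded_iff by (metis abs_ge_zero order_trans rangeI real_norm_def)

lemma Cb_measurable: "Cb r f \<Longrightarrow> f \<in> borel_measurable borel"
  by (intro borel_measurable_continuous_onI Cb_continuous)

lemma Cb_Suc_D: "Cb (Suc r) f \<Longrightarrow> Cb r f"
proof (induction r arbitrary: f)
  case 0
  then show ?case using Cb_continuous[of "Suc 0" f] by auto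
next
  case (Suc r)
  then show ?case by (metis Cb.simps(2))
qed

lemma Cb_mono: "Cb r f \<Longrightarrow> q \<le> r \<Longrightarrow> Cb q f"
  by (induction r) (auto simp: le_Suc_eq intro: Cb_Suc_D simp del: Cb.simps)

lemma Cb_has_deriv: "Cb (Suc r) f \<Longrightarrow> (f has_real_derivative deriv f x) (at x)"
  by (simp add: DERIV_deriv_iff_real_differentiable)

lemma Cb_deriv: "Cb (Suc r) f \<Longrightarrow> Cb r (deriv f)"
  by simp

lemma Cb_SucI:
  assumes "\<And>x. (f has_real_derivative f' x) (at x)" "bounded (range f)" "Cb r f'"
  shows "Cb (Suc r) f"
proof -
  have "deriv f = f'" using assms(1) by (auto intro: DERIV_imp_deriv)
  then show ?thesis using assms by (auto simp: real_differentiable_def)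
qed

lemma bounded_range_lincomb:
  fixes f g :: "real \<Rightarrow> real"
  assumes "bounded (range f)" "bounded (range g)"
  shows "bounded (range (\<lambda>x. a * f x + b * g x))"
proof -
  obtain B C where "\<And>x. \<bar>f x\<bar> \<le> B" "\<And>x. \<bar>g x\<bar> \<le> C"
    using assms unfolding bounded_iff by auto
  then have "\<bar>a * f x + b * g x\<bar> \<le> \<bar>a\<bar> * B + \<bar>b\<bar> * C" for x
    by (intro order_trans[OF abs_triangle_ineq] add_mono) (auto simp: abs_mult intro!: mult_left_mono)
  then show ?thesis unfolding bounded_iff by auto
qed

lemma deriv_lincomb:
  assumes "Cb (Suc 0) f" "Cb (Suc 0) g"
  shows "deriv (\<lambda>x. a * f x + b * g x) = (\<lambda>x. a * deriv f x + b * deriv g x)"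
proof
  fix x
  show "deriv (\<lambda>x. a * f x + b * g x) x = a * deriv f x + b * deriv g x"
    by (rule DERIV_imp_deriv) (auto intro!: derivative_eq_intros Cb_has_deriv assms)
qed

lemma Cb_lincomb: "Cb r f \<Longrightarrow> Cb r g \<Longrightarrow> Cb r (\<lambda>x. a * f x + b * g x)"
proof (induction r arbitrary: f g)
  case 0
  then show ?case by (auto intro!: bounded_range_lincomb continuous_intros)
next
  case (Suc r)
  have "((\<lambda>x. a * f x + b * g x) has_real_derivative a * deriv f x + b * deriv g x) (at x)" for x
    by (auto intro!: derivative_eq_intros Cb_has_deriv Suc)
  moreover have "Cb r (\<lambda>x. a * deriv f x + b * deriv g x)"
    using Suc by auto
  ultimately show ?case
    using Suc.prems by (intro Cb_SucI) (auto intro!: bounded_range_lincomb)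
qed

lemma Cb_add: "Cb r f \<Longrightarrow> Cb r g \<Longrightarrow> Cb r (\<lambda>x. f x + g x)"
  using Cb_lincomb[of r f g 1 1] by simp

lemma Cb_cmult: "Cb r f \<Longrightarrow> Cb r (\<lambda>x. a * f x)"
  using Cb_lincomb[of r f f a 0] by simp

lemma Cb_deriv2: "Cb (Suc (Suc r)) f \<Longrightarrow> Cb r (deriv (deriv f))"
  by simp

lemma Cb_2D:
  assumes "Cb 2 g"
  shows "Cb 0 g" "Cb 1 g" "Cb 0 (deriv g)" "Cb 1 (deriv g)" "Cb 0 (deriv (deriv g))"
    "(g has_real_derivative deriv g x) (at x)"
    "(deriv g has_real_derivative deriv (deriv g) x) (at x)"
  using assms Cb_mono[of 2 g 0] Cb_mono[of 2 g 1] Cb_mono[of 1 "deriv g" 0] Cb_has_deriv[of 1 g x]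
    Cb_has_deriv[of 0 "deriv g" x]
  by (simp_all add: numeral_2_eq_2)

section \<open>Averaging over a finite measure\<close>

text \<open>The convolution of \<open>g\<close> with the reflected measure. Transition operators,
  both jump parts of the generator and the mollifications all have this form, so smoothness and
  commutation are proved once.\<close>

definition conv_op :: "real measure \<Rightarrow> (real \<Rightarrow> real) \<Rightarrow> real \<Rightarrow> real" where
  "conv_op \<kappa> g x = (\<integral>u. g (x + u) \<partial>\<kappa>)"

context finite_borel_measure
begin

lemma integrable_bounded:
  assumes "f \<in> borel_measurable borel" "\<And>x. \<bar>f x\<bar> \<le> (B::real)"
  shows "integrable M f"
  by (rule integrable_const_bound[where B = B]) (use assms M_is_borel in \<open>auto cong: measurable_cong_sets\<close>)

lemma conv_op_integrable:
  assumes "Cb r g"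
  shows "integrable M (\<lambda>u. g (x + u))"
proof -
  obtain B where B: "\<And>x. \<bar>g x\<bar> \<le> B" using Cb_bound[OF assms] by auto
  note [measurable] = Cb_measurable[OF assms]
  show ?thesis using B by (intro integrable_bounded) auto
qed

lemma conv_op_bound:
  assumes "\<And>x. \<bar>g x\<bar> \<le> B"
  shows "\<bar>conv_op M g x\<bar> \<le> B * measure M UNIV"
proof -
  have sp: "space M = UNIV" using sets_eq_imp_space_eq[OF M_is_borel] by simp
  have "norm (conv_op M g x) \<le> (\<integral>u. B \<partial>M)"
    unfolding conv_op_def using assms order_trans[OF abs_ge_zero assms]
    by (intro order_trans[OF integral_norm_bound] integral_mono') auto
  then show ?thesis by (simp add: sp mult.commute)
qed

lemma conv_op_tendsto:
  assumes "\<And>k. f k \<in> borel_measurable borel" "g \<in> borel_measurable borel" "\<And>k x. \<bar>f k x\<bar> \<le> B"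
    and "\<And>x. (\<lambda>k. f k x) \<longlonglongrightarrow> g x"
  shows "(\<lambda>k. conv_op M (f k) x) \<longlonglongrightarrow> conv_op M g x"
proof -
  note [measurable] = assms(1,2)
  show ?thesis unfolding conv_op_def
    by (rule integral_dominated_convergence[where w = "\<lambda>_. B"])
      (use assms M_is_borel in \<open>auto cong: measurable_cong_sets\<close>)
qed

lemma conv_op_continuous:
  assumes "Cb r g"
  shows "continuous_on UNIV (conv_op M g)"
proof -
  obtain B where B: "\<And>x. \<bar>g x\<bar> \<le> B" using Cb_bound[OF assms] by auto
  note [measurable] = Cb_measurable[OF assms]
  have "continuous (at x) (conv_op M g)" for x
    unfolding continuous_at_sequentially comp_def
  proof safe
    fix X assume X: "X \<longlonglongrightarrow> x"
    have "(\<lambda>k. g (X k + u)) \<longlonglongrightarrow> g (x + u)" for u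
      using Cb_continuous[OF assms] X
      by (intro continuous_on_tendsto_compose[of UNIV g]) (auto intro!: tendsto_intros)
    then show "(\<lambda>k. conv_op M g (X k)) \<longlonglongrightarrow> conv_op M g x"
      unfolding conv_op_def using B
      by (intro integral_dominated_convergence[where w = "\<lambda>_. B"])
        (use M_is_borel in \<open>auto cong: measurable_cong_sets\<close>)
  qed
  then show ?thesis by (simp add: continuous_at_imp_continuous_on)
qed

text \<open>Differentiation under the integral: by the mean value inequality all difference
  quotients are bounded by the supremum of the derivative, a constant and hence integrable against a
  finite measure. The limit is taken along sequences so that dominated convergence applies.\<close>

lemma conv_op_has_deriv:
  assumes "Cb (Suc 0) g"
  shows "(conv_op M g has_real_derivative conv_op M (deriv g) x) (at x)"
  unfolding has_field_derivative_iff tendsto_at_iff_sequentially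
proof safe
  fix X :: "nat \<Rightarrow> real" assume X0: "\<forall>i. X i \<in> UNIV - {x}" and X: "X \<longlonglongrightarrow> x"
  obtain B where B: "\<And>x. \<bar>deriv g x\<bar> \<le> B" using Cb_bound[OF Cb_deriv[OF assms]] by auto
  note [measurable] = Cb_measurable[OF assms] Cb_measurable[OF Cb_deriv[OF assms]]
  have bnd: "\<bar>(g (X i + u) - g (x + u)) / (X i - x)\<bar> \<le> B" for i u
  proof -
    have "norm (g (X i + u) - g (x + u)) \<le> B * norm (X i + u - (x + u))"
      by (rule field_differentiable_bound[where S = UNIV and f' = "deriv g"])
        (use B Cb_has_deriv[OF assms] in \<open>auto\<close>)
    then show ?thesis using X0 by (simp add: divide_le_eq abs_divide)
  qed
  have "(\<lambda>i. (g (X i + u) - g (x + u)) / (X i - x)) \<longlonglongrightarrow> deriv g (x + u)" for u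
  proof -
    have "((\<lambda>x'. (g x' - g (x + u)) / (x' - (x + u))) \<longlongrightarrow> deriv g (x + u)) (at (x + u))"
      using Cb_has_deriv[OF assms] has_field_derivative_iff by blast
    moreover have "filterlim (\<lambda>i. X i + u) (at (x + u)) sequentially"
      using X X0 by (auto simp: filterlim_at intro!: tendsto_intros)
    ultimately have "(\<lambda>i. (g (X i + u) - g (x + u)) / (X i + u - (x + u))) \<longlonglongrightarrow> deriv g (x + u)"
      by (rule filterlim_compose)
    then show ?thesis by simp
  qed
  then have "(\<lambda>i. \<integral>u. (g (X i + u) - g (x + u)) / (X i - x) \<partial>M) \<longlonglongrightarrow> (\<integral>u. deriv g (x + u) \<partial>M)"
    using bnd by (intro integral_dominated_convergence[where w = "\<lambda>_. B"])
        (use M_is_borel in \<open>auto cong: measurable_cong_sets\<close>)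
  moreover have "(\<integral>u. (g (X i + u) - g (x + u)) / (X i - x) \<partial>M)
     = (conv_op M g (X i) - conv_op M g x) / (X i - x)" for i
    unfolding integral_divide_zero
    using conv_op_integrable[OF assms] by (simp add: conv_op_def)
  ultimately have "(\<lambda>i. (conv_op M g (X i) - conv_op M g x) / (X i - x)) \<longlonglongrightarrow> (\<integral>u. deriv g (x + u) \<partial>M)"
    by (simp only:)
  then show "((\<lambda>y. (conv_op M g y - conv_op M g x) / (y - x)) \<circ> X) \<longlonglongrightarrow> conv_op M (deriv g) x"
    by (simp add: conv_op_def comp_def)
qed

lemma conv_op_deriv:
  "Cb (Suc 0) g \<Longrightarrow> deriv (conv_op M g) = conv_op M (deriv g)"
  by (auto intro!: DERIV_imp_deriv conv_op_has_deriv)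

lemma conv_op_bounded: "Cb r g \<Longrightarrow> bounded (range (conv_op M g))"
  using Cb_bound[of r g] conv_op_bound[of g] by (force simp: bounded_iff)

lemma Cb_conv_op: "Cb r g \<Longrightarrow> Cb r (conv_op M g)"
proof (induction r arbitrary: g)
  case 0
  then show ?case using conv_op_continuous[of 0 g] conv_op_bounded[of 0 g] by auto
next
  case (Suc r)
  show ?case
    by (rule Cb_SucI[OF conv_op_has_deriv conv_op_bounded[OF Suc.prems] Suc.IH[OF Cb_deriv]])
      (use Suc.prems Cb_mono[of "Suc r" g "Suc 0"] in auto)
qed

lemma conv_op_lincomb:
  assumes "Cb r f" "Cb r g"
  shows "conv_op M (\<lambda>x. a * f x + b * g x) = (\<lambda>x. a * conv_op M f x + b * conv_op M g x)"
  by (auto simp: conv_op_def conv_op_integrable[OF assms(1)] conv_op_integrable[OF assms(2)])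

lemma conv_op_nonneg: "(\<And>x. 0 \<le> g x) \<Longrightarrow> 0 \<le> conv_op M g x"
  by (simp add: conv_op_def)

end

text \<open>Fubini: both sides integrate \<open>g (x + u + v)\<close> over the product measure. The
  form for bounded measurable \<open>g\<close> is what \<open>I_pow_fm\<close> applies to the
  indicator of a half-line.\<close>

lemma conv_op_commute_bounded:
  fixes g :: "real \<Rightarrow> real"
  assumes "finite_borel_measure \<kappa>" "finite_borel_measure \<kappa>'"
    and [measurable]: "g \<in> borel_measurable borel" and C: "\<And>x. \<bar>g x\<bar> \<le> C"
  shows "conv_op \<kappa> (conv_op \<kappa>' g) = conv_op \<kappa>' (conv_op \<kappa> g)"
proof
  fix x
  interpret A: finite_borel_measure \<kappa> by fact
  interpret B: finite_borel_measure \<kappa>' by fact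
  interpret AB: pair_sigma_finite \<kappa> \<kappa>' ..
  note [measurable_cong] = A.M_is_borel B.M_is_borel
  interpret P: finite_measure "\<kappa> \<Otimes>\<^sub>M \<kappa>'"
    by (rule finite_measure_pair_measure) unfold_locales
  have int: "integrable (\<kappa> \<Otimes>\<^sub>M \<kappa>') (\<lambda>(u, v). g (x + u + v))"
    by (rule P.integrable_const_bound[where B = C]) (use C in auto)
  have "(\<integral>v. \<integral>u. g (x + u + v) \<partial>\<kappa> \<partial>\<kappa>') = (\<integral>u. \<integral>v. g (x + u + v) \<partial>\<kappa>' \<partial>\<kappa>)"
    using AB.Fubini_integral[OF int] by simp
  then show "conv_op \<kappa> (conv_op \<kappa>' g) x = conv_op \<kappa>' (conv_op \<kappa> g) x"
    unfolding conv_op_def by (simp add: ac_simps)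
qed

lemma conv_op_commute:
  assumes "finite_borel_measure \<kappa>" "finite_borel_measure \<kappa>'" "Cb r g"
  shows "conv_op \<kappa> (conv_op \<kappa>' g) = conv_op \<kappa>' (conv_op \<kappa> g)"
proof -
  obtain C where "\<And>x. \<bar>g x\<bar> \<le> C" using Cb_bound[OF assms(3)] by auto
  from conv_op_commute_bounded[OF assms(1,2) Cb_measurable[OF assms(3)] this] show ?thesis .
qed

section \<open>Second order operators with constant coefficients\<close>

text \<open>Bounded pointwise convergence with two derivatives. Uniform convergence would be too
  strong, as uniform limits of trigonometric polynomials on the line are almost periodic; this
  weaker mode still suffices for dominated convergence.\<close>

definition bp_conv2 :: "(nat \<Rightarrow> real \<Rightarrow> real) \<Rightarrow> (real \<Rightarrow> real) \<Rightarrow> bool" where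
  "bp_conv2 f g \<longleftrightarrow> (\<forall>k. Cb 2 (f k)) \<and> Cb 2 g \<and>
     (\<exists>B. \<forall>k x. \<bar>f k x\<bar> \<le> B \<and> \<bar>deriv (f k) x\<bar> \<le> B \<and> \<bar>deriv (deriv (f k)) x\<bar> \<le> B) \<and>
     (\<forall>x. (\<lambda>k. f k x) \<longlonglongrightarrow> g x \<and> (\<lambda>k. deriv (f k) x) \<longlonglongrightarrow> deriv g x \<and>
        (\<lambda>k. deriv (deriv (f k)) x) \<longlonglongrightarrow> deriv (deriv g) x)"

text \<open>Two finite measures describe the jumps even if the Levy measure is infinite: large jumps
  average \<open>g\<close>, small jumps average its second derivative. The formula is required only
  on \<open>Cb 2\<close>, where these derivatives make sense.\<close>

definition second_order :: "((real \<Rightarrow> real) \<Rightarrow> real \<Rightarrow> real) \<Rightarrow> bool" where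
  "second_order T \<longleftrightarrow> (\<exists>a0 a1 a2 \<kappa>1 \<kappa>2. finite_borel_measure \<kappa>1 \<and> finite_borel_measure \<kappa>2 \<and>
     (\<forall>g. Cb 2 g \<longrightarrow> T g = (\<lambda>x. a0 * g x + a1 * deriv g x + a2 * deriv (deriv g) x
        + conv_op \<kappa>1 g x + conv_op \<kappa>2 (deriv (deriv g)) x)))"

lemma second_order_Cb:
  assumes "second_order T" "Cb (r + 2) g"
  shows "Cb r (T g)"
proof -
  obtain a0 a1 a2 \<kappa>1 \<kappa>2 where k: "finite_borel_measure \<kappa>1" "finite_borel_measure \<kappa>2" and
     T: "\<And>g. Cb 2 g \<Longrightarrow> T g = (\<lambda>x. a0 * g x + a1 * deriv g x + a2 * deriv (deriv g) x
        + conv_op \<kappa>1 g x + conv_op \<kappa>2 (deriv (deriv g)) x)"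
    using assms(1) unfolding second_order_def by blast
  have "Cb r g" "Cb r (deriv g)" "Cb r (deriv (deriv g))" "Cb 2 g"
    using assms(2) Cb_mono[of "r + 2" g r] Cb_mono[of "Suc r" "deriv g" r] Cb_mono[of "r + 2" g 2]
    by auto
  then show ?thesis
    by (auto simp: T intro!: Cb_add Cb_cmult finite_borel_measure.Cb_conv_op k)
qed

lemma second_order_lincomb:
  assumes "second_order T" "Cb 2 f" "Cb 2 g"
  shows "T (\<lambda>x. a * f x + b * g x) = (\<lambda>x. a * T f x + b * T g x)"
proof -
  obtain a0 a1 a2 \<kappa>1 \<kappa>2 where k: "finite_borel_measure \<kappa>1" "finite_borel_measure \<kappa>2" and
     T: "\<And>g. Cb 2 g \<Longrightarrow> T g = (\<lambda>x. a0 * g x + a1 * deriv g x + a2 * deriv (deriv g) x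
        + conv_op \<kappa>1 g x + conv_op \<kappa>2 (deriv (deriv g)) x)"
    using assms(1) unfolding second_order_def by blast
  have 1: "Cb 1 f" "Cb 1 g" "Cb 1 (deriv f)" "Cb 1 (deriv g)" "Cb 0 (deriv (deriv f))" "Cb 0 (deriv (deriv g))"
    using assms(2,3) Cb_mono[of 2 f 1] Cb_mono[of 2 g 1] by (auto simp: numeral_2_eq_2)
  have "deriv (deriv (\<lambda>x. a * f x + b * g x)) = (\<lambda>x. a * deriv (deriv f) x + b * deriv (deriv g) x)"
    using 1 by (simp only: deriv_lincomb One_nat_def)
  moreover have "deriv (\<lambda>x. a * f x + b * g x) = (\<lambda>x. a * deriv f x + b * deriv g x)"
    using 1 by (simp only: deriv_lincomb One_nat_def)
  ultimately show ?thesis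
    by (subst (1 2 3) T) (auto intro!: Cb_lincomb assms simp: algebra_simps
       finite_borel_measure.conv_op_lincomb[OF k(1) assms(2,3)]
       finite_borel_measure.conv_op_lincomb[OF k(2) 1(5,6)])
qed

text \<open>Every term of such an operator is translation invariant: derivatives pass under the
  integral, and convolutions with finite measures commute by Fubini.\<close>

lemma second_order_conv_op:
  assumes "second_order T" "finite_borel_measure \<kappa>" "Cb 2 g"
  shows "T (conv_op \<kappa> g) = conv_op \<kappa> (T g)"
proof -
  obtain a0 a1 a2 \<kappa>1 \<kappa>2 where k: "finite_borel_measure \<kappa>1" "finite_borel_measure \<kappa>2" and
     T: "\<And>g. Cb 2 g \<Longrightarrow> T g = (\<lambda>x. a0 * g x + a1 * deriv g x + a2 * deriv (deriv g) x
        + conv_op \<kappa>1 g x + conv_op \<kappa>2 (deriv (deriv g)) x)"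
    using assms(1) unfolding second_order_def by blast
  interpret K: finite_borel_measure \<kappa> by fact
  have 1: "Cb 0 g" "Cb 0 (deriv g)" "Cb 0 (deriv (deriv g))" "Cb (Suc 0) g" "Cb (Suc 0) (deriv g)"
    using assms(3) Cb_mono[of 2 g 1] Cb_mono[of 2 g 0] Cb_mono[of 1 "deriv g" 0] by (auto simp: numeral_2_eq_2)
  have 2: "Cb 0 (conv_op \<kappa>1 g)" "Cb 0 (conv_op \<kappa>2 (deriv (deriv g)))"
    using 1 k finite_borel_measure.Cb_conv_op by blast+
  have d: "deriv (conv_op \<kappa> g) = conv_op \<kappa> (deriv g)" "deriv (conv_op \<kappa> (deriv g)) = conv_op \<kappa> (deriv (deriv g))"
    using 1 by (auto intro!: K.conv_op_deriv)
  have "integrable \<kappa> (\<lambda>u. g (x + u))" "integrable \<kappa> (\<lambda>u. deriv g (x + u))"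
    "integrable \<kappa> (\<lambda>u. deriv (deriv g) (x + u))" "integrable \<kappa> (\<lambda>u. conv_op \<kappa>1 g (x + u))"
    "integrable \<kappa> (\<lambda>u. conv_op \<kappa>2 (deriv (deriv g)) (x + u))" for x
    using 1 2 K.conv_op_integrable by blast+
  then have "conv_op \<kappa> (T g) = (\<lambda>x. a0 * conv_op \<kappa> g x + a1 * conv_op \<kappa> (deriv g) x + a2 * conv_op \<kappa> (deriv (deriv g)) x
        + conv_op \<kappa> (conv_op \<kappa>1 g) x + conv_op \<kappa> (conv_op \<kappa>2 (deriv (deriv g))) x)"
    by (subst T[OF assms(3)]) (auto simp: conv_op_def)
  moreover have "T (conv_op \<kappa> g) = (\<lambda>x. a0 * conv_op \<kappa> g x + a1 * conv_op \<kappa> (deriv g) x + a2 * conv_op \<kappa> (deriv (deriv g)) x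
        + conv_op \<kappa>1 (conv_op \<kappa> g) x + conv_op \<kappa>2 (conv_op \<kappa> (deriv (deriv g))) x)"
    by (subst T) (auto simp: d intro!: K.Cb_conv_op assms)
  ultimately show ?thesis
    using conv_op_commute[OF assms(2) k(1) 1(1)] conv_op_commute[OF assms(2) k(2) 1(3)] by simp
qed

text \<open>Dominated convergence for each of the two finite measures, the common bound on the
  derivatives being the majorant.\<close>

lemma second_order_bp:
  assumes "second_order T" "bp_conv2 f g"
  shows "(\<lambda>k. T (f k) x) \<longlonglongrightarrow> T g x" "\<exists>B. \<forall>k x. \<bar>T (f k) x\<bar> \<le> B"
proof -
  obtain a0 a1 a2 \<kappa>1 \<kappa>2 where k: "finite_borel_measure \<kappa>1" "finite_borel_measure \<kappa>2" and
     T: "\<And>g. Cb 2 g \<Longrightarrow> T g = (\<lambda>x. a0 * g x + a1 * deriv g x + a2 * deriv (deriv g) x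
        + conv_op \<kappa>1 g x + conv_op \<kappa>2 (deriv (deriv g)) x)"
    using assms(1) unfolding second_order_def by blast
  obtain B where B: "\<And>k x. \<bar>f k x\<bar> \<le> B" "\<And>k x. \<bar>deriv (f k) x\<bar> \<le> B" "\<And>k x. \<bar>deriv (deriv (f k)) x\<bar> \<le> B"
    and C: "\<And>k. Cb 2 (f k)" "Cb 2 g"
    and lim: "\<And>x. (\<lambda>k. f k x) \<longlonglongrightarrow> g x" "\<And>x. (\<lambda>k. deriv (f k) x) \<longlonglongrightarrow> deriv g x"
        "\<And>x. (\<lambda>k. deriv (deriv (f k)) x) \<longlonglongrightarrow> deriv (deriv g) x"
    using assms(2) unfolding bp_conv2_def by blast
  have m: "f k \<in> borel_measurable borel" "g \<in> borel_measurable borel"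
    "deriv (deriv (f k)) \<in> borel_measurable borel" "deriv (deriv g) \<in> borel_measurable borel" for k
    using Cb_measurable[OF C(1)] Cb_measurable[OF C(2)] Cb_measurable[OF Cb_deriv2[of 0 "f k"]]
      Cb_measurable[OF Cb_deriv2[of 0 g]] C unfolding numeral_2_eq_2 by blast+
  show "(\<lambda>k. T (f k) x) \<longlonglongrightarrow> T g x"
    unfolding T[OF C(1)] T[OF C(2)]
    by (intro tendsto_intros lim finite_borel_measure.conv_op_tendsto[where B = B] k m B)
  define C where "C = \<bar>a0\<bar> * B + \<bar>a1\<bar> * B + \<bar>a2\<bar> * B + B * measure \<kappa>1 UNIV + B * measure \<kappa>2 UNIV"
  have "\<bar>T (f k) x\<bar> \<le> C" for k x
    unfolding T[OF \<open>Cb 2 (f k)\<close>] C_def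
    by (intro order_trans[OF abs_triangle_ineq] add_mono
       finite_borel_measure.conv_op_bound k B) (auto simp: abs_mult B intro!: mult_left_mono)
  then show "\<exists>B. \<forall>k x. \<bar>T (f k) x\<bar> \<le> B" by auto
qed

section \<open>Trigonometric approximation\<close>

text \<open>The phase covers the sines, and u = 0 gives the constants, so this is the space of real
  trigonometric polynomials with arbitrary frequencies.\<close>

inductive_set trig :: "(real \<Rightarrow> real) set" where
  trig_cos: "(\<lambda>x. cos (u * x + \<theta>)) \<in> trig"
| trig_lincomb: "f \<in> trig \<Longrightarrow> g \<in> trig \<Longrightarrow> (\<lambda>x. a * f x + b * g x) \<in> trig"

text \<open>The derivative is u times the cosine whose phase is shifted by pi / 2, so the induction
  has to run over all phases at once.\<close>

lemma Cb_cos: "Cb r (\<lambda>x. cos (u * x + \<theta>))"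
proof (induction r arbitrary: \<theta>)
  case 0
  show ?case by (auto simp: bounded_iff intro!: continuous_intros exI[of _ 1])
next
  case (Suc r)
  have "cos (u * x + (\<theta> + pi / 2)) = - sin (u * x + \<theta>)" for x
    using cos_add[of "u * x + \<theta>" "pi / 2"] by (simp add: add.assoc)
  then have "((\<lambda>x. cos (u * x + \<theta>)) has_real_derivative u * cos (u * x + (\<theta> + pi / 2))) (at x)" for x
    by (auto intro!: derivative_eq_intros)
  then show ?case
    by (rule Cb_SucI) (auto intro!: Cb_cmult Suc simp: bounded_iff intro!: exI[of _ 1])
qed

lemma trig_Cb: "f \<in> trig \<Longrightarrow> Cb r f"
  by (induction rule: trig.induct) (auto intro: Cb_cos Cb_lincomb)

text \<open>Product-to-sum formula, with sines read as cosines of phase - pi / 2. Repeated use turns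
  powers of a sine into trigonometric polynomials.\<close>

lemma trig_mult_sin: "f \<in> trig \<Longrightarrow> (\<lambda>x. sin (w * x) * f x) \<in> trig"
proof (induction rule: trig.induct)
  case (trig_cos u \<theta>)
  have "sin (w * x) * cos (u * x + \<theta>)
     = 1 / 2 * cos ((w + u) * x + (\<theta> - pi / 2)) + 1 / 2 * cos ((w - u) * x + (- \<theta> - pi / 2))" for x
  proof -
    have "cos ((w + u) * x + (\<theta> - pi / 2)) = sin (w * x + (u * x + \<theta>))"
      using cos_diff[of "w * x + (u * x + \<theta>)" "pi / 2"] by (simp add: algebra_simps)
    moreover have "cos ((w - u) * x + (- \<theta> - pi / 2)) = sin (w * x - (u * x + \<theta>))"
      using cos_diff[of "w * x - (u * x + \<theta>)" "pi / 2"] by (simp add: algebra_simps)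
    ultimately show ?thesis
      using sin_add[of "w * x" "u * x + \<theta>"] sin_diff[of "w * x" "u * x + \<theta>"] by linarith
  qed
  then show ?case by (simp only:) (intro trig.intros)
next
  case (trig_lincomb f g a b)
  have "sin (w * x) * (a * f x + b * g x) = a * (sin (w * x) * f x) + b * (sin (w * x) * g x)" for x
    by (simp add: algebra_simps)
  then show ?case using trig_lincomb by (simp only:) (intro trig.intros)
qed

lemma trig_poly_sin: "(\<lambda>x. \<Sum>i\<in>A. a i * (R * sin (w * x)) ^ (k i :: nat)) \<in> trig"
proof -
  have const: "(\<lambda>x. c) \<in> trig" for c
    using trig_lincomb[OF trig_cos[of 0 0] trig_cos[of 0 0], of c 0] by simp
  have pow: "(\<lambda>x. (R * sin (w * x)) ^ j) \<in> trig" for j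
  proof (induction j)
    case (Suc j)
    then have "(\<lambda>x. R * (sin (w * x) * (R * sin (w * x)) ^ j) + 0 * 0) \<in> trig"
      by (intro trig_lincomb trig_mult_sin const)
    then show ?case by (simp add: algebra_simps)
  qed (use const in auto)
  show ?thesis
  proof (induction A rule: infinite_finite_induct)
    case (insert i A)
    then show ?case using trig_lincomb[OF pow insert.IH, of "a i" "k i" 1] by simp
  qed (use const in auto)
qed

lemma deriv_comp_sin:
  assumes "\<And>x. (p has_real_derivative p1 x) (at x)" "\<And>x. (p1 has_real_derivative p2 x) (at x)" "R \<noteq> 0"
  shows "deriv (\<lambda>x. p (R * sin (x / R))) = (\<lambda>x. p1 (R * sin (x / R)) * cos (x / R))"
    and "deriv (\<lambda>x. p1 (R * sin (x / R)) * cos (x / R))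
      = (\<lambda>x. p2 (R * sin (x / R)) * (cos (x / R))\<^sup>2 - p1 (R * sin (x / R)) * sin (x / R) / R)"
proof -
  have s: "((\<lambda>x. R * sin (x / R)) has_real_derivative cos (x / R)) (at x)" for x
    using assms(3) by (auto intro!: derivative_eq_intros)
  have "((\<lambda>x. p (R * sin (x / R))) has_real_derivative p1 (R * sin (x / R)) * cos (x / R)) (at x)" for x
    by (rule DERIV_chain2[OF assms(1) s])
  then show "deriv (\<lambda>x. p (R * sin (x / R))) = (\<lambda>x. p1 (R * sin (x / R)) * cos (x / R))"
    by (auto intro!: DERIV_imp_deriv)
  have c: "((\<lambda>x. cos (x / R)) has_real_derivative - sin (x / R) / R) (at x)" for x
    using assms(3) by (auto intro!: derivative_eq_intros)
  have "((\<lambda>x. p1 (R * sin (x / R)) * cos (x / R)) has_real_derivative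
       p2 (R * sin (x / R)) * (cos (x / R))\<^sup>2 - p1 (R * sin (x / R)) * sin (x / R) / R) (at x)" for x
    using DERIV_mult[OF DERIV_chain2[OF assms(2) s[of x]] c[of x]]
    by (simp add: power2_eq_square algebra_simps)
  then show "deriv (\<lambda>x. p1 (R * sin (x / R)) * cos (x / R))
      = (\<lambda>x. p2 (R * sin (x / R)) * (cos (x / R))\<^sup>2 - p1 (R * sin (x / R)) * sin (x / R) / R)"
    by (auto intro!: DERIV_imp_deriv)
qed

text \<open>With R = k + 1 this is the difference quotient at 0 of h \<mapsto> sin (x h) for the
  increment h = 1 / R.\<close>

lemma sin_scaled_tendsto: "(\<lambda>k. real (Suc k) * sin (x / real (Suc k))) \<longlonglongrightarrow> x"
proof -
  have "((\<lambda>h. sin (x * h)) has_real_derivative x) (at 0)"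
    by (auto intro!: derivative_eq_intros)
  then have "((\<lambda>h. sin (x * h) / h) \<longlongrightarrow> x) (at 0)"
    by (simp add: has_field_derivative_iff)
  moreover have "filterlim (\<lambda>k. inverse (real (Suc k))) (at 0) sequentially"
    using LIMSEQ_inverse_real_of_nat by (auto simp: filterlim_at)
  ultimately have "(\<lambda>k. sin (x * inverse (real (Suc k))) / inverse (real (Suc k))) \<longlonglongrightarrow> x"
    by (rule filterlim_compose)
  then show ?thesis by (simp add: divide_inverse mult.commute)
qed

lemma Cb_comp_sin:
  assumes "Cb 2 g" "R \<noteq> 0"
  shows "Cb 2 (\<lambda>x. g (R * sin (x / R)))"
proof -
  have g1: "(g has_real_derivative deriv g x) (at x)"
    and g2: "(deriv g has_real_derivative deriv (deriv g) x) (at x)" for x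
    using assms(1) by (simp_all add: Cb_2D)
  obtain B0 B1 B2 where B: "\<And>x. \<bar>g x\<bar> \<le> B0" "\<And>x. \<bar>deriv g x\<bar> \<le> B1" "\<And>x. \<bar>deriv (deriv g) x\<bar> \<le> B2"
    using assms(1) by (metis Cb_2D(1,3,5) Cb_bound)
  have cont: "continuous_on UNIV g" "continuous_on UNIV (deriv g)" "continuous_on UNIV (deriv (deriv g))"
    using assms(1) by (metis Cb_2D(1,3,5) Cb_continuous)+
  have comp: "continuous_on UNIV (\<lambda>x. h (R * sin (x / R)))" if "continuous_on UNIV h" for h :: "real \<Rightarrow> real"
    using assms(2) by (intro continuous_on_compose2[OF that] continuous_intros) auto
  have s: "((\<lambda>x. R * sin (x / R)) has_real_derivative cos (x / R)) (at x)" for x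
    using assms(2) by (auto intro!: derivative_eq_intros)
  have c: "((\<lambda>x. cos (x / R)) has_real_derivative - sin (x / R) / R) (at x)" for x
    using assms(2) by (auto intro!: derivative_eq_intros)
  define d1 where "d1 x = deriv g (R * sin (x / R)) * cos (x / R)" for x
  define d2 where "d2 x = deriv (deriv g) (R * sin (x / R)) * (cos (x / R))\<^sup>2
     - deriv g (R * sin (x / R)) * sin (x / R) / R" for x
  have D1: "((\<lambda>x. g (R * sin (x / R))) has_real_derivative d1 x) (at x)" for x
    unfolding d1_def by (rule DERIV_chain2[OF g1 s])
  have D2: "(d1 has_real_derivative d2 x) (at x)" for x
    unfolding d1_def[abs_def] d2_def
    using DERIV_mult[OF DERIV_chain2[OF g2 s[of x]] c[of x]]
    by (simp add: power2_eq_square algebra_simps)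
  have m: "\<bar>a * b\<bar> \<le> C" if "\<bar>a\<bar> \<le> C" "\<bar>b\<bar> \<le> 1" for a b C :: real
    using mult_mono[OF that] that by (auto simp: abs_mult)
  have "\<bar>d1 x\<bar> \<le> B1" for x
    unfolding d1_def by (intro m B) auto
  moreover have "\<bar>d2 x\<bar> \<le> B2 + B1 / \<bar>R\<bar>" for x
    unfolding d2_def by (intro order_trans[OF abs_triangle_ineq4] add_mono m B)
      (auto simp: abs_divide power_le_one abs_square_le_1 intro!: divide_right_mono m B)
  moreover have "continuous_on UNIV d2"
    unfolding d2_def using assms(2) by (intro continuous_intros comp cont) auto
  ultimately have "Cb (Suc (Suc 0)) (\<lambda>x. g (R * sin (x / R)))"
    using B(1) by (intro Cb_SucI[OF D1] Cb_SucI[OF D2]) (auto simp: bounded_iff)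
  then show ?thesis by (simp only: numeral_2_eq_2)
qed

text \<open>With R = k + 1, the chain rule produces factors cos (x / R) tending to 1 and one
  correction of order 1 / R. As R \<ge> 1, all bounds are independent of k.\<close>

lemma bp_conv2_comp_sin:
  assumes "Cb 2 g"
  shows "bp_conv2 (\<lambda>k x. g (real (Suc k) * sin (x / real (Suc k)))) g"
proof -
  have g1: "(g has_real_derivative deriv g x) (at x)"
    and g2: "(deriv g has_real_derivative deriv (deriv g) x) (at x)" for x
    using assms(1) by (simp_all add: Cb_2D)
  obtain B0 B1 B2 where B: "\<And>x. \<bar>g x\<bar> \<le> B0" "\<And>x. \<bar>deriv g x\<bar> \<le> B1" "\<And>x. \<bar>deriv (deriv g) x\<bar> \<le> B2"
    using assms(1) by (metis Cb_2D(1,3,5) Cb_bound)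
  have pos: "0 \<le> B0" "0 \<le> B1" "0 \<le> B2" using B by (meson abs_ge_zero order_trans)+
  have cont: "continuous_on UNIV g" "continuous_on UNIV (deriv g)" "continuous_on UNIV (deriv (deriv g))"
    using assms(1) by (metis Cb_2D(1,3,5) Cb_continuous)+
  have m: "\<bar>a * b\<bar> \<le> C" if "\<bar>a\<bar> \<le> C" "\<bar>b\<bar> \<le> 1" for a b C :: real
    using mult_mono[OF that] that by (auto simp: abs_mult)
  have R: "real (Suc k) \<noteq> 0" for k by simp
  have lim: "(\<lambda>k. h (real (Suc k) * sin (x / real (Suc k)))) \<longlonglongrightarrow> h x" if "continuous_on UNIV h" for h :: "real \<Rightarrow> real" and x
    by (rule continuous_on_tendsto_compose[OF that sin_scaled_tendsto]) auto
  have z: "(\<lambda>k. x / real (Suc k)) \<longlonglongrightarrow> 0" for x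
    by (rule LIMSEQ_Suc[of "\<lambda>k. x / real k"]) (rule lim_const_over_n)
  have z1: "(\<lambda>k. cos (x / real (Suc k))) \<longlonglongrightarrow> 1" for x
    using tendsto_cos[OF z[of x]] by simp
  have z2: "(\<lambda>k. sin (x / real (Suc k)) / real (Suc k)) \<longlonglongrightarrow> 0" for x
    using tendsto_mult[OF tendsto_sin[OF z[of x]] z[of 1]] by simp
  have b0: "\<bar>d * sin (x / real (Suc k)) / real (Suc k)\<bar> \<le> B1" if "\<bar>d\<bar> \<le> B1" for d x k
  proof -
    have "\<bar>sin (x / real (Suc k)) / real (Suc k)\<bar> \<le> 1"
      using abs_sin_le_one[of "x / real (Suc k)"] by (simp add: abs_divide divide_le_eq del: abs_sin_le_one)
    then show ?thesis using m[OF that] by (simp add: mult.assoc flip: times_divide_eq_right)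
  qed
  have "\<bar>(cos z)\<^sup>2\<bar> \<le> (1::real)" for z by (simp add: abs_square_le_1)
  then have "\<bar>deriv (deriv g) z * (cos (x / real (Suc k)))\<^sup>2
     - deriv g z * sin (x / real (Suc k)) / real (Suc k)\<bar> \<le> B2 + B1" for z x k
    by (intro order_trans[OF abs_triangle_ineq4] add_mono m[OF B(3)] b0[OF B(2)])
  note b2 = this
  have l2: "(\<lambda>k. deriv (deriv g) (real (Suc k) * sin (x / real (Suc k))) * (cos (x / real (Suc k)))\<^sup>2
     - deriv g (real (Suc k) * sin (x / real (Suc k))) * sin (x / real (Suc k)) / real (Suc k))
     \<longlonglongrightarrow> deriv (deriv g) x" for x
    using tendsto_diff[OF tendsto_mult[OF lim[OF cont(3)] tendsto_power[OF z1[of x], of 2]] tendsto_mult[OF lim[OF cont(2)] z2[of x]]]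
    by simp
  have l1: "(\<lambda>k. deriv g (real (Suc k) * sin (x / real (Suc k))) * cos (x / real (Suc k)))
     \<longlonglongrightarrow> deriv g x" for x
    using tendsto_mult[OF lim[OF cont(2)] z1[of x]] by simp
  have b1: "\<bar>deriv g z * cos w\<bar> \<le> B2 + B1" for z w
    using m[OF B(2)[of z], of "cos w"] pos by auto
  show ?thesis
    unfolding bp_conv2_def deriv_comp_sin[OF g1 g2 R]
  proof (intro conjI allI exI[of _ "B0 + B1 + B2"])
    fix k x
    show "\<bar>g (real (Suc k) * sin (x / real (Suc k)))\<bar> \<le> B0 + B1 + B2"
      using B(1)[of "real (Suc k) * sin (x / real (Suc k))"] pos by linarith
    show "\<bar>deriv g (real (Suc k) * sin (x / real (Suc k))) * cos (x / real (Suc k))\<bar> \<le> B0 + B1 + B2"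
      by (rule order_trans[OF b1]) (use pos in simp)
    show "\<bar>deriv (deriv g) (real (Suc k) * sin (x / real (Suc k))) * (cos (x / real (Suc k)))\<^sup>2
       - deriv g (real (Suc k) * sin (x / real (Suc k))) * sin (x / real (Suc k)) / real (Suc k)\<bar> \<le> B0 + B1 + B2"
      by (rule order_trans[OF b2]) (use pos in simp)
  qed (rule Cb_comp_sin[OF assms R] assms lim[OF cont(1)] l1 l2)+
qed

text \<open>Weierstrass is applied to the second derivative only, and the polynomial is then
  integrated twice with the initial values of \<open>g\<close> and \<open>deriv g\<close> at 0. Each
  integration over \<open>{-R..R}\<close> costs a factor R in the error.\<close>

lemma poly_C2_approx:
  assumes "Cb 2 g" "R > 0" "e > 0"
  obtains a :: "nat \<Rightarrow> real" and n p1 p2 where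
    "\<And>x. ((\<lambda>x. \<Sum>i\<le>n. a i * x ^ i) has_real_derivative p1 x) (at x)"
    "\<And>x. (p1 has_real_derivative p2 x) (at x)"
    "\<And>x. x \<in> {-R..R} \<Longrightarrow> \<bar>(\<Sum>i\<le>n. a i * x ^ i) - g x\<bar> \<le> e * R * R"
    "\<And>x. x \<in> {-R..R} \<Longrightarrow> \<bar>p1 x - deriv g x\<bar> \<le> e * R"
    "\<And>x. x \<in> {-R..R} \<Longrightarrow> \<bar>p2 x - deriv (deriv g) x\<bar> \<le> e"
proof -
  have g1: "(g has_real_derivative deriv g x) (at x)"
    and g2: "(deriv g has_real_derivative deriv (deriv g) x) (at x)" for x
    using assms(1) by (simp_all add: Cb_2D)
  have "continuous_on {-R..R} (deriv (deriv g))"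
    using assms(1) Cb_continuous[of 0 "deriv (deriv g)"] by (auto simp: numeral_2_eq_2 intro: continuous_on_subset)
  then obtain q where q: "real_polynomial_function q" "\<And>x. x \<in> {-R..R} \<Longrightarrow> \<bar>deriv (deriv g) x - q x\<bar> < e"
    using Stone_Weierstrass_real_polynomial_function[of "{-R..R}" "deriv (deriv g)" e] assms by auto
  obtain b n where b: "q = (\<lambda>x. \<Sum>i\<le>n. b i * x ^ i)"
    using q(1) real_polynomial_function_iff_sum by auto
  \<comment> \<open>Coefficients of the double primitive: the divisor undoes two differentiations,
    and the two lowest coefficients are the initial values at 0.\<close>
  define a where "a i = (case i of 0 \<Rightarrow> g 0 | Suc 0 \<Rightarrow> deriv g 0
     | Suc (Suc j) \<Rightarrow> b j / (real (Suc j) * real (Suc (Suc j))))" for i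
  define p1 where "p1 x = deriv g 0 + (\<Sum>i\<le>n. b i / real (Suc i) * x ^ Suc i)" for x
  have p: "(\<Sum>i\<le>Suc (Suc n). a i * x ^ i) = g 0 + deriv g 0 * x + (\<Sum>i\<le>n. b i / (real (Suc i) * real (Suc (Suc i))) * x ^ Suc (Suc i))" for x
    by (subst sum.atMost_Suc_shift, subst sum.atMost_Suc_shift) (simp add: a_def add.assoc)
  have D1: "((\<lambda>x. \<Sum>i\<le>Suc (Suc n). a i * x ^ i) has_real_derivative p1 x) (at x)" for x
  proof -
    have "((\<lambda>x. b i / (real (Suc i) * real (Suc (Suc i))) * x ^ Suc (Suc i)) has_real_derivative b i / real (Suc i) * x ^ Suc i) (at x)" for i
    proof -
      have "((\<lambda>x. b i / (real (Suc i) * real (Suc (Suc i))) * x ^ Suc (Suc i)) has_real_derivative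
         b i / (real (Suc i) * real (Suc (Suc i))) * (real (Suc (Suc i)) * x ^ Suc i)) (at x)"
        using DERIV_pow[of "Suc (Suc i)" x UNIV] by (intro DERIV_cmult) (simp del: power_Suc of_nat_Suc)
      moreover have "b i / (real (Suc i) * real (Suc (Suc i))) * (real (Suc (Suc i)) * x ^ Suc i) = b i / real (Suc i) * x ^ Suc i"
        by simp
      ultimately show ?thesis by (simp only:)
    qed
    then have "((\<lambda>x. \<Sum>i\<le>n. b i / (real (Suc i) * real (Suc (Suc i))) * x ^ Suc (Suc i)) has_real_derivative (\<Sum>i\<le>n. b i / real (Suc i) * x ^ Suc i)) (at x)"
      by (intro DERIV_sum) auto
    moreover have "((\<lambda>x. g 0 + deriv g 0 * x) has_real_derivative deriv g 0) (at x)"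
      by (auto intro!: derivative_eq_intros)
    ultimately show ?thesis unfolding p p1_def by (intro DERIV_add)
  qed
  have D2: "(p1 has_real_derivative q x) (at x)" for x
  proof -
    have "((\<lambda>x. b i / real (Suc i) * x ^ Suc i) has_real_derivative b i * x ^ i) (at x)" for i
    proof -
      have "((\<lambda>x. b i / real (Suc i) * x ^ Suc i) has_real_derivative b i / real (Suc i) * (real (Suc i) * x ^ i)) (at x)"
        using DERIV_pow[of "Suc i" x UNIV] by (intro DERIV_cmult) (simp del: power_Suc of_nat_Suc)
      moreover have "b i / real (Suc i) * (real (Suc i) * x ^ i) = b i * x ^ i"
        by simp
      ultimately show ?thesis by (simp only:)
    qed
    then have "((\<lambda>x. \<Sum>i\<le>n. b i / real (Suc i) * x ^ Suc i) has_real_derivative q x) (at x)"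
      unfolding b by (intro DERIV_sum) auto
    from DERIV_add[OF DERIV_const this] show ?thesis unfolding p1_def[abs_def] by simp
  qed
  \<comment> \<open>Mean value inequality for the difference of the two functions, started from
    their common value at 0.\<close>
  have int: "\<bar>h x - h' x\<bar> \<le> c * R" if "h 0 = h' 0" "x \<in> {-R..R}" "\<And>x. x \<in> {-R..R} \<Longrightarrow> \<bar>d x - d' x\<bar> \<le> c"
    "\<And>x. (h has_real_derivative d x) (at x)" "\<And>x. (h' has_real_derivative d' x) (at x)"
    for h h' d d' and x c :: real
  proof -
    have d: "((\<lambda>x. h x - h' x) has_real_derivative d z - d' z) (at z within {-R..R})" for z
      by (rule has_field_derivative_at_within[OF DERIV_diff[OF that(4,5)]])
    have "norm ((h x - h' x) - (h 0 - h' 0)) \<le> c * norm (x - 0)"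
      by (rule field_differentiable_bound[where S = "{-R..R}" and f = "\<lambda>x. h x - h' x" and f' = "\<lambda>x. d x - d' x", OF _ d])
        (use that(2,3) assms(2) in simp_all)
    moreover have "0 \<le> c" using that(3)[OF that(2)] by (meson abs_ge_zero order_trans)
    moreover have "c * \<bar>x\<bar> \<le> c * R" using that(2) \<open>0 \<le> c\<close> by (intro mult_left_mono) auto
    ultimately show ?thesis using that(1) by auto
  qed
  have e2: "\<bar>q x - deriv (deriv g) x\<bar> \<le> e" if "x \<in> {-R..R}" for x
    using q(2)[OF that] by (simp add: abs_minus_commute)
  have e1: "\<bar>p1 x - deriv g x\<bar> \<le> e * R" if "x \<in> {-R..R}" for x
    by (rule int[OF _ that e2 D2 g2]) (auto simp: p1_def)
  have e0: "\<bar>(\<Sum>i\<le>Suc (Suc n). a i * x ^ i) - g x\<bar> \<le> e * R * R" if "x \<in> {-R..R}" for x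
    by (rule int[OF _ that e1 D1 g1]) (auto simp: p a_def)
  show ?thesis by (rule that[OF D1 D2 e0 e1 e2])
qed

text \<open>The functions \<open>x \<mapsto> g (R sin (x / R))\<close> converge to \<open>g\<close> as \<open>R\<close> tends to infinity, with uniformly
  bounded derivatives, and only the values of \<open>g\<close> on \<open>[-R, R]\<close> enter; there \<open>g\<close> is approximated
  by polynomials, which turn into trigonometric polynomials.\<close>

theorem trig_bp_dense:
  assumes trig: "\<And>f. f \<in> trig \<Longrightarrow> P f"
    and bp: "\<And>f g. (\<And>k. P (f k)) \<Longrightarrow> bp_conv2 f g \<Longrightarrow> P g"
    and g: "Cb 2 g"
  shows "P g"
proof -
  \<comment> \<open>First limit, with R fixed: the polynomials approximate g on [-R, R] with error
    of order 1 / (k + 1), and R sin (x / R) never leaves this interval.\<close>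
  have "P (\<lambda>x. g (R * sin (x / R)))" if R: "R > 0" for R
  proof -
    define E where "E k a n p1 p2 \<longleftrightarrow>
      (\<forall>x. ((\<lambda>x. \<Sum>i\<le>n. a i * x ^ i) has_real_derivative p1 x) (at x)) \<and>
      (\<forall>x. (p1 has_real_derivative p2 x) (at x)) \<and>
      (\<forall>x\<in>{-R..R}. \<bar>(\<Sum>i\<le>n. a i * x ^ i) - g x\<bar> \<le> (1 / real (Suc k)) * R * R) \<and>
      (\<forall>x\<in>{-R..R}. \<bar>p1 x - deriv g x\<bar> \<le> (1 / real (Suc k)) * R) \<and>
      (\<forall>x\<in>{-R..R}. \<bar>p2 x - deriv (deriv g) x\<bar> \<le> 1 / real (Suc k))"
      for k :: nat and a :: "nat \<Rightarrow> real" and n :: nat and p1 p2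
    have "\<exists>a n p1 p2. E k a n p1 p2" for k
    proof (rule poly_C2_approx[OF g R, of "1 / real (Suc k)"])
      fix a n p1 p2
      assume *: "\<And>x. ((\<lambda>x. \<Sum>i\<le>n. a i * x ^ i) has_real_derivative p1 x) (at x)"
        "\<And>x. (p1 has_real_derivative p2 x) (at x)"
        "\<And>x. x \<in> {-R..R} \<Longrightarrow> \<bar>(\<Sum>i\<le>n. a i * x ^ i) - g x\<bar> \<le> 1 / real (Suc k) * R * R"
        "\<And>x. x \<in> {-R..R} \<Longrightarrow> \<bar>p1 x - deriv g x\<bar> \<le> 1 / real (Suc k) * R"
        "\<And>x. x \<in> {-R..R} \<Longrightarrow> \<bar>p2 x - deriv (deriv g) x\<bar> \<le> 1 / real (Suc k)"
      have "E k a n p1 p2" unfolding E_def by (intro conjI allI ballI *)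
      then show ?thesis by metis
    qed simp
    then obtain a n p1 p2 where E: "\<And>k. E k (a k) (n k) (p1 k) (p2 k)" by metis
    define p where "p k x = (\<Sum>i\<le>n k. a k i * x ^ i)" for k x
    have D: "(p k has_real_derivative p1 k x) (at x)" "(p1 k has_real_derivative p2 k x) (at x)" for k x
      using E[of k] unfolding E_def p_def[abs_def] by blast+
    have e: "\<bar>p k x - g x\<bar> \<le> (1 / real (Suc k)) * R * R" "\<bar>p1 k x - deriv g x\<bar> \<le> (1 / real (Suc k)) * R"
      "\<bar>p2 k x - deriv (deriv g) x\<bar> \<le> 1 / real (Suc k)" if "x \<in> {-R..R}" for x k
      using E[of k] that unfolding E_def p_def[abs_def] by blast+
    have g1: "(g has_real_derivative deriv g x) (at x)"
      and g2: "(deriv g has_real_derivative deriv (deriv g) x) (at x)" for x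
      using g by (simp_all add: Cb_2D)
    obtain B0 B1 B2 where B: "\<And>x. \<bar>g x\<bar> \<le> B0" "\<And>x. \<bar>deriv g x\<bar> \<le> B1" "\<And>x. \<bar>deriv (deriv g) x\<bar> \<le> B2"
      using g by (metis Cb_2D(1,3,5) Cb_bound)
    have pos: "0 \<le> B0" "0 \<le> B1" "0 \<le> B2" using B by (meson abs_ge_zero order_trans)+
    define S where "S x = R * sin (x / R)" for x
    have S: "S x \<in> {-R..R}" for x
    proof -
      have "R * (-1) \<le> S x" "S x \<le> R * 1" unfolding S_def using R by (intro mult_left_mono; simp)+
      then show ?thesis by auto
    qed
    have lim0: "(\<lambda>k. h k) \<longlonglongrightarrow> l" if "\<And>k. \<bar>h k - l\<bar> \<le> (1 / real (Suc k)) * c" for h and l c :: real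
    proof -
      have "(\<lambda>k. (1 / real (Suc k)) * c) \<longlonglongrightarrow> 0"
        using tendsto_mult[OF LIMSEQ_Suc[OF lim_const_over_n[of 1]] tendsto_const[of c]] by simp
      then have "(\<lambda>k. h k - l) \<longlonglongrightarrow> 0" by (rule Lim_null_comparison[rotated]) (use that in auto)
      then show ?thesis by (simp add: LIM_zero_iff)
    qed
    have l: "(\<lambda>k. p k (S x)) \<longlonglongrightarrow> g (S x)" "(\<lambda>k. p1 k (S x)) \<longlonglongrightarrow> deriv g (S x)"
      "(\<lambda>k. p2 k (S x)) \<longlonglongrightarrow> deriv (deriv g) (S x)" for x
      using lim0[OF e(1)[OF S, unfolded mult.assoc]] lim0[OF e(2)[OF S]] lim0[where c = 1, OF order_trans[OF e(3)[OF S] eq_refl]]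
      by simp_all
    have inv: "1 / real (Suc k) * c \<le> c" if "c \<ge> 0" for c k
      using that by (simp add: divide_le_eq mult_le_cancel_left1)
    have b: "\<bar>p k (S x)\<bar> \<le> B0 + R * R" "\<bar>p1 k (S x)\<bar> \<le> B1 + R" "\<bar>p2 k (S x)\<bar> \<le> B2 + 1" for k x
    proof -
      have "\<bar>p k (S x) - g (S x)\<bar> \<le> R * R"
        by (rule order_trans[OF e(1)[OF S, unfolded mult.assoc] inv]) simp
      then show "\<bar>p k (S x)\<bar> \<le> B0 + R * R" using B(1)[of "S x"] by linarith
      have "\<bar>p1 k (S x) - deriv g (S x)\<bar> \<le> R"
        by (rule order_trans[OF e(2)[OF S] inv]) (use R in simp)
      then show "\<bar>p1 k (S x)\<bar> \<le> B1 + R" using B(2)[of "S x"] by linarith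
      have "\<bar>p2 k (S x) - deriv (deriv g) (S x)\<bar> \<le> 1"
        by (rule order_trans[OF e(3)[OF S]]) simp
      then show "\<bar>p2 k (S x)\<bar> \<le> B2 + 1" using B(3)[of "S x"] by linarith
    qed
    have m: "\<bar>a * b\<bar> \<le> C" if "\<bar>a\<bar> \<le> C" "\<bar>b\<bar> \<le> 1" for a b C :: real
      using mult_mono[OF that] that by (auto simp: abs_mult)
    have R0: "R \<noteq> 0" using R by simp
    have tr: "(\<lambda>x. p k (S x)) \<in> trig" for k
      using trig_poly_sin[of "a k" R "1 / R" "\<lambda>i. i" "{..n k}"] by (simp add: p_def S_def)
    define C where "C = B0 + R * R + (B1 + R) + (B2 + 1) + (B1 + R) / R"
    have C: "B0 + R * R \<le> C" "B1 + R \<le> C" "B2 + 1 + (B1 + R) / R \<le> C"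
      unfolding C_def using pos R by auto
    have dp: "deriv (\<lambda>x. p k (S x)) = (\<lambda>x. p1 k (S x) * cos (x / R))"
      "deriv (\<lambda>x. p1 k (S x) * cos (x / R)) = (\<lambda>x. p2 k (S x) * (cos (x / R))\<^sup>2 - p1 k (S x) * sin (x / R) / R)" for k
      unfolding S_def by (rule deriv_comp_sin[OF D R0])+
    have dg: "deriv (\<lambda>x. g (S x)) = (\<lambda>x. deriv g (S x) * cos (x / R))"
      "deriv (\<lambda>x. deriv g (S x) * cos (x / R)) = (\<lambda>x. deriv (deriv g) (S x) * (cos (x / R))\<^sup>2 - deriv g (S x) * sin (x / R) / R)"
      unfolding S_def by (rule deriv_comp_sin[OF g1 g2 R0])+
    have "\<bar>p1 k (S x) * cos (x / R)\<bar> \<le> B1 + R" for k x by (intro m b) auto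
    moreover have "\<bar>p2 k (S x) * (cos (x / R))\<^sup>2 - p1 k (S x) * sin (x / R) / R\<bar> \<le> B2 + 1 + (B1 + R) / R" for k x
      by (intro order_trans[OF abs_triangle_ineq4] add_mono m b)
        (use R in \<open>auto simp: abs_divide abs_square_le_1 intro!: divide_right_mono m b\<close>)
    ultimately have bb: "\<bar>p k (S x)\<bar> \<le> C \<and> \<bar>deriv (\<lambda>x. p k (S x)) x\<bar> \<le> C \<and> \<bar>deriv (deriv (\<lambda>x. p k (S x))) x\<bar> \<le> C" for k x
      unfolding dp using b(1) C by (meson order_trans)
    have "bp_conv2 (\<lambda>k x. p k (S x)) (\<lambda>x. g (S x))"
      unfolding bp_conv2_def
    proof (intro conjI allI)
      show "Cb 2 (\<lambda>x. p k (S x))" for k by (rule trig_Cb[OF tr])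
      show "Cb 2 (\<lambda>x. g (S x))" unfolding S_def by (rule Cb_comp_sin[OF g R0])
      show "\<exists>B. \<forall>k x. \<bar>p k (S x)\<bar> \<le> B \<and> \<bar>deriv (\<lambda>x. p k (S x)) x\<bar> \<le> B \<and> \<bar>deriv (deriv (\<lambda>x. p k (S x))) x\<bar> \<le> B"
        using bb by blast
    qed (unfold dp dg, auto intro!: tendsto_intros l simp: R0)
    then have "P (\<lambda>x. g (S x))" by (rule bp[rotated]) (rule trig[OF tr])
    then show ?thesis by (simp add: S_def)
  qed
  \<comment> \<open>Second limit: R = k + 1 tends to infinity.\<close>
  then show ?thesis by (intro bp[OF _ bp_conv2_comp_sin[OF g]]) auto
qed

section \<open>Characteristic functions of integrals against a Poisson random measure\<close>

text \<open>A priori N takes arbitrary values in \<open>ennreal\<close>; but the point probabilities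
  at the natural numbers add up to 1, so almost every value is one of them. The characteristic
  function is then an exponential series whose partial sums are dominated by 1.\<close>

lemma (in prob_space)
  fixes N :: "'a \<Rightarrow> ennreal" and v u a :: real
  assumes N[measurable]: "N \<in> borel_measurable M"
    and P: "\<And>k::nat. prob {w \<in> space M. N w = of_nat k} = exp (- a) * a ^ k / fact k"
  shows poisson_AE_nat: "AE w in M. \<exists>k::nat. N w = of_nat k"
    and char_poisson: "char (distr M borel (\<lambda>w. v * enn2real (N w))) u = exp (a * (iexp (u * v) - 1))"
proof -
  define \<Omega> where "\<Omega> k = {w \<in> space M. N w = of_nat k}" for k :: nat
  have [measurable]: "\<Omega> k \<in> events" for k unfolding \<Omega>_def by measurable
  have disj: "disjoint_family \<Omega>" unfolding \<Omega>_def disjoint_family_on_def by auto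
  have "(\<lambda>k. exp (- a) * (a ^ k / fact k)) sums (exp (- a) * exp a)"
    using exp_converges[of a] by (intro sums_mult) (simp add: divide_inverse mult.commute)
  then have "(\<lambda>k. prob (\<Omega> k)) sums 1"
    by (simp add: \<Omega>_def P exp_minus)
  moreover have "(\<lambda>k. prob (\<Omega> k)) sums prob (\<Union>k. \<Omega> k)"
    by (intro finite_measure_UNION disj) auto
  ultimately have "prob (\<Union>k. \<Omega> k) = 1" using sums_unique2 by blast
  then have "AE w in M. w \<in> (\<Union>k. \<Omega> k)" by (intro AE_prob_1) auto
  then show AEn: "AE w in M. \<exists>k::nat. N w = of_nat k" by eventually_elim (auto simp: \<Omega>_def)
  define c where "c k = iexp (u * (v * real k))" for k :: nat
  define S where "S n w = (\<Sum>k<n. indicator (\<Omega> k) w *\<^sub>R c k)" for n :: nat and w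
  have [measurable]: "S n \<in> borel_measurable M" for n
    unfolding S_def[abs_def] by measurable
  have S_eq: "S n w = (if k < n then c k else 0)" if "w \<in> \<Omega> k" for n w k
  proof -
    have "indicator (\<Omega> j) w = (if j = k then 1 else 0 :: real)" for j
      using that disj by (auto simp: disjoint_family_on_def indicator_def)
    then have "S n w = (\<Sum>j<n. if j = k then c j else 0)" unfolding S_def by (intro sum.cong) auto
    then show ?thesis by simp
  qed
  have "(\<lambda>n. integral\<^sup>L M (S n)) \<longlonglongrightarrow> (\<integral>w. iexp (u * (v * enn2real (N w))) \<partial>M)"
  proof (rule integral_dominated_convergence[where w = "\<lambda>_. 1"])
    show "AE w in M. (\<lambda>n. S n w) \<longlonglongrightarrow> iexp (u * (v * enn2real (N w)))"
      using AEn AE_space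
    proof eventually_elim
      case (elim w)
      then obtain k where k: "N w = of_nat k" by auto
      then have w: "w \<in> \<Omega> k" using elim by (auto simp: \<Omega>_def)
      have "eventually (\<lambda>n. S n w = c k) sequentially"
        using eventually_gt_at_top[of k] by eventually_elim (simp add: S_eq[OF w])
      then have "(\<lambda>n. S n w) \<longlonglongrightarrow> c k" by (rule tendsto_eventually)
      then show ?case by (simp add: c_def k)
    qed
    show "AE w in M. norm (S n w) \<le> 1" for n
      using AEn AE_space
    proof eventually_elim
      case (elim w)
      then obtain k where k: "N w = of_nat k" by auto
      then have w: "w \<in> \<Omega> k" using elim by (auto simp: \<Omega>_def)
      show ?case by (simp add: S_eq[OF w] c_def)
    qed
  qed simp_all
  moreover have "integral\<^sup>L M (S n) = (\<Sum>k<n. prob (\<Omega> k) *\<^sub>R c k)" for n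
  proof -
    have i: "integrable M (indicator (\<Omega> k) :: _ \<Rightarrow> real)" for k
      by (intro integrable_real_indicator) (auto simp: emeasure_eq_measure)
    show ?thesis
      unfolding S_def by (subst Bochner_Integration.integral_sum) (simp_all add: i integral_scaleR_left Bochner_Integration.integral_indicator)
  qed
  moreover have "(\<lambda>k. prob (\<Omega> k) *\<^sub>R c k) sums exp (a * (iexp (u * v) - 1))"
  proof -
    have c: "c k = iexp (u * v) ^ k" for k
      by (simp add: c_def exp_of_nat_mult[symmetric] algebra_simps)
    have "(\<lambda>k. of_real (exp (- a)) * ((a * iexp (u * v)) ^ k /\<^sub>R fact k)) sums
        (of_real (exp (- a)) * exp (a * iexp (u * v)))"
      by (intro sums_mult exp_converges)
    moreover have "of_real (exp (- a)) * ((a * iexp (u * v)) ^ k /\<^sub>R fact k) = prob (\<Omega> k) *\<^sub>R c k" for k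
      by (simp add: \<Omega>_def P c scaleR_conv_of_real power_mult_distrib divide_inverse mult_ac)
    moreover have "of_real (exp (- a)) * exp (a * iexp (u * v)) = exp (a * (iexp (u * v) - 1))"
      by (simp add: exp_of_real[symmetric] exp_add[symmetric] algebra_simps)
    ultimately show ?thesis by simp
  qed
  ultimately have "(\<integral>w. iexp (u * (v * enn2real (N w))) \<partial>M) = exp (a * (iexp (u * v) - 1))"
    unfolding sums_def using LIMSEQ_unique by auto
  then show "char (distr M borel (\<lambda>w. v * enn2real (N w))) u = exp (a * (iexp (u * v) - 1))"
    by (simp add: char_def integral_distr)
qed

section \<open>Levy measures and sums of jumps bounded away from 0\<close>

lemma levy_measure_facts:
  assumes "levy_measure \<nu>"
  shows "sigma_finite_measure \<nu>" "\<And>D \<delta>. D \<in> sets borel \<Longrightarrow> 0 < \<delta> \<Longrightarrow> D \<subseteq> {z. \<delta> < \<bar>z\<bar>} \<Longrightarrow> emeasure \<nu> D < \<infinity>"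
    "integrable \<nu> (\<lambda>z. min 1 (z\<^sup>2))"
proof -
  have s[measurable_cong]: "sets \<nu> = sets borel" and z: "emeasure \<nu> {0} = 0"
    and f: "(\<integral>\<^sup>+ x. ennreal (min 1 (x\<^sup>2)) \<partial>\<nu>) < \<infinity>" using assms unfolding levy_measure_def by auto
  show "integrable \<nu> (\<lambda>z. min 1 (z\<^sup>2))"
    by (rule integrableI_nonneg) (use f in auto)
  show fin: "emeasure \<nu> D < \<infinity>" if D: "D \<in> sets borel" "0 < \<delta>" "D \<subseteq> {z. \<delta> < \<bar>z\<bar>}" for D \<delta>
  proof -
    have [measurable]: "D \<in> sets \<nu>" using D(1) s by simp
    \<comment> \<open>On D the function min 1 (x^2) is at least m, so up to the factor 1 / m it
      dominates the indicator of D.\<close>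
    define m where "m = min 1 (\<delta>\<^sup>2)"
    have m: "m > 0" using D(2) by (simp add: m_def)
    have "emeasure \<nu> D = (\<integral>\<^sup>+ x. indicator D x \<partial>\<nu>)" by simp
    also have "\<dots> \<le> (\<integral>\<^sup>+ x. ennreal (1 / m) * ennreal (min 1 (x\<^sup>2)) \<partial>\<nu>)"
    proof (rule nn_integral_mono)
      fix x
      show "indicator D x \<le> ennreal (1 / m) * ennreal (min 1 (x\<^sup>2))"
      proof (cases "x \<in> D")
        case True
        then have "\<delta> \<le> \<bar>x\<bar>" using D(3) by auto
        then have "\<delta>\<^sup>2 \<le> \<bar>x\<bar>\<^sup>2" using D(2) by (intro power_mono) auto
        then have "m \<le> min 1 (x\<^sup>2)" by (auto simp: m_def)
        then have "1 \<le> 1 / m * min 1 (x\<^sup>2)" using m by (simp add: le_divide_eq)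
        then show ?thesis using True m by (simp add: ennreal_mult[symmetric] del: ennreal_1 flip: ennreal_1)
      qed simp
    qed
    also have "\<dots> = ennreal (1 / m) * (\<integral>\<^sup>+ x. ennreal (min 1 (x\<^sup>2)) \<partial>\<nu>)"
      by (intro nn_integral_cmult) auto
    also have "\<dots> < \<infinity>" using f by (auto simp: ennreal_mult_less_top)
    finally show ?thesis .
  qed
  show "sigma_finite_measure \<nu>"
  proof
    \<comment> \<open>Sets bounded away from 0 have finite measure and {0} is a null set; countably
      many of them exhaust the line.\<close>
    define A where "A = insert {0} (range (\<lambda>n::nat. {z::real. 1 / real (Suc n) < \<bar>z\<bar>}))"
    have "\<exists>n::nat. 1 / real (Suc n) < \<bar>x\<bar>" if "x \<noteq> 0" for x
      using reals_Archimedean[of "\<bar>x\<bar>"] that by (auto simp: inverse_eq_divide)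
    then have "\<Union>A = space \<nu>"
      unfolding A_def using sets_eq_imp_space_eq[OF s] by auto
    moreover have "\<forall>a\<in>A. emeasure \<nu> a \<noteq> \<infinity>"
    proof
      fix a assume "a \<in> A"
      then consider "a = {0}" | n :: nat where "a = {z. 1 / real (Suc n) < \<bar>z\<bar>}" unfolding A_def by blast
      then show "emeasure \<nu> a \<noteq> \<infinity>"
      proof cases
        case 2
        then have "emeasure \<nu> a < \<infinity>" by (intro fin[of _ "1 / real (Suc n)"]) auto
        then show ?thesis by simp
      qed (use z in auto)
    qed
    moreover have "A \<subseteq> sets \<nu>" unfolding A_def s by auto
    ultimately show "\<exists>A. countable A \<and> A \<subseteq> sets \<nu> \<and> \<Union>A = space \<nu> \<and> (\<forall>a\<in>A. emeasure \<nu> a \<noteq> \<infinity>)"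
      by (intro exI[of _ A]) (auto simp: A_def)
  qed
qed

text \<open>The intensity lives on nonzero jump sizes only, whence the condition that 0 lies outside
  D; its value is the product formula for rectangles.\<close>

lemma jump_intensity_rect:
  assumes "levy_measure \<nu>" "D \<in> sets borel" "0 \<notin> D" "0 \<le> t"
  shows "{0<..t} \<times> D \<in> sets (jump_intensity \<nu>)"
    and "emeasure (jump_intensity \<nu>) ({0<..t} \<times> D) = ennreal t * emeasure \<nu> D"
proof -
  have s: "sets \<nu> = sets borel" using assms(1) by (simp add: levy_measure_def)
  interpret R: sigma_finite_measure "restrict_space \<nu> (- {0})"
    by (intro sigma_finite_measure_restrict_space levy_measure_facts assms) (simp add: s)
  have 1: "{0<..t} \<in> sets (restrict_space lborel {0..})" "D \<in> sets (restrict_space \<nu> (- {0}))"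
    using assms by (auto simp: sets_restrict_space_iff s)
  then show "{0<..t} \<times> D \<in> sets (jump_intensity \<nu>)" by (simp add: jump_intensity_def)
  have "emeasure (jump_intensity \<nu>) ({0<..t} \<times> D) = emeasure (restrict_space lborel {0..}) {0<..t} * emeasure (restrict_space \<nu> (- {0})) D"
    unfolding jump_intensity_def by (rule R.emeasure_pair_measure_Times[OF 1])
  moreover have "emeasure (restrict_space lborel {0..}) {0<..t} = ennreal t"
    using assms by (subst emeasure_restrict_space) auto
  moreover have "emeasure (restrict_space \<nu> (- {0})) D = emeasure \<nu> D"
    using assms by (subst emeasure_restrict_space) (auto simp: s)
  ultimately show "emeasure (jump_intensity \<nu>) ({0<..t} \<times> D) = ennreal t * emeasure \<nu> D" by simp
qed

lemma snd_measurable_jump_intensity: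
  assumes "levy_measure \<nu>"
  shows "snd \<in> borel_measurable (jump_intensity \<nu>)"
proof -
  have [measurable_cong]: "sets \<nu> = sets borel" using assms by (simp add: levy_measure_def)
  have "(\<lambda>x. x) \<in> borel_measurable (restrict_space \<nu> (- {0}))"
    by (rule measurable_restrict_space1) simp
  from measurable_compose[OF measurable_snd this] show ?thesis
    by (simp add: jump_intensity_def)
qed

text \<open>A simple F turns the integral over the jumps in D into a finite combination of Poisson
  counts of disjoint rectangles, hence of independent variables; independence of \<open>W\<close>
  and \<open>\<mu>\<close> yields the product. The third claim identifies this combination with the
  integral on paths with finitely many jumps in D.\<close>

lemma (in prob_space) char_simple_jumps:
  fixes F :: "real \<Rightarrow> real" and u t :: real
  assumes lev: "levy_measure \<nu>" and prm: "poisson_random_measure M (jump_intensity \<nu>) \<mu>"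
    and ind: "indep_process_random_measure M W (jump_intensity \<nu>) \<mu>"
    and W[measurable]: "W t \<in> borel_measurable M"
    and D: "D \<in> sets borel" "0 < \<delta>" "D \<subseteq> {z. \<delta> < \<bar>z\<bar>}" and t: "0 \<le> t"
    and F: "simple_function borel F"
  defines "S \<equiv> \<lambda>w. \<Sum>v\<in>range F. v * measure (\<mu> w) ({0<..t} \<times> (D \<inter> F -` {v}))"
  shows "S \<in> borel_measurable M"
    and "char (distr M borel (\<lambda>w. \<sigma> * W t w + S w)) u
      = char (distr M borel (\<lambda>w. \<sigma> * W t w)) u * exp (t * (CLINT z:D|\<nu>. iexp (u * F z) - 1))"
    and "\<And>w. w \<in> space M \<Longrightarrow> emeasure (\<mu> w) ({0<..t} \<times> D) < \<infinity> \<Longrightarrow>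
       S w = (\<integral>p. indicator ({0<..t} \<times> D) p * F (snd p) \<partial>\<mu> w)"
proof -
  have s[measurable_cong]: "sets \<nu> = sets borel" using lev by (simp add: levy_measure_def)
  have fin: "finite (range F)" using simple_functionD(1)[OF F] by simp
  have Fm[measurable]: "F \<in> borel_measurable borel" using F by (rule borel_measurable_simple_function)
  have "D \<inter> F -` {v} \<in> sets borel" for v
    using measurable_sets[OF Fm, of "{v}"] D by auto
  note Dv = this
  note rect = jump_intensity_rect[OF lev _ _ t]
  have Dv0: "0 \<notin> D \<inter> F -` {v}" for v using D by auto
  have Efin: "emeasure \<nu> (D \<inter> F -` {v}) < \<infinity>" for v
    using D by (intro levy_measure_facts(2)[OF lev Dv D(2)]) auto
  have m[measurable]: "(\<lambda>w. emeasure (\<mu> w) A) \<in> borel_measurable M" if "A \<in> sets (jump_intensity \<nu>)" for A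
    using prm that unfolding poisson_random_measure_def by blast
  \<comment> \<open>Independence is given for families indexed by an initial segment of the
    naturals, so the values of F are enumerated.\<close>
  obtain h where h: "bij_betw h {..<card (range F)} (range F)"
    using ex_bij_betw_nat_finite[OF fin] by (auto simp: atLeast0LessThan)
  define r where "r = card (range F)"
  define A where "A i = {0<..t} \<times> (D \<inter> F -` {h i})" for i
  have Am: "A i \<in> sets (jump_intensity \<nu>)" for i unfolding A_def by (rule rect(1)[OF Dv Dv0])
  have Ae: "emeasure (jump_intensity \<nu>) (A i) = ennreal t * emeasure \<nu> (D \<inter> F -` {h i})" for i
    unfolding A_def by (rule rect(2)[OF Dv Dv0])
  then have Afin: "emeasure (jump_intensity \<nu>) (A i) < \<infinity>" for i
    using Efin by (simp add: ennreal_mult_less_top)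
  have Ameas: "measure (jump_intensity \<nu>) (A i) = t * measure \<nu> (D \<inter> F -` {h i})" for i
    unfolding measure_def Ae using t by (simp add: enn2real_mult)
  have disj: "disjoint_family_on A {..<r}"
    using h unfolding disjoint_family_on_def A_def r_def bij_betw_def inj_on_def by fastforce
  define N where "N i w = h i * enn2real (emeasure (\<mu> w) (A i))" for i w
  have S_eq: "S w = (\<Sum>i<r. N i w)" for w
    unfolding S_def N_def A_def r_def using sum.reindex_bij_betw[OF h, of "\<lambda>v. v * measure (\<mu> w) ({0<..t} \<times> (D \<inter> F -` {v}))"]
    by (simp add: measure_def)
  have Nm[measurable]: "N i \<in> borel_measurable M" for i
    unfolding N_def using m[OF Am] by measurable
  show Sm[measurable]: "S \<in> borel_measurable M" unfolding S_eq[abs_def] by measurable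
  have indA: "indep_vars (\<lambda>_. borel) (\<lambda>i w. emeasure (\<mu> w) (A i)) {..<r}"
    using prm Am disj unfolding poisson_random_measure_def by blast
  have indN: "indep_vars (\<lambda>_. borel) N {..<r}"
    using indep_vars_compose2[OF indA, of "\<lambda>i x. h i * enn2real x" "\<lambda>_. borel"] by (simp add: N_def[abs_def])
  have charN: "char (distr M borel (N i)) u = exp (t * measure \<nu> (D \<inter> F -` {h i}) * (iexp (u * h i) - 1))" for i
  proof -
    have "\<forall>A\<in>sets (jump_intensity \<nu>). emeasure (jump_intensity \<nu>) A < \<infinity> \<longrightarrow>
        (\<forall>k::nat. prob {w \<in> space M. emeasure (\<mu> w) A = of_nat k}
          = exp (- measure (jump_intensity \<nu>) A) * measure (jump_intensity \<nu>) A ^ k / fact k)"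
      using prm unfolding poisson_random_measure_def by blast
    from char_poisson[OF m[OF Am] this[rule_format, OF Am Afin]] show ?thesis unfolding N_def Ameas .
  qed
  have "char (distr M borel S) u = (\<Prod>i<r. char (distr M borel (N i)) u)"
    unfolding S_eq[abs_def] by (rule char_distr_sum[OF indN])
  also have "\<dots> = exp (\<Sum>i<r. t * measure \<nu> (D \<inter> F -` {h i}) * (iexp (u * h i) - 1))"
    by (simp add: charN exp_sum)
  also have "(\<Sum>i<r. t * measure \<nu> (D \<inter> F -` {h i}) * (iexp (u * h i) - 1)) = t * (\<Sum>v\<in>range F. measure \<nu> (D \<inter> F -` {v}) *\<^sub>R (iexp (u * v) - 1))"
    unfolding r_def using sum.reindex_bij_betw[OF h, of "\<lambda>v. measure \<nu> (D \<inter> F -` {v}) *\<^sub>R (iexp (u * v) - 1)"]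
    by (simp add: scaleR_conv_of_real mult.assoc flip: sum_distrib_left)
  also have "(\<Sum>v\<in>range F. measure \<nu> (D \<inter> F -` {v}) *\<^sub>R (iexp (u * v) - 1)) = (CLINT z:D|\<nu>. iexp (u * F z) - 1)"
  proof -
    have "indicator D z *\<^sub>R (iexp (u * F z) - 1) = (\<Sum>v\<in>range F. indicator (D \<inter> F -` {v}) z *\<^sub>R (iexp (u * v) - 1))" for z
    proof -
      have "(\<Sum>v\<in>range F. indicator (D \<inter> F -` {v}) z *\<^sub>R (iexp (u * v) - 1)) = (\<Sum>v\<in>range F. if v = F z then indicator D z *\<^sub>R (iexp (u * v) - 1) else 0)"
        by (intro sum.cong) (auto simp: indicator_def)
      then show ?thesis using fin by simp
    qed
    then have "(CLINT z:D|\<nu>. iexp (u * F z) - 1) = (\<integral>z. (\<Sum>v\<in>range F. indicator (D \<inter> F -` {v}) z *\<^sub>R (iexp (u * v) - 1)) \<partial>\<nu>)"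
      unfolding set_lebesgue_integral_def by simp
    also have "\<dots> = (\<Sum>v\<in>range F. measure \<nu> (D \<inter> F -` {v}) *\<^sub>R (iexp (u * v) - 1))"
      using Dv Efin sets_eq_imp_space_eq[OF s] by (subst Bochner_Integration.integral_sum) (auto simp: s intro!: sum.cong)
    finally show ?thesis by simp
  qed
  finally have charS: "char (distr M borel S) u = exp (t * (CLINT z:D|\<nu>. iexp (u * F z) - 1))" .
  \<comment> \<open>Independence is given between the sigma-algebra of all \<open>W t\<close> and
    that of all counts. It passes to \<open>W t\<close> and \<open>S\<close> because each is
    measurable for the respective sigma-algebra.\<close>
  define \<A> where "\<A> = {W t -` B \<inter> space M | t B. 0 \<le> t \<and> B \<in> sets borel}"
  define \<B> where "\<B> = {(\<lambda>w. emeasure (\<mu> w) A) -` B \<inter> space M | A B. A \<in> sets (jump_intensity \<nu>) \<and> B \<in> sets borel}"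
  have AB: "indep_set (sigma_sets (space M) \<A>) (sigma_sets (space M) \<B>)"
    using ind unfolding indep_process_random_measure_def \<A>_def \<B>_def .
  have ind2: "indep_var borel (\<lambda>w. \<sigma> * W t w) borel S"
    unfolding indep_var_eq
  proof (intro conjI)
    have subA: "\<A> \<subseteq> Pow (space M)" and subB: "\<B> \<subseteq> Pow (space M)" unfolding \<A>_def \<B>_def by auto
    have Wm: "W t \<in> borel_measurable (sigma (space M) \<A>)"
      by (rule measurableI) (use t in \<open>auto simp: subA space_measure_of_conv sets_measure_of \<A>_def intro!: sigma_sets.Basic\<close>)
    have Wm': "(\<lambda>w. \<sigma> * W t w) \<in> borel_measurable (sigma (space M) \<A>)" using Wm by measurable
    have "(\<lambda>w. emeasure (\<mu> w) (A i)) \<in> borel_measurable (sigma (space M) \<B>)" for i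
      by (rule measurableI) (use Am in \<open>auto simp: subB space_measure_of_conv sets_measure_of \<B>_def intro!: sigma_sets.Basic\<close>)
    then have Sm': "S \<in> borel_measurable (sigma (space M) \<B>)"
      unfolding S_eq[abs_def] N_def by measurable
    show "indep_set (sigma_sets (space M) {(\<lambda>w. \<sigma> * W t w) -` A \<inter> space M |A. A \<in> sets borel})
       (sigma_sets (space M) {S -` A \<inter> space M |A. A \<in> sets borel})"
    proof (rule indep_setI)
      have 1: "sigma_sets (space M) {(\<lambda>w. \<sigma> * W t w) -` A \<inter> space M |A. A \<in> sets borel} \<subseteq> sigma_sets (space M) \<A>"
        by (rule sigma_sets_mono) (use measurable_sets[OF Wm'] in \<open>auto simp: subA space_measure_of_conv sets_measure_of\<close>)
      have 2: "sigma_sets (space M) {S -` A \<inter> space M |A. A \<in> sets borel} \<subseteq> sigma_sets (space M) \<B>"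
        by (rule sigma_sets_mono) (use measurable_sets[OF Sm'] in \<open>auto simp: subB space_measure_of_conv sets_measure_of\<close>)
      show "sigma_sets (space M) {(\<lambda>w. \<sigma> * W t w) -` A \<inter> space M |A. A \<in> sets borel} \<subseteq> events"
        using 1 indep_setD_ev1[OF AB] by blast
      show "sigma_sets (space M) {S -` A \<inter> space M |A. A \<in> sets borel} \<subseteq> events"
        using 2 indep_setD_ev2[OF AB] by blast
      show "prob (a \<inter> b) = prob a * prob b" if "a \<in> sigma_sets (space M) {(\<lambda>w. \<sigma> * W t w) -` A \<inter> space M |A. A \<in> sets borel}"
        "b \<in> sigma_sets (space M) {S -` A \<inter> space M |A. A \<in> sets borel}" for a b
        using that 1 2 indep_setD[OF AB] by blast
    qed
  qed auto
  show "char (distr M borel (\<lambda>w. \<sigma> * W t w + S w)) u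
      = char (distr M borel (\<lambda>w. \<sigma> * W t w)) u * exp (t * (CLINT z:D|\<nu>. iexp (u * F z) - 1))"
    unfolding char_distr_add[OF ind2] charS ..
  fix w assume w: "w \<in> space M" "emeasure (\<mu> w) ({0<..t} \<times> D) < \<infinity>"
  have sw: "sets (\<mu> w) = sets (jump_intensity \<nu>)"
    using prm w unfolding poisson_random_measure_def by blast
  have ef: "emeasure (\<mu> w) ({0<..t} \<times> (D \<inter> F -` {v})) < \<infinity>" for v
    by (rule le_less_trans[OF emeasure_mono w(2)]) (use D in \<open>auto simp: sw intro!: rect(1)\<close>)
  have "indicator ({0<..t} \<times> D) p * F (snd p) = (\<Sum>v\<in>range F. v * indicator ({0<..t} \<times> (D \<inter> F -` {v})) p)" for p
  proof -
    have "(\<Sum>v\<in>range F. v * indicator ({0<..t} \<times> (D \<inter> F -` {v})) p) = (\<Sum>v\<in>range F. if v = F (snd p) then indicator ({0<..t} \<times> D) p * v else 0)"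
      by (intro sum.cong) (auto simp: indicator_def mem_Times_iff)
    then show ?thesis using fin by simp
  qed
  then have "(\<integral>p. indicator ({0<..t} \<times> D) p * F (snd p) \<partial>\<mu> w) = (\<integral>p. (\<Sum>v\<in>range F. v * indicator ({0<..t} \<times> (D \<inter> F -` {v})) p) \<partial>\<mu> w)"
    by simp
  also have "\<dots> = (\<Sum>v\<in>range F. v * measure (\<mu> w) ({0<..t} \<times> (D \<inter> F -` {v})))"
  proof -
    have B: "{0<..t} \<times> (D \<inter> F -` {v}) \<in> sets (\<mu> w)" for v
      using rect(1)[OF Dv Dv0] sw by simp
    have i: "integrable (\<mu> w) (indicator ({0<..t} \<times> (D \<inter> F -` {v})) :: _ \<Rightarrow> real)" for v
      by (rule integrable_real_indicator[OF B ef])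
    show ?thesis
      by (subst Bochner_Integration.integral_sum)
        (simp_all only: integrable_mult_right i integral_mult_right_zero Bochner_Integration.integral_indicator sets.Int_space_eq2[OF B])
  qed
  finally show "S w = (\<integral>p. indicator ({0<..t} \<times> D) p * F (snd p) \<partial>\<mu> w)" by (simp add: S_def)
qed

text \<open>The jump size is approximated by simple functions. The integral over
  \<open>\<mu> w\<close> is meaningful only if \<open>snd\<close> is integrable there, which holds
  almost surely: up to time t there are finitely many jumps in D, and none exceeds some bound
  depending on the path.\<close>

lemma (in prob_space) char_large_jumps:
  fixes t :: real
  assumes lev: "levy_measure \<nu>" and prm: "poisson_random_measure M (jump_intensity \<nu>) \<mu>"
    and ind: "indep_process_random_measure M W (jump_intensity \<nu>) \<mu>"
    and W[measurable]: "W t \<in> borel_measurable M"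
    and D: "D \<in> sets borel" "0 < \<delta>" "D \<subseteq> {z. \<delta> < \<bar>z\<bar>}" and t: "0 \<le> t"
  obtains Z where "Z \<in> borel_measurable M"
    "AE w in M. integrable (\<mu> w) (\<lambda>p. indicator ({0<..t} \<times> D) p *\<^sub>R snd p) \<and>
       Z w = set_lebesgue_integral (\<mu> w) ({0<..t} \<times> D) snd"
    "\<And>u. char (distr M borel (\<lambda>w. \<sigma> * W t w + Z w)) u
      = char (distr M borel (\<lambda>w. \<sigma> * W t w)) u * exp (t * (CLINT z:D|\<nu>. iexp (u * z) - 1))"
proof -
  have s[measurable_cong]: "sets \<nu> = sets borel" using lev by (simp add: levy_measure_def)
  note [measurable] = D(1)
  have Dn: "emeasure \<nu> D < \<infinity>" by (rule levy_measure_facts(2)[OF lev D])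
  obtain F :: "nat \<Rightarrow> real \<Rightarrow> real" where F: "\<And>k. simple_function borel (F k)"
    "\<And>z. (\<lambda>k. F k z) \<longlonglongrightarrow> z" "\<And>k z. \<bar>F k z\<bar> \<le> 2 * \<bar>z\<bar>"
    using borel_measurable_implies_sequence_metric[of "\<lambda>x::real. x" borel 0] by auto
  have [measurable]: "F k \<in> borel_measurable borel" for k by (rule borel_measurable_simple_function[OF F(1)])
  define S where "S k w = (\<Sum>v\<in>range (F k). v * measure (\<mu> w) ({0<..t} \<times> (D \<inter> F k -` {v})))" for k w
  note simple = char_simple_jumps[OF lev prm ind W D t F(1), folded S_def]
  have [measurable]: "S k \<in> borel_measurable M" for k using simple(1)[of k] by (simp add: S_def[abs_def])
  define H where "H n = {0<..t} \<times> (D \<inter> {z. real n < \<bar>z\<bar>})" for n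
  have D0: "0 \<notin> D" using D by auto
  note rect = jump_intensity_rect[OF lev _ _ t]
  have Hm: "H n \<in> sets (jump_intensity \<nu>)" for n
    unfolding H_def by (rule rect(1)) (use D0 D in auto)
  have Em: "{0<..t} \<times> D \<in> sets (jump_intensity \<nu>)"
    by (rule rect(1)) (use D0 D in auto)
  have He: "emeasure (jump_intensity \<nu>) (H n) = ennreal t * emeasure \<nu> (D \<inter> {z. real n < \<bar>z\<bar>})" for n
    unfolding H_def by (rule rect(2)) (use D0 D in auto)
  have Ee: "emeasure (jump_intensity \<nu>) ({0<..t} \<times> D) = ennreal t * emeasure \<nu> D"
    by (rule rect(2)) (use D0 D in auto)
  have m[measurable]: "(\<lambda>w. emeasure (\<mu> w) A) \<in> borel_measurable M" if "A \<in> sets (jump_intensity \<nu>)" for A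
    using prm that unfolding poisson_random_measure_def by blast
  have P: "\<forall>A\<in>sets (jump_intensity \<nu>). emeasure (jump_intensity \<nu>) A < \<infinity> \<longrightarrow>
        (\<forall>k::nat. prob {w \<in> space M. emeasure (\<mu> w) A = of_nat k}
          = exp (- measure (jump_intensity \<nu>) A) * measure (jump_intensity \<nu>) A ^ k / fact k)"
    using prm unfolding poisson_random_measure_def by blast
  have Efin: "emeasure (jump_intensity \<nu>) ({0<..t} \<times> D) < \<infinity>"
    using Dn by (simp add: Ee ennreal_mult_less_top)
  have Hn: "emeasure \<nu> (D \<inter> {z. real n < \<bar>z\<bar>}) < \<infinity>" for n
    by (rule le_less_trans[OF emeasure_mono Dn]) (auto simp: s)
  have Hfin: "emeasure (jump_intensity \<nu>) (H n) < \<infinity>" for n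
    using Hn by (simp add: He ennreal_mult_less_top)
  have AEfin: "AE w in M. emeasure (\<mu> w) ({0<..t} \<times> D) < \<infinity>"
    using poisson_AE_nat[OF m[OF Em] P[rule_format, OF Em Efin]] by eventually_elim (auto simp: of_nat_less_top)
  \<comment> \<open>The event of no jump in D larger than n has probability exp (- t \<nu>(D
    \<inter> {|z| > n})), which tends to 1 because \<nu> is finite on D.\<close>
  have AEbig: "AE w in M. \<exists>n. emeasure (\<mu> w) (H n) = 0"
  proof -
    define G where "G n = {w \<in> space M. emeasure (\<mu> w) (H n) = 0}" for n
    have [measurable]: "G n \<in> events" for n
      unfolding G_def using m[OF Hm] by measurable
    have PG: "prob (G n) = exp (- (t * measure \<nu> (D \<inter> {z. real n < \<bar>z\<bar>})))" for n
    proof -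
      have "measure (jump_intensity \<nu>) (H n) = t * measure \<nu> (D \<inter> {z. real n < \<bar>z\<bar>})"
        unfolding measure_def He using t by (simp add: enn2real_mult)
      then show ?thesis using P[rule_format, OF Hm Hfin, of n 0] by (simp add: G_def)
    qed
    have "(\<lambda>n. measure \<nu> (D \<inter> {z. real n < \<bar>z\<bar>})) \<longlonglongrightarrow> measure \<nu> (\<Inter>n. D \<inter> {z. real n < \<bar>z\<bar>})"
      by (rule Lim_measure_decseq) (use Hn[THEN less_imp_neq] in \<open>auto simp: s decseq_def\<close>)
    moreover have "(\<Inter>n. D \<inter> {z. real n < \<bar>z\<bar>}) = {}"
    proof -
      have "\<exists>n. \<not> real n < \<bar>z\<bar>" for z by (meson less_asym reals_Archimedean2)
      then show ?thesis by blast
    qed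
    ultimately have "(\<lambda>n. exp (- (t * measure \<nu> (D \<inter> {z. real n < \<bar>z\<bar>})))) \<longlonglongrightarrow> exp (- (t * 0))"
      by (intro tendsto_intros) simp
    then have lim: "(\<lambda>n. prob (G n)) \<longlonglongrightarrow> 1" by (simp add: PG)
    have "prob (G n) \<le> prob (\<Union>n. G n)" for n by (intro finite_measure_mono) auto
    then have "1 \<le> prob (\<Union>n. G n)" using LIMSEQ_le_const2[OF lim] by blast
    then have "prob (\<Union>n. G n) = 1" using prob_le_1 by (simp add: antisym)
    then have "AE w in M. w \<in> (\<Union>n. G n)" by (intro AE_prob_1) auto
    then show ?thesis by eventually_elim (auto simp: G_def)
  qed
  have AE_main: "AE w in M. integrable (\<mu> w) (\<lambda>p. indicator ({0<..t} \<times> D) p *\<^sub>R snd p) \<and>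
       (\<lambda>k. S k w) \<longlonglongrightarrow> set_lebesgue_integral (\<mu> w) ({0<..t} \<times> D) snd"
    using AEfin AEbig AE_space
  proof eventually_elim
    case (elim w)
    have sw[measurable_cong]: "sets (\<mu> w) = sets (jump_intensity \<nu>)"
      using prm elim unfolding poisson_random_measure_def by blast
    have [measurable]: "{0<..t} \<times> D \<in> sets (jump_intensity \<nu>)" "snd \<in> borel_measurable (jump_intensity \<nu>)"
      using Em snd_measurable_jump_intensity[OF lev] by auto
    obtain n where n: "emeasure (\<mu> w) (H n) = 0" using elim by auto
    have i: "integrable (\<mu> w) (\<lambda>p. real n * indicator ({0<..t} \<times> D) p)"
      using elim Em sw by (intro integrable_mult_right integrable_real_indicator) auto
    have b: "AE p in \<mu> w. norm (indicator ({0<..t} \<times> D) p *\<^sub>R snd p) \<le> norm (real n * indicator ({0<..t} \<times> D) p)"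
    proof -
      have "H n \<in> null_sets (\<mu> w)" using n Hm sw by auto
      from AE_not_in[OF this] show ?thesis
        by eventually_elim (auto simp: H_def indicator_def split: if_splits)
    qed
    have int: "integrable (\<mu> w) (\<lambda>p. indicator ({0<..t} \<times> D) p *\<^sub>R snd p)"
      by (rule Bochner_Integration.integrable_bound[OF i _ b]) measurable
    have "(\<lambda>k. \<integral>p. indicator ({0<..t} \<times> D) p * F k (snd p) \<partial>\<mu> w) \<longlonglongrightarrow> (\<integral>p. indicator ({0<..t} \<times> D) p *\<^sub>R snd p \<partial>\<mu> w)"
    proof (rule integral_dominated_convergence[where w = "\<lambda>p. 2 * norm (indicator ({0<..t} \<times> D) p *\<^sub>R snd p)"])
      show "integrable (\<mu> w) (\<lambda>p. 2 * norm (indicator ({0<..t} \<times> D) p *\<^sub>R snd p))"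
        using int by auto
      show "AE p in \<mu> w. (\<lambda>k. indicator ({0<..t} \<times> D) p * F k (snd p)) \<longlonglongrightarrow> indicator ({0<..t} \<times> D) p *\<^sub>R snd p"
        by (auto intro!: tendsto_intros F)
      show "AE p in \<mu> w. norm (indicator ({0<..t} \<times> D) p * F k (snd p)) \<le> 2 * norm (indicator ({0<..t} \<times> D) p *\<^sub>R snd p)" for k
        using F(3) by (auto simp: indicator_def)
    qed measurable
    then have "(\<lambda>k. S k w) \<longlonglongrightarrow> set_lebesgue_integral (\<mu> w) ({0<..t} \<times> D) snd"
      using simple(3)[of w] elim unfolding set_lebesgue_integral_def by simp
    with int show ?case by simp
  qed
  \<comment> \<open>Measurability in w is known for the counts, not for the integrals; the limit of
    the simple approximations is a measurable version.\<close>
  define Z where "Z w = lim (\<lambda>k. S k w)" for w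
  have Zm[measurable]: "Z \<in> borel_measurable M" unfolding Z_def[abs_def] by measurable
  have AEZ: "AE w in M. integrable (\<mu> w) (\<lambda>p. indicator ({0<..t} \<times> D) p *\<^sub>R snd p) \<and>
       Z w = set_lebesgue_integral (\<mu> w) ({0<..t} \<times> D) snd"
    using AE_main by eventually_elim (auto simp: Z_def intro: limI)
  have AElim: "AE w in M. (\<lambda>k. S k w) \<longlonglongrightarrow> Z w"
    using AE_main by eventually_elim (auto simp: Z_def limI)
  have "char (distr M borel (\<lambda>w. \<sigma> * W t w + Z w)) u
      = char (distr M borel (\<lambda>w. \<sigma> * W t w)) u * exp (t * (CLINT z:D|\<nu>. iexp (u * z) - 1))" for u
  proof (rule LIMSEQ_unique)
    show "(\<lambda>k. char (distr M borel (\<lambda>w. \<sigma> * W t w + S k w)) u) \<longlonglongrightarrow> char (distr M borel (\<lambda>w. \<sigma> * W t w + Z w)) u"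
      unfolding char_def
    proof (subst (1 2) integral_distr)
      show "(\<lambda>k. CLINT w|M. iexp (u * (\<sigma> * W t w + S k w))) \<longlonglongrightarrow> (CLINT w|M. iexp (u * (\<sigma> * W t w + Z w)))"
      proof (rule integral_dominated_convergence[where w = "\<lambda>_. 1"])
        show "AE w in M. (\<lambda>k. iexp (u * (\<sigma> * W t w + S k w))) \<longlonglongrightarrow> iexp (u * (\<sigma> * W t w + Z w))"
          using AElim by eventually_elim (intro tendsto_intros)
      qed (simp_all, measurable)
    qed measurable
    have "(\<lambda>k. CLINT z:D|\<nu>. iexp (u * F k z) - 1) \<longlonglongrightarrow> (CLINT z:D|\<nu>. iexp (u * z) - 1)"
      unfolding set_lebesgue_integral_def
    proof (rule integral_dominated_convergence[where w = "\<lambda>z. 2 * indicator D z"])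
      show "integrable \<nu> (\<lambda>z. 2 * indicator D z :: real)" using Dn by auto
      show "AE z in \<nu>. (\<lambda>k. indicator D z *\<^sub>R (iexp (u * F k z) - 1)) \<longlonglongrightarrow> indicator D z *\<^sub>R (iexp (u * z) - 1)"
        by (intro AE_I2 tendsto_intros F)
      show "AE z in \<nu>. norm (indicator D z *\<^sub>R (iexp (u * F k z) - 1)) \<le> 2 * indicator D z" for k
      proof (rule AE_I2)
        fix z
        have "norm (iexp (u * F k z) - 1) \<le> norm (iexp (u * F k z)) + norm (1::complex)" by (rule norm_triangle_ineq4)
        then show "norm (indicator D z *\<^sub>R (iexp (u * F k z) - 1)) \<le> 2 * indicator D z" by (auto simp: indicator_def)
      qed
    qed measurable
    then show "(\<lambda>k. char (distr M borel (\<lambda>w. \<sigma> * W t w + S k w)) u) \<longlonglongrightarrow>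
       char (distr M borel (\<lambda>w. \<sigma> * W t w)) u * exp (t * (CLINT z:D|\<nu>. iexp (u * z) - 1))"
      using simple(2)[of \<sigma> _ u] by (auto intro!: tendsto_intros)
  qed
  then show ?thesis by (rule that[OF Zm AEZ])
qed

section \<open>Levy-Khintchine formula, with optional removal of large jumps\<close>

definition levy_exponent :: "real \<Rightarrow> real \<Rightarrow> real measure \<Rightarrow> real \<Rightarrow> complex" where
  "levy_exponent \<sigma> b \<nu> u = \<i> * (u * b) - (\<sigma>\<^sup>2 * u\<^sup>2 / 2 :: real)
     + (CLINT z|\<nu>. iexp (u * z) - 1 - \<i> * (u * z * indicator {-1..1} z))"

lemma norm_iexp_minus_1: "norm (iexp x - 1) \<le> \<bar>x\<bar>" "norm (iexp x - 1) \<le> 2"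
  using iexp_approx1[of x 0] norm_triangle_ineq4[of "iexp x" 1] by auto

text \<open>A second order Taylor bound where the compensator is active and the trivial bound 2
  elsewhere: together a multiple of the \<nu>-integrable function min 1 (z^2).\<close>

lemma levy_exponent_bound:
  "norm (iexp (u * z) - 1 - \<i> * (u * z * indicator {-1..1} z)) \<le> (2 + u\<^sup>2) * min 1 (z\<^sup>2)"
proof (cases "\<bar>z\<bar> \<le> 1")
  case True
  have "norm (iexp (u * z) - 1 - \<i> * (u * z)) \<le> (u * z)\<^sup>2 / 2"
    using iexp_approx1[of "u * z" 1] by (simp add: algebra_simps numeral_2_eq_2)
  also have "\<dots> \<le> (2 + u\<^sup>2) * z\<^sup>2"
    by (simp add: power_mult_distrib algebra_simps)
  also have "z\<^sup>2 = min 1 (z\<^sup>2)" using True by (simp add: abs_square_le_1)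
  finally show ?thesis using True by (simp add: indicator_def abs_le_iff)
next
  case False
  then have "\<not> z\<^sup>2 \<le> 1" by (simp add: abs_square_le_1)
  then have "min 1 (z\<^sup>2) = 1" by simp
  moreover have "indicator {-1..1} z = (0::real)" using False by (auto simp: indicator_def abs_le_iff)
  moreover have "2 \<le> 2 + u\<^sup>2" by simp
  ultimately show ?thesis
    using order_trans[OF norm_iexp_minus_1(2)[of "u * z"]] by (simp del: of_real_mult)
qed

lemma levy_exponent_integrable:
  assumes "levy_measure \<nu>"
  shows "integrable \<nu> (\<lambda>z. iexp (u * z) - 1 - \<i> * (u * z * indicator {-1..1} z))"
proof -
  have [measurable_cong]: "sets \<nu> = sets borel" using assms by (simp add: levy_measure_def)
  have i: "integrable \<nu> (\<lambda>z. (2 + u\<^sup>2) * min 1 (z\<^sup>2))"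
    by (intro integrable_mult_right levy_measure_facts assms)
  show ?thesis
    by (rule Bochner_Integration.integrable_bound[OF i])
      (measurable, intro AE_I2 order_trans[OF levy_exponent_bound], simp)
qed

lemma levy_measure_integrable_set:
  assumes "levy_measure \<nu>" "D \<in> sets borel" "0 < \<delta>" "D \<subseteq> {z. \<delta> < \<bar>z\<bar>}"
    and "f \<in> borel_measurable borel" "\<And>z. z \<in> D \<Longrightarrow> norm (f z) \<le> (B::real)"
  shows "set_integrable \<nu> D (f :: real \<Rightarrow> 'a::{banach, second_countable_topology})"
proof -
  have [measurable_cong]: "sets \<nu> = sets borel" using assms by (simp add: levy_measure_def)
  note [measurable] = assms(2,5)
  have i: "integrable \<nu> (\<lambda>z. B * indicator D z)"
    using levy_measure_facts(2)[OF assms(1-4)] by auto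
  show ?thesis unfolding set_integrable_def
    by (rule Bochner_Integration.integrable_bound[OF i])
      (use assms(6) in \<open>auto simp: indicator_def intro: order_trans[OF _ abs_ge_self]\<close>)
qed

text \<open>The law is prescribed for increments over intervals of positive length, so
  \<open>W t\<close> is read as \<open>W t - W 0\<close>, where \<open>W 0\<close> is almost surely
  0.\<close>

lemma (in prob_space) char_brownian:
  assumes "brownian_motion M W" "0 < t"
  shows "char (distr M borel (\<lambda>w. \<sigma> * W t w)) u = exp (- (\<sigma>\<^sup>2 * u\<^sup>2 / 2 * t))"
proof -
  have [measurable]: "W t \<in> borel_measurable M" "W 0 \<in> borel_measurable M"
    and W0: "AE w in M. W 0 w = 0"
    using assms unfolding brownian_motion_def by auto
  have "\<forall>r t. 0 \<le> r \<and> r < t \<longrightarrow> distributed M lborel (\<lambda>w. W t w - W r w) (normal_density 0 (sqrt (t - r)))"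
    using assms(1) unfolding brownian_motion_def by blast
  then have d: "distributed M lborel (\<lambda>w. W t w - W 0 w) (normal_density 0 (sqrt (t - 0)))"
    using assms(2) by blast
  have "distributed M lborel (\<lambda>w. (W t w - W 0 w) / sqrt t) std_normal_density"
    using d assms(2) normal_standard_normal_convert[of "sqrt t" "\<lambda>w. W t w - W 0 w" 0] by simp
  then have "distr M lborel (\<lambda>w. (W t w - W 0 w) / sqrt t) = std_normal_distribution"
    by (rule distributed_distr_eq_density)
  moreover have "distr M borel (\<lambda>w. (W t w - W 0 w) / sqrt t) = distr M lborel (\<lambda>w. (W t w - W 0 w) / sqrt t)"
    by (rule distr_cong) auto
  ultimately have n: "distr M borel (\<lambda>w. (W t w - W 0 w) / sqrt t) = std_normal_distribution"
    by simp
  have "char (distr M borel (\<lambda>w. \<sigma> * W t w)) u = (CLINT w|M. iexp (u * (\<sigma> * W t w)))"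
    by (simp add: char_def integral_distr)
  also have "\<dots> = (CLINT w|M. iexp (u * \<sigma> * sqrt t * ((W t w - W 0 w) / sqrt t)))"
    by (rule integral_cong_AE) (use W0 assms(2) in \<open>auto simp: mult.assoc\<close>)
  also have "\<dots> = char (distr M borel (\<lambda>w. (W t w - W 0 w) / sqrt t)) (u * \<sigma> * sqrt t)"
    unfolding char_def by (subst integral_distr) auto
  also have "\<dots> = exp (- (\<sigma>\<^sup>2 * u\<^sup>2 / 2 * t))"
    unfolding n char_std_normal_distribution using assms(2)
    by (simp add: power_mult_distrib mult_ac flip: exp_of_real)
  finally show ?thesis .
qed

text \<open>The difference of the exponentials is at most x = |u (Y - V)|, and x \<le> \<eta> + x^2
  / \<eta>. Hence closeness in mean square, the form in which the compensated small jumps are given,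
  is enough for characteristic functions.\<close>

lemma (in prob_space) char_diff_bound:
  fixes Y V :: "'a \<Rightarrow> real"
  assumes [measurable]: "Y \<in> borel_measurable M" "V \<in> borel_measurable M"
    and Q: "(\<integral>\<^sup>+ w. ennreal ((Y w - V w)\<^sup>2) \<partial>M) \<le> ennreal q" "0 \<le> q" and "\<eta> > 0"
  shows "norm (char (distr M borel Y) u - char (distr M borel V) u) \<le> \<eta> + u\<^sup>2 * q / \<eta>"
proof -
  have i: "integrable M (\<lambda>w. (Y w - V w)\<^sup>2)"
    by (rule integrableI_nonneg) (use le_less_trans[OF Q(1) ennreal_less_top] in auto)
  have q: "(\<integral>w. (Y w - V w)\<^sup>2 \<partial>M) \<le> q"
    using Q nn_integral_eq_integral[OF i] by simp
  have b: "norm (iexp (u * Y w) - iexp (u * V w)) \<le> \<eta> + u\<^sup>2 / \<eta> * (Y w - V w)\<^sup>2" for w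
  proof -
    define x where "x = \<bar>u * (Y w - V w)\<bar>"
    have "iexp (u * V w) * iexp (u * (Y w - V w)) = iexp (u * Y w)"
      by (subst exp_add[symmetric]) (simp add: algebra_simps)
    then have "iexp (u * Y w) - iexp (u * V w) = iexp (u * V w) * (iexp (u * (Y w - V w)) - 1)"
      by (simp add: right_diff_distrib)
    then have "norm (iexp (u * Y w) - iexp (u * V w)) \<le> x"
      using norm_iexp_minus_1(1)[of "u * (Y w - V w)"] by (simp add: norm_mult x_def del: of_real_mult of_real_diff)
    also have "x \<le> \<eta> + x\<^sup>2 / \<eta>"
    proof (cases "x \<le> \<eta>")
      case True
      then show ?thesis using assms(5) by (simp add: add_increasing2)
    next
      case False
      then have "x * \<eta> \<le> x * x" by (intro mult_left_mono) (auto simp: x_def)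
      then have "x \<le> x\<^sup>2 / \<eta>" using assms(5) by (simp add: le_divide_eq power2_eq_square)
      then show ?thesis using assms(5) by simp
    qed
    finally show ?thesis by (simp add: x_def power_mult_distrib)
  qed
  have "norm (char (distr M borel Y) u - char (distr M borel V) u)
      = norm (CLINT w|M. iexp (u * Y w) - iexp (u * V w))"
    unfolding char_def
    by (subst (1 2) integral_distr, simp_all, subst Bochner_Integration.integral_diff)
      (auto intro!: integrable_const_bound[of _ 1])
  also have "\<dots> \<le> (\<integral>w. \<eta> + u\<^sup>2 / \<eta> * (Y w - V w)\<^sup>2 \<partial>M)"
    by (rule order_trans[OF integral_norm_bound], rule integral_mono')
      (use i b assms(5) in \<open>auto simp del: of_real_mult\<close>)
  also have "\<dots> = \<eta> + u\<^sup>2 / \<eta> * (\<integral>w. (Y w - V w)\<^sup>2 \<partial>M)"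
    using i by (simp add: prob_space)
  also have "\<dots> \<le> \<eta> + u\<^sup>2 / \<eta> * q" using q assms(5) by (intro add_left_mono mult_left_mono) auto
  finally show ?thesis by simp
qed

text \<open>The choice \<open>D0 = {}\<close> gives the Levy-Khintchine formula itself.\<close>

lemma (in prob_space) char_levy_remove_jumps:
  assumes X: "levy_triplet M X \<sigma> b \<nu>" and D0: "D0 \<in> sets borel" "0 < \<theta>" "D0 \<subseteq> {z. \<theta> < \<bar>z\<bar>}"
    and t: "0 < t"
  obtains Z where "Z \<in> borel_measurable M" "D0 = {} \<Longrightarrow> AE w in M. Z w = 0"
    "\<And>u. char (distr M borel (\<lambda>w. X t w - Z w)) u
       = exp (t * (levy_exponent \<sigma> b \<nu> u - (CLINT z:D0|\<nu>. iexp (u * z) - 1)))"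
proof -
  obtain W \<mu> Jp where lev: "levy_measure \<nu>" and bm: "brownian_motion M W"
    and prm: "poisson_random_measure M (jump_intensity \<nu>) \<mu>"
    and ind: "indep_process_random_measure M W (jump_intensity \<nu>) \<mu>"
    and J: "\<And>t. 0 \<le> t \<Longrightarrow> compensated_small_jumps M (jump_intensity \<nu>) \<mu> t (Jp t)"
    and Xeq: "\<And>t. 0 \<le> t \<Longrightarrow> AE w in M. X t w = b * t + \<sigma> * W t w + Jp t w
                   + set_lebesgue_integral (\<mu> w) ({0<..t} \<times> {x. 1 < \<bar>x\<bar>}) snd"
    using X unfolding levy_triplet_def by blast
  have s[measurable_cong]: "sets \<nu> = sets borel" using lev by (simp add: levy_measure_def)
  have t0: "0 \<le> t" using t by simp
  have Xm[measurable]: "X t \<in> borel_measurable M"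
    using X t unfolding levy_triplet_def levy_process_def by simp
  have Wm[measurable]: "W t \<in> borel_measurable M"
    using bm t unfolding brownian_motion_def by simp
  note jumps = char_large_jumps[OF lev prm ind Wm _ _ _ t0, where \<sigma> = \<sigma>]
  obtain Z where Zm[measurable]: "Z \<in> borel_measurable M" and
    Z: "AE w in M. integrable (\<mu> w) (\<lambda>p. indicator ({0<..t} \<times> D0) p *\<^sub>R snd p) \<and>
       Z w = set_lebesgue_integral (\<mu> w) ({0<..t} \<times> D0) snd"
    by (rule jumps[OF D0]) blast
  \<comment> \<open>Cutoffs tending to 0 that stay strictly below both \<theta> and 1, so that D0
    and the jumps larger than 1 always lie above the cutoff; the divisor is at least 2 to make this
    strict.\<close>
  define d where "d k = min \<theta> 1 / real (k + 2)" for k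
  have d: "0 < d k" "d k < \<theta>" "d k < 1" for k
  proof -
    have m: "0 < min \<theta> 1" using D0 by simp
    show "0 < d k" unfolding d_def using m by simp
    have "d k < min \<theta> 1 / 1" unfolding d_def using m by (intro divide_strict_left_mono) auto
    then have "d k < min \<theta> 1" by simp
    then show "d k < \<theta>" "d k < 1" by auto
  qed
  have dlim: "filterlim d (at_right 0) sequentially"
  proof -
    have "d \<longlonglongrightarrow> 0"
      unfolding d_def by (rule LIMSEQ_ignore_initial_segment[of "\<lambda>k. min \<theta> 1 / real k"]) (rule lim_const_over_n)
    moreover have "d k \<noteq> 0" for k using d(1)[of k] by simp
    ultimately show ?thesis using d(1) by (auto simp: filterlim_at)
  qed
  \<comment> \<open>\<open>D k\<close> collects the jumps above the cutoff that are kept;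
    \<open>E k\<close> below collects those above the cutoff that are compensated.\<close>
  define D where "D k = {z. d k < \<bar>z\<bar>} - D0" for k
  have D: "D k \<in> sets borel" "D k \<subseteq> {z. d k < \<bar>z\<bar>}" for k using D0 unfolding D_def by auto
  define E where "E k = {z. d k < \<bar>z\<bar> \<and> \<bar>z\<bar> \<le> (1::real)}" for k
  have E: "E k \<in> sets borel" "E k \<subseteq> {z. d k < \<bar>z\<bar>}" "0 \<notin> E k" for k
    unfolding E_def using d(1)[of k] by auto
  define a where "a k = set_lebesgue_integral \<nu> (E k) (\<lambda>z. z)" for k
  \<comment> \<open>The compensator is an integral over a product measure, hence linear in
    t.\<close>
  have a_eq: "set_lebesgue_integral (jump_intensity \<nu>) ({0<..t} \<times> E k) snd = t * a k" for k
  proof -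
    interpret R: sigma_finite_measure "restrict_space \<nu> (- {0})"
      by (intro sigma_finite_measure_restrict_space levy_measure_facts lev) (simp add: s)
    interpret L: sigma_finite_measure "restrict_space lborel {0::real..}"
      by (intro sigma_finite_measure_restrict_space sigma_finite_lborel) simp
    interpret P: pair_sigma_finite "restrict_space lborel {0::real..}" "restrict_space \<nu> (- {0})" ..
    have sE: "{0<..t} \<times> E k \<in> sets (jump_intensity \<nu>)"
      and eE: "emeasure (jump_intensity \<nu>) ({0<..t} \<times> E k) = ennreal t * emeasure \<nu> (E k)"
      using jump_intensity_rect[OF lev E(1,3) t0] by auto
    have "emeasure \<nu> (E k) < \<infinity>" by (rule levy_measure_facts(2)[OF lev E(1) d(1) E(2)])
    then have "emeasure (jump_intensity \<nu>) ({0<..t} \<times> E k) < \<infinity>" by (simp add: eE ennreal_mult_less_top)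
    then have i: "integrable (jump_intensity \<nu>) (indicator ({0<..t} \<times> E k) :: _ \<Rightarrow> real)"
      using sE by (intro integrable_real_indicator)
    have [measurable]: "snd \<in> borel_measurable (jump_intensity \<nu>)" "{0<..t} \<times> E k \<in> sets (jump_intensity \<nu>)"
      using snd_measurable_jump_intensity[OF lev] sE by auto
    have int: "integrable (jump_intensity \<nu>) (\<lambda>p. indicator ({0<..t} \<times> E k) p *\<^sub>R snd p)"
      by (rule Bochner_Integration.integrable_bound[OF i], measurable)
        (auto simp: indicator_def E_def)
    have "set_lebesgue_integral (jump_intensity \<nu>) ({0<..t} \<times> E k) snd
       = (\<integral>r. \<integral>z. indicator ({0<..t} \<times> E k) (r, z) *\<^sub>R z \<partial>restrict_space \<nu> (- {0}) \<partial>restrict_space lborel {0..})"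
      using P.integral_fst'[OF int[unfolded jump_intensity_def]]
      by (simp add: set_lebesgue_integral_def jump_intensity_def)
    also have "\<dots> = (\<integral>r. indicator {0<..t} r * (\<integral>z. indicator (E k) z *\<^sub>R z \<partial>restrict_space \<nu> (- {0})) \<partial>restrict_space lborel {0..})"
      by (simp add: indicator_times mult.assoc)
    also have "(\<integral>z. indicator (E k) z *\<^sub>R z \<partial>restrict_space \<nu> (- {0})) = a k"
      unfolding a_def set_lebesgue_integral_def
      by (subst integral_restrict_space) (auto simp: s intro!: Bochner_Integration.integral_cong simp: indicator_def)
    also have "(\<integral>r. indicator {0<..t} r * a k \<partial>restrict_space lborel {0..}) = (\<integral>r. indicator {0<..t} r * a k \<partial>lborel)"
      by (subst integral_restrict_space, simp, rule arg_cong[where f = "integral\<^sup>L lborel"])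
        (auto simp: fun_eq_iff indicator_def)
    also have "\<dots> = t * a k" using t by simp
    finally show ?thesis .
  qed
  define P where "P k U \<longleftrightarrow> U \<in> borel_measurable M \<and> (AE w in M. integrable (\<mu> w) (\<lambda>p. indicator ({0<..t} \<times> D k) p *\<^sub>R snd p) \<and>
       U w = set_lebesgue_integral (\<mu> w) ({0<..t} \<times> D k) snd) \<and>
      (\<forall>u. char (distr M borel (\<lambda>w. \<sigma> * W t w + U w)) u
      = char (distr M borel (\<lambda>w. \<sigma> * W t w)) u * exp (t * (CLINT z:D k|\<nu>. iexp (u * z) - 1)))" for k U
  have "\<exists>U. P k U" for k
  proof (rule jumps[OF D(1) d(1) D(2)])
    fix U
    assume "U \<in> borel_measurable M" "AE w in M. integrable (\<mu> w) (\<lambda>p. indicator ({0<..t} \<times> D k) p *\<^sub>R snd p) \<and>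
       U w = set_lebesgue_integral (\<mu> w) ({0<..t} \<times> D k) snd"
      "\<And>u. char (distr M borel (\<lambda>w. \<sigma> * W t w + U w)) u
      = char (distr M borel (\<lambda>w. \<sigma> * W t w)) u * exp (t * (CLINT z:D k|\<nu>. iexp (u * z) - 1))"
    then have "P k U" unfolding P_def by (intro conjI allI)
    then show ?thesis by blast
  qed
  then obtain U where "P k (U k)" for k by metis
  then have Um: "\<And>k. U k \<in> borel_measurable M"
    and U: "\<And>k. AE w in M. integrable (\<mu> w) (\<lambda>p. indicator ({0<..t} \<times> D k) p *\<^sub>R snd p) \<and>
       U k w = set_lebesgue_integral (\<mu> w) ({0<..t} \<times> D k) snd"
    and cU: "\<And>k u. char (distr M borel (\<lambda>w. \<sigma> * W t w + U k w)) u
      = char (distr M borel (\<lambda>w. \<sigma> * W t w)) u * exp (t * (CLINT z:D k|\<nu>. iexp (u * z) - 1))"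
    unfolding P_def by auto
  note [measurable] = Um
  define Y where "Y w = X t w - Z w" for w
  \<comment> \<open>\<open>V k\<close> approximates \<open>Y\<close>: it contains all kept jumps
    above the cutoff, and the compensator of \<open>E k\<close> enters as a deterministic
    drift.\<close>
  define V where "V k w = (b * t - t * a k) + (\<sigma> * W t w + U k w)" for k w
  have [measurable]: "Y \<in> borel_measurable M" "V k \<in> borel_measurable M" for k
    unfolding Y_def[abs_def] V_def[abs_def] by measurable
  define Q where "Q k = (\<integral>\<^sup>+ w. ennreal ((Y w - V k w)\<^sup>2) \<partial>M)" for k
  \<comment> \<open>The jumps above the cutoff are split in two ways, into \<open>D k\<close> and
    D0, and into \<open>E k\<close> and the jumps larger than 1. What remains is exactly the error
    in the definition of the compensated integral, up to sign.\<close>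
  have AEd: "AE w in M. Y w - V k w = - ((set_lebesgue_integral (\<mu> w) ({0<..t} \<times> E k) snd
      - set_lebesgue_integral (jump_intensity \<nu>) ({0<..t} \<times> E k) snd) - Jp t w)" for k
    using Z U[of k] Xeq[OF t0] AE_space
  proof eventually_elim
    case (elim w)
    have sw: "sets (\<mu> w) = sets (jump_intensity \<nu>)"
      using prm elim unfolding poisson_random_measure_def by blast
    have all: "set_integrable (\<mu> w) ({0<..t} \<times> {z. d k < \<bar>z\<bar>}) snd"
      and sum1: "set_lebesgue_integral (\<mu> w) ({0<..t} \<times> {z. d k < \<bar>z\<bar>}) snd = U k w + Z w"
    proof -
      have un: "{0<..t} \<times> {z. d k < \<bar>z\<bar>} = ({0<..t} \<times> D k) \<union> ({0<..t} \<times> D0)"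
        unfolding D_def using D0(3) d(2)[of k] by auto
      have dis: "({0<..t} \<times> D k) \<inter> ({0<..t} \<times> D0) = {}" unfolding D_def by auto
      have si: "set_integrable (\<mu> w) ({0<..t} \<times> D k) snd" "set_integrable (\<mu> w) ({0<..t} \<times> D0) snd"
        using elim unfolding set_integrable_def by auto
      have "0 \<notin> D k" "0 \<notin> D0" using D0 D(2)[of k] d(1)[of k] by auto
      then have "{0<..t} \<times> D k \<in> sets (\<mu> w)" "{0<..t} \<times> D0 \<in> sets (\<mu> w)"
        using jump_intensity_rect(1)[OF lev _ _ t0] D(1) D0(1) sw by auto
      then show "set_integrable (\<mu> w) ({0<..t} \<times> {z. d k < \<bar>z\<bar>}) snd"
        "set_lebesgue_integral (\<mu> w) ({0<..t} \<times> {z. d k < \<bar>z\<bar>}) snd = U k w + Z w"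
        unfolding un using si elim dis by (auto intro!: set_integrable_Un simp: set_integral_Un)
    qed
    have "0 \<notin> {z::real. 1 < \<bar>z\<bar>}" by simp
    then have m: "{0<..t} \<times> E k \<in> sets (\<mu> w)" "{0<..t} \<times> {z. 1 < \<bar>z\<bar>} \<in> sets (\<mu> w)"
      using jump_intensity_rect(1)[OF lev _ _ t0] E(1,3)[of k] sw by auto
    have un: "{0<..t} \<times> {z. d k < \<bar>z\<bar>} = ({0<..t} \<times> E k) \<union> ({0<..t} \<times> {z. 1 < \<bar>z\<bar>})"
      unfolding E_def using d(3)[of k] by auto
    have dis: "({0<..t} \<times> E k) \<inter> ({0<..t} \<times> {z. 1 < \<bar>z\<bar>}) = {}" unfolding E_def by auto
    have "set_integrable (\<mu> w) ({0<..t} \<times> E k) snd" "set_integrable (\<mu> w) ({0<..t} \<times> {z. 1 < \<bar>z\<bar>}) snd"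
      by (rule set_integrable_subset[OF all]; use m un in auto)+
    then have "set_lebesgue_integral (\<mu> w) ({0<..t} \<times> {z. d k < \<bar>z\<bar>}) snd
      = set_lebesgue_integral (\<mu> w) ({0<..t} \<times> E k) snd + set_lebesgue_integral (\<mu> w) ({0<..t} \<times> {z. 1 < \<bar>z\<bar>}) snd"
      unfolding un using dis by (intro set_integral_Un)
    then show ?case using sum1 elim by (simp add: Y_def V_def a_eq)
  qed
  have Qlim: "Q \<longlonglongrightarrow> 0"
  proof -
    have "((\<lambda>\<delta>. \<integral>\<^sup>+ w. ennreal
          (((set_lebesgue_integral (\<mu> w) ({0<..t} \<times> {x. \<delta> < \<bar>x\<bar> \<and> \<bar>x\<bar> \<le> 1}) snd
            - set_lebesgue_integral (jump_intensity \<nu>) ({0<..t} \<times> {x. \<delta> < \<bar>x\<bar> \<and> \<bar>x\<bar> \<le> 1}) snd)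
            - Jp t w)\<^sup>2) \<partial>M) \<longlongrightarrow> 0) (at_right 0)"
      using J[OF t0] unfolding compensated_small_jumps_def by blast
    from filterlim_compose[OF this dlim] have "(\<lambda>k. \<integral>\<^sup>+ w. ennreal
          (((set_lebesgue_integral (\<mu> w) ({0<..t} \<times> E k) snd
            - set_lebesgue_integral (jump_intensity \<nu>) ({0<..t} \<times> E k) snd)
            - Jp t w)\<^sup>2) \<partial>M) \<longlonglongrightarrow> 0" unfolding E_def .
    moreover have "(\<integral>\<^sup>+ w. ennreal (((set_lebesgue_integral (\<mu> w) ({0<..t} \<times> E k) snd
            - set_lebesgue_integral (jump_intensity \<nu>) ({0<..t} \<times> E k) snd) - Jp t w)\<^sup>2) \<partial>M) = Q k" for k
      unfolding Q_def
    proof (rule nn_integral_cong_AE)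
      show "AE w in M. ennreal (((set_lebesgue_integral (\<mu> w) ({0<..t} \<times> E k) snd
            - set_lebesgue_integral (jump_intensity \<nu>) ({0<..t} \<times> E k) snd) - Jp t w)\<^sup>2) = ennreal ((Y w - V k w)\<^sup>2)"
        using AEd[of k] by eventually_elim (simp only: power2_minus)
    qed
    ultimately show ?thesis by simp
  qed
  have cV: "char (distr M borel (V k)) u = exp (t * (\<i> * (u * b) - (\<sigma>\<^sup>2 * u\<^sup>2 / 2 :: real)
      + (CLINT z:{z. d k < \<bar>z\<bar>}|\<nu>. iexp (u * z) - 1 - \<i> * (u * z * indicator {-1..1} z))
      - (CLINT z:D0|\<nu>. iexp (u * z) - 1)))" for k u
  proof -
    have "char (distr M borel (V k)) u = iexp (u * (b * t - t * a k)) * char (distr M borel (\<lambda>w. \<sigma> * W t w + U k w)) u"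
      unfolding char_def V_def[abs_def]
      by (subst (1 2) integral_distr) (simp_all add: ring_distribs exp_add exp_diff flip: integral_mult_right_zero)
    also have "\<dots> = exp (\<i> * (u * (b * t - t * a k)) - \<sigma>\<^sup>2 * u\<^sup>2 / 2 * t + t * (CLINT z:D k|\<nu>. iexp (u * z) - 1))"
      unfolding cU char_brownian[OF bm t]
      by (simp add: exp_add[symmetric] flip: exp_of_real) (rule arg_cong[where f = exp], simp add: algebra_simps)
    also have "(CLINT z:D k|\<nu>. iexp (u * z) - 1) = (CLINT z:{z. d k < \<bar>z\<bar>}|\<nu>. iexp (u * z) - 1) - (CLINT z:D0|\<nu>. iexp (u * z) - 1)"
    proof -
      have un: "{z. d k < \<bar>z\<bar>} = D k \<union> D0" unfolding D_def using D0(3) d(2)[of k] by auto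
      have "set_integrable \<nu> (D k) (\<lambda>z. iexp (u * z) - 1)" "set_integrable \<nu> D0 (\<lambda>z. iexp (u * z) - 1)"
        by (rule levy_measure_integrable_set[OF lev D(1) d(1) D(2) _ norm_iexp_minus_1(2)], measurable)
          (rule levy_measure_integrable_set[OF lev D0 _ norm_iexp_minus_1(2)], measurable)
      then show ?thesis unfolding un by (subst set_integral_Un) (auto simp: D_def)
    qed
    \<comment> \<open>The drift of \<open>V k\<close> moves into the integral as its compensator,
      which is what makes the integral converge when the cutoff tends to 0.\<close>
    also have "(CLINT z:{z. d k < \<bar>z\<bar>}|\<nu>. iexp (u * z) - 1)
       = (CLINT z:{z. d k < \<bar>z\<bar>}|\<nu>. iexp (u * z) - 1 - \<i> * (u * z * indicator {-1..1} z)) + \<i> * (u * a k)"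
    proof -
      have m: "{z::real. d k < \<bar>z\<bar>} \<in> sets borel" by simp
      have i1: "set_integrable \<nu> {z. d k < \<bar>z\<bar>} (\<lambda>z. iexp (u * z) - 1)"
        by (rule levy_measure_integrable_set[OF lev m d(1) order_refl _ norm_iexp_minus_1(2)], measurable)
      have i2: "set_integrable \<nu> {z. d k < \<bar>z\<bar>} (\<lambda>z. \<i> * (u * z * indicator {-1..1} z))"
        by (rule levy_measure_integrable_set[OF lev m d(1) order_refl, where B = "\<bar>u\<bar>"])
          (auto simp: norm_mult indicator_def abs_mult abs_le_iff intro!: mult_left_le)
      have "(CLINT z:{z. d k < \<bar>z\<bar>}|\<nu>. \<i> * (u * z * indicator {-1..1} z)) = (CLINT z|\<nu>. (\<i> * u) * complex_of_real (indicator (E k) z *\<^sub>R z))"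
        unfolding set_lebesgue_integral_def
        by (intro Bochner_Integration.integral_cong) (auto simp: indicator_def E_def abs_le_iff)
      also have "\<dots> = \<i> * (u * a k)"
        by (simp add: a_def set_lebesgue_integral_def flip: integral_complex_of_real)
      finally show ?thesis using set_integral_diff(2)[OF i1 i2] by simp
    qed
    finally show ?thesis by (simp add: algebra_simps)
  qed
  have "char (distr M borel Y) u = exp (t * (levy_exponent \<sigma> b \<nu> u - (CLINT z:D0|\<nu>. iexp (u * z) - 1)))" for u
  proof (rule LIMSEQ_unique)
    have "(\<lambda>k. CLINT z:{z. d k < \<bar>z\<bar>}|\<nu>. iexp (u * z) - 1 - \<i> * (u * z * indicator {-1..1} z))
       \<longlonglongrightarrow> (CLINT z|\<nu>. iexp (u * z) - 1 - \<i> * (u * z * indicator {-1..1} z))"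
      unfolding set_lebesgue_integral_def
    proof (rule integral_dominated_convergence[where w = "\<lambda>z. (2 + u\<^sup>2) * min 1 (z\<^sup>2)"])
      show "integrable \<nu> (\<lambda>z. (2 + u\<^sup>2) * min 1 (z\<^sup>2))"
        by (intro integrable_mult_right levy_measure_facts lev)
      show "AE z in \<nu>. (\<lambda>k. indicator {z. d k < \<bar>z\<bar>} z *\<^sub>R (iexp (u * z) - 1 - \<i> * (u * z * indicator {-1..1} z)))
          \<longlonglongrightarrow> iexp (u * z) - 1 - \<i> * (u * z * indicator {-1..1} z)"
      proof (rule AE_I2)
        fix z
        show "(\<lambda>k. indicator {z. d k < \<bar>z\<bar>} z *\<^sub>R (iexp (u * z) - 1 - \<i> * (u * z * indicator {-1..1} z)))
          \<longlonglongrightarrow> iexp (u * z) - 1 - \<i> * (u * z * indicator {-1..1} z)"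
        proof (cases "z = 0")
          case False
          have "d \<longlonglongrightarrow> 0" using dlim by (simp add: filterlim_at)
          then have "\<forall>\<^sub>F k in sequentially. d k < \<bar>z\<bar>"
            using False by (intro order_tendstoD(2)) auto
          then have "\<forall>\<^sub>F k in sequentially. indicator {z. d k < \<bar>z\<bar>} z *\<^sub>R (iexp (u * z) - 1 - \<i> * (u * z * indicator {-1..1} z))
             = iexp (u * z) - 1 - \<i> * (u * z * indicator {-1..1} z)"
            by eventually_elim simp
          then show ?thesis by (rule tendsto_eventually)
        qed simp
      qed
      show "AE z in \<nu>. norm (indicator {z. d k < \<bar>z\<bar>} z *\<^sub>R (iexp (u * z) - 1 - \<i> * (u * z * indicator {-1..1} z)))
         \<le> (2 + u\<^sup>2) * min 1 (z\<^sup>2)" for k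
        using levy_exponent_bound[of u] by (auto simp: indicator_def split: if_splits)
    qed measurable
    then show "(\<lambda>k. char (distr M borel (V k)) u) \<longlonglongrightarrow> exp (t * (levy_exponent \<sigma> b \<nu> u - (CLINT z:D0|\<nu>. iexp (u * z) - 1)))"
      unfolding cV levy_exponent_def by (intro tendsto_intros)
    show "(\<lambda>k. char (distr M borel (V k)) u) \<longlonglongrightarrow> char (distr M borel Y) u"
    proof (rule LIMSEQ_I)
      fix r :: real assume r: "r > 0"
      \<comment> \<open>With \<eta> = r / 4 in \<open>char_diff_bound\<close>, both terms of the
        bound are at most r / 4; the summand 1 in u^2 + 1 covers the case u = 0.\<close>
      define q where "q = r\<^sup>2 / (16 * (u\<^sup>2 + 1))"
      have u1: "u\<^sup>2 + 1 > 0" by (simp add: add_nonneg_pos)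
      have q: "q > 0" unfolding q_def using r u1 by simp
      have "\<forall>\<^sub>F k in sequentially. Q k < ennreal q"
        using Qlim q by (intro order_tendstoD(2)) auto
      then obtain N where N: "\<And>k. k \<ge> N \<Longrightarrow> Q k < ennreal q" unfolding eventually_sequentially by auto
      have "norm (char (distr M borel (V k)) u - char (distr M borel Y) u) < r" if "k \<ge> N" for k
      proof -
        have "norm (char (distr M borel Y) u - char (distr M borel (V k)) u) \<le> r / 4 + u\<^sup>2 * q / (r / 4)"
          by (rule char_diff_bound) (use N[OF that] q r in \<open>auto simp: Q_def\<close>)
        also have "u\<^sup>2 * q \<le> (u\<^sup>2 + 1) * q" using q by simp
        then have "u\<^sup>2 * q / (r / 4) \<le> (u\<^sup>2 + 1) * q / (r / 4)" using r by (intro divide_right_mono) auto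
        also have "(u\<^sup>2 + 1) * q = r\<^sup>2 / 16"
        proof -
          have "v * (r\<^sup>2 / (16 * v)) = r\<^sup>2 / 16" if "v \<noteq> 0" for v :: real using that by simp
          from this[of "u\<^sup>2 + 1"] u1 show ?thesis unfolding q_def by simp
        qed
        also have "r\<^sup>2 / 16 / (r / 4) = r / 4" using r by (simp add: power2_eq_square)
        finally show ?thesis using r by (simp add: norm_minus_commute)
      qed
      then show "\<exists>no. \<forall>n\<ge>no. norm (char (distr M borel (V n)) u - char (distr M borel Y) u) < r" by blast
    qed
  qed
  moreover have "AE w in M. Z w = 0" if "D0 = {}"
    using Z by eventually_elim (simp add: that set_lebesgue_integral_def)
  ultimately show ?thesis using that[OF Zm] unfolding Y_def[abs_def] by blast
qed

section \<open>The generator as a second order operator\<close>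

definition large_jump_kernel :: "real measure \<Rightarrow> (real \<Rightarrow> real) \<Rightarrow> real measure" where
  "large_jump_kernel \<nu> c = density \<nu> (\<lambda>x. ennreal (1 - c x))"

text \<open>The image of \<open>(1 - \<beta>) w\<^sup>2 c(w) d\<beta> \<nu>(dw)\<close> under \<open>(\<beta>, w) \<mapsto> \<beta> w\<close>, so that the small jump part
  of the generator averages \<open>g''\<close> over this measure.\<close>

definition small_jump_kernel :: "real measure \<Rightarrow> (real \<Rightarrow> real) \<Rightarrow> real measure" where
  "small_jump_kernel \<nu> c = distr (density (lborel \<Otimes>\<^sub>M \<nu>)
     (\<lambda>p. ennreal (indicator {0..1} (fst p) * (1 - fst p) * ((snd p)\<^sup>2 * c (snd p))))) borel (\<lambda>p. fst p * snd p)"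

text \<open>The operator \<open>L_trunc\<close> without reference to a density, the double integral
  being absorbed in a finite kernel; the two agree on \<open>Cb 2\<close> by
  \<open>L_trunc_eq\<close>.\<close>

definition small_jump_generator ::
  "real \<Rightarrow> real \<Rightarrow> real measure \<Rightarrow> (real \<Rightarrow> real) \<Rightarrow> (real \<Rightarrow> real) \<Rightarrow> real \<Rightarrow> real" where
  "small_jump_generator \<sigma> b \<nu> c g x = b_trunc b \<nu> c * deriv g x + \<sigma>\<^sup>2 / 2 * deriv (deriv g) x
     + conv_op (small_jump_kernel \<nu> c) (deriv (deriv g)) x"

lemma taylor_second_order:
  assumes "Cb 2 g"
  shows "g (x + w) - g x - w * deriv g x = w\<^sup>2 * (LBINT \<beta>:{0..1}. deriv (deriv g) (x + \<beta> * w) * (1 - \<beta>))"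
proof -
  note g = Cb_2D[OF assms]
  have cont: "continuous_on UNIV (deriv (deriv g))" by (rule Cb_continuous[OF g(5)])
  \<comment> \<open>The terms with the first derivative cancel when h is differentiated, leaving w^2
    (1 - \<beta>) times the second derivative; h 1 - h 0 is the left-hand side.\<close>
  define h where "h \<beta> = g (x + \<beta> * w) + (1 - \<beta>) * w * deriv g (x + \<beta> * w)" for \<beta>
  have "(h has_real_derivative w\<^sup>2 * (deriv (deriv g) (x + \<beta> * w) * (1 - \<beta>))) (at \<beta> within S)" for \<beta> S
  proof -
    have l: "((\<lambda>\<beta>. x + \<beta> * w) has_real_derivative w) (at \<beta> within S)"
      by (auto intro!: derivative_eq_intros)
    show ?thesis unfolding h_def[abs_def]
      by (rule derivative_eq_intros refl DERIV_chain2[OF g(6) l] DERIV_chain2[OF g(7) l])+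
        (simp add: algebra_simps power2_eq_square)
  qed
  then have "((\<lambda>\<beta>. w\<^sup>2 * (deriv (deriv g) (x + \<beta> * w) * (1 - \<beta>))) has_integral (h 1 - h 0)) {0..1}"
    by (intro fundamental_theorem_of_calculus) (auto simp: has_real_derivative_iff_has_vector_derivative[symmetric])
  then have "integral {0..1} (\<lambda>\<beta>. w\<^sup>2 * (deriv (deriv g) (x + \<beta> * w) * (1 - \<beta>))) = h 1 - h 0"
    by (rule integral_unique)
  then have "w\<^sup>2 * integral {0..1} (\<lambda>\<beta>. deriv (deriv g) (x + \<beta> * w) * (1 - \<beta>)) = g (x + w) - g x - w * deriv g x"
    by (simp add: h_def)
  moreover have "set_integrable lborel {0..1} (\<lambda>\<beta>. deriv (deriv g) (x + \<beta> * w) * (1 - \<beta>))"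
    by (intro borel_integrable_atLeastAtMost' continuous_intros continuous_on_compose2[OF cont]) auto
  then have "(LBINT \<beta>:{0..1}. deriv (deriv g) (x + \<beta> * w) * (1 - \<beta>)) = integral {0..1} (\<lambda>\<beta>. deriv (deriv g) (x + \<beta> * w) * (1 - \<beta>))"
    by (rule set_borel_integral_eq_integral)
  ultimately show ?thesis by simp
qed

lemma truncation_facts:
  assumes "truncation_function \<epsilon> c" "0 < \<epsilon>"
  shows "c \<in> borel_measurable borel" "0 \<le> c x" "c x \<le> 1" "\<bar>x\<bar> \<le> \<epsilon> / 2 \<Longrightarrow> c x = 1" "\<epsilon> < \<bar>x\<bar> \<Longrightarrow> c x = 0"
proof -
  have sm: "smooth c" and le: "\<And>x. indicator {- \<epsilon> / 2..\<epsilon> / 2} x \<le> c x" "\<And>x. c x \<le> indicator {- \<epsilon>..\<epsilon>} x"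
    using assms unfolding truncation_function_def by auto
  have "\<forall>x. (deriv ^^ 0) c differentiable (at x)" using sm unfolding smooth_def by blast
  then have "c differentiable (at x)" for x by simp
  then have "continuous_on UNIV c"
    by (auto intro!: continuous_at_imp_continuous_on differentiable_imp_continuous_within)
  then show "c \<in> borel_measurable borel" by (rule borel_measurable_continuous_onI)
  show c0: "0 \<le> c x" using order_trans[OF indicator_pos_le le(1)] .
  have "indicator {- \<epsilon>..\<epsilon>} x \<le> (1::real)" by (simp add: indicator_def)
  then show c1: "c x \<le> 1" using le(2)[of x] by linarith
  show "c x = 1" if "\<bar>x\<bar> \<le> \<epsilon> / 2"
  proof -
    have "x \<in> {- \<epsilon> / 2..\<epsilon> / 2}" using that by (auto simp del: le_divide_eq_numeral1 divide_le_eq_numeral1)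
    then show ?thesis using le(1)[of x] c1 by simp
  qed
  show "c x = 0" if "\<epsilon> < \<bar>x\<bar>"
  proof -
    have "x \<notin> {- \<epsilon>..\<epsilon>}" using that by auto
    then show ?thesis using le(2)[of x] c0 by simp
  qed
qed

text \<open>The bound \<epsilon> \<le> 1 puts the support of c inside [-1, 1], the range of jumps
  that the generator compensates; \<open>generator_decomp\<close> relies on this.\<close>

locale levy_truncation =
  fixes \<sigma> b :: real and \<nu> :: "real measure" and \<epsilon> :: real and c :: "real \<Rightarrow> real"
  assumes lev: "levy_measure \<nu>" and eps: "0 < \<epsilon>" "\<epsilon> \<le> 1" and trunc: "truncation_function \<epsilon> c"
begin

lemmas c_facts = truncation_facts[OF trunc eps(1)]

abbreviation "\<kappa>I \<equiv> large_jump_kernel \<nu> c"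
abbreviation "\<kappa>S \<equiv> small_jump_kernel \<nu> c"
abbreviation "L \<equiv> levy_generator \<sigma> b \<nu>"
abbreviation "L\<epsilon> \<equiv> small_jump_generator \<sigma> b \<nu> c"
abbreviation "lam \<equiv> lambda_trunc \<nu> c"

lemma sets_nu[measurable_cong, simp]: "sets \<nu> = sets borel"
  using lev by (simp add: levy_measure_def)

lemma space_nu[simp]: "space \<nu> = UNIV"
  using sets_eq_imp_space_eq[OF sets_nu] by simp

lemma c_measurable[measurable]: "c \<in> borel_measurable borel"
  by (rule c_facts)

lemma one_minus_c_le: "1 - c x \<le> indicator {x. \<epsilon> / 2 < \<bar>x\<bar>} x" "0 \<le> 1 - c x"
  using c_facts(2-4)[of x] by (auto simp: indicator_def)

text \<open>The factor 1 - c vanishes near 0, so f matters only for |x| > \<epsilon> / 2, where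
  \<nu> has finite mass.\<close>

lemma integrable_one_minus_c:
  assumes "f \<in> borel_measurable borel" "\<And>x. \<epsilon> / 2 < \<bar>x\<bar> \<Longrightarrow> \<bar>f x\<bar> \<le> B"
  shows "integrable \<nu> (\<lambda>x. f x * (1 - c x))"
proof -
  note [measurable] = assms(1)
  have "set_integrable \<nu> {x. \<epsilon> / 2 < \<bar>x\<bar>} (\<lambda>x. f x * (1 - c x))"
  proof (rule levy_measure_integrable_set[OF lev _ _ order_refl])
    show "norm (f z * (1 - c z)) \<le> B" if "z \<in> {x. \<epsilon> / 2 < \<bar>x\<bar>}" for z
      using assms(2)[of z] that c_facts(2,3)[of z] mult_mono[of "\<bar>f z\<bar>" B "1 - c z" 1]
      by (auto simp: abs_mult)
  qed (use eps in auto)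
  moreover have "indicator {x. \<epsilon> / 2 < \<bar>x\<bar>} x *\<^sub>R (f x * (1 - c x)) = f x * (1 - c x)" for x
    using c_facts(4)[of x] by (auto simp: indicator_def)
  ultimately show ?thesis unfolding set_integrable_def by (simp only:)
qed

lemma finite_large: "finite_borel_measure \<kappa>I"
proof (rule finite_borel_measure.intro, rule finite_measureI)
  have i: "integrable \<nu> (\<lambda>x. 1 - c x)" using integrable_one_minus_c[of "\<lambda>_. 1" 1] by simp
  have "emeasure \<kappa>I (space \<kappa>I) = (\<integral>\<^sup>+x. ennreal (1 - c x) \<partial>\<nu>)"
    unfolding large_jump_kernel_def by (simp add: emeasure_density)
  also have "\<dots> = ennreal (\<integral>x. 1 - c x \<partial>\<nu>)"
    using i one_minus_c_le(2) by (intro nn_integral_eq_integral) auto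
  finally show "emeasure \<kappa>I (space \<kappa>I) \<noteq> \<infinity>" by simp
qed (simp add: large_jump_kernel_def finite_borel_measure_axioms_def)

lemma conv_op_large: "g \<in> borel_measurable borel \<Longrightarrow> conv_op \<kappa>I g x = (\<integral>u. g (x + u) * (1 - c u) \<partial>\<nu>)"
  unfolding conv_op_def large_jump_kernel_def using one_minus_c_le(2)
  by (subst integral_density) (auto simp: mult.commute)

lemma nu_sigma_finite: "sigma_finite_measure \<nu>"
  by (rule levy_measure_facts[OF lev])

lemma integrable_w2c: "integrable \<nu> (\<lambda>w. w\<^sup>2 * c w)"
proof (rule Bochner_Integration.integrable_bound[OF levy_measure_facts(3)[OF lev]])
  have "w\<^sup>2 * c w \<le> min 1 (w\<^sup>2)" for w
  proof (cases "\<bar>w\<bar> \<le> \<epsilon>")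
    case True
    then have "w\<^sup>2 \<le> 1" using eps by (simp add: abs_square_le_1)
    then show ?thesis using c_facts(2,3)[of w] mult_left_le[of "c w" "w\<^sup>2"] by auto
  next
    case False
    then show ?thesis using c_facts(5)[of w] by auto
  qed
  then show "AE w in \<nu>. norm (w\<^sup>2 * c w) \<le> norm (min 1 (w\<^sup>2))"
    using c_facts(2) by (auto simp: abs_mult)
qed measurable

text \<open>Fubini on the product of Lebesgue measure and \<nu>. The mass of the kernel is half the
  integral of w^2 c(w), finite since w^2 c(w) \<le> min 1 (w^2).\<close>

lemma finite_small: "finite_borel_measure \<kappa>S"
  and conv_op_small: "Cb 0 h \<Longrightarrow> conv_op \<kappa>S h x = (\<integral>w. (LBINT \<beta>:{0..1}. h (x + \<beta> * w) * (1 - \<beta>)) * w\<^sup>2 * c w \<partial>\<nu>)"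
  and integrable_small: "Cb 0 h \<Longrightarrow> integrable \<nu> (\<lambda>w. (LBINT \<beta>:{0..1}. h (x + \<beta> * w) * (1 - \<beta>)) * w\<^sup>2 * c w)"
proof -
  interpret N: sigma_finite_measure \<nu> by (rule nu_sigma_finite)
  interpret P: pair_sigma_finite lborel \<nu> ..
  define D where "D p = indicator {0..1} (fst p) * (1 - fst p) * ((snd p)\<^sup>2 * c (snd p))" for p :: "real \<times> real"
  have [measurable]: "D \<in> borel_measurable (lborel \<Otimes>\<^sub>M \<nu>)" unfolding D_def[abs_def] by measurable
  have D0: "0 \<le> D p" for p unfolding D_def using c_facts(2) by (auto simp: indicator_def)
  have i1: "integrable lborel (\<lambda>\<beta>::real. indicator {0..1} \<beta> * (1 - \<beta>))"
  proof -
    have "set_integrable lborel {0..1} (\<lambda>\<beta>::real. 1 - \<beta>)"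
      by (intro borel_integrable_atLeastAtMost' continuous_intros)
    then show ?thesis by (simp add: set_integrable_def)
  qed
  have iD: "integrable (lborel \<Otimes>\<^sub>M \<nu>) D"
  proof -
    have "integrable (lborel \<Otimes>\<^sub>M \<nu>) (\<lambda>(\<beta>, w). (indicator {0..1} \<beta> * (1 - \<beta>)) * (w\<^sup>2 * c w))"
    proof (rule P.Fubini_integrable)
      have n: "norm (indicator {0..1} \<beta> * (1 - \<beta>) * (w\<^sup>2 * c w)) = indicator {0..1} \<beta> * (1 - \<beta>) * (w\<^sup>2 * c w)" for \<beta> w :: real
        using c_facts(2)[of w] by (auto simp: indicator_def abs_mult)
      show "integrable lborel (\<lambda>x. \<integral>y. norm (case (x, y) of (\<beta>, w) \<Rightarrow> indicator {0..1} \<beta> * (1 - \<beta>) * (w\<^sup>2 * c w)) \<partial>\<nu>)"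
        using i1 by (simp only: n prod.case integral_mult_right_zero integrable_mult_left)
      show "AE x in lborel. integrable \<nu> (\<lambda>y. case (x, y) of (\<beta>, w) \<Rightarrow> indicator {0..1} \<beta> * (1 - \<beta>) * (w\<^sup>2 * c w))"
        using integrable_w2c by simp
    qed measurable
    then show ?thesis by (simp add: D_def[abs_def] case_prod_beta')
  qed
  have kS: "\<kappa>S = distr (density (lborel \<Otimes>\<^sub>M \<nu>) (\<lambda>p. ennreal (D p))) borel (\<lambda>p. fst p * snd p)"
    unfolding small_jump_kernel_def D_def ..
  show "finite_borel_measure \<kappa>S"
  proof (rule finite_borel_measure.intro, rule finite_measureI)
    have m: "(\<lambda>p. ennreal (D p)) \<in> borel_measurable (lborel \<Otimes>\<^sub>M \<nu>)" by measurable
    have "emeasure \<kappa>S (space \<kappa>S) = emeasure (density (lborel \<Otimes>\<^sub>M \<nu>) (\<lambda>p. ennreal (D p))) (space (lborel \<Otimes>\<^sub>M \<nu>))"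
      unfolding kS by (subst emeasure_distr) auto
    also have "\<dots> = (\<integral>\<^sup>+p. ennreal (D p) * indicator (space (lborel \<Otimes>\<^sub>M \<nu>)) p \<partial>(lborel \<Otimes>\<^sub>M \<nu>))"
      by (rule emeasure_density[OF m sets.top])
    also have "\<dots> = (\<integral>\<^sup>+p. ennreal (D p) \<partial>(lborel \<Otimes>\<^sub>M \<nu>))"
      by (intro nn_integral_cong) auto
    also have "\<dots> = ennreal (integral\<^sup>L (lborel \<Otimes>\<^sub>M \<nu>) D)"
      using iD D0 by (intro nn_integral_eq_integral) auto
    finally show "emeasure \<kappa>S (space \<kappa>S) \<noteq> \<infinity>" by simp
  qed (simp add: kS finite_borel_measure_axioms_def)
  assume h: "Cb 0 h"
  note [measurable] = Cb_measurable[OF h]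
  obtain B where B: "\<And>x. \<bar>h x\<bar> \<le> B" "0 \<le> B" using Cb_bound[OF h] by auto
  have int: "integrable (lborel \<Otimes>\<^sub>M \<nu>) (\<lambda>p. D p * h (x + fst p * snd p))"
  proof (rule Bochner_Integration.integrable_bound)
    show "integrable (lborel \<Otimes>\<^sub>M \<nu>) (\<lambda>p. D p * B)" using iD by auto
    show "AE p in lborel \<Otimes>\<^sub>M \<nu>. norm (D p * h (x + fst p * snd p)) \<le> norm (D p * B)"
      using B D0 by (auto simp: abs_mult intro!: mult_left_mono)
  qed measurable
  have int': "integrable (lborel \<Otimes>\<^sub>M \<nu>) (\<lambda>(\<beta>, w). D (\<beta>, w) * h (x + \<beta> * w))"
    using int by (simp add: case_prod_beta')
  have in_eq: "(\<integral>\<beta>. D (\<beta>, w) * h (x + \<beta> * w) \<partial>lborel) = (LBINT \<beta>:{0..1}. h (x + \<beta> * w) * (1 - \<beta>)) * w\<^sup>2 * c w" for w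
  proof -
    have "(\<integral>\<beta>. D (\<beta>, w) * h (x + \<beta> * w) \<partial>lborel) = (\<integral>\<beta>. (w\<^sup>2 * c w) * (indicator {0..1} \<beta> *\<^sub>R (h (x + \<beta> * w) * (1 - \<beta>))) \<partial>lborel)"
      by (intro Bochner_Integration.integral_cong) (auto simp: D_def)
    then show ?thesis by (simp add: set_lebesgue_integral_def)
  qed
  have "conv_op \<kappa>S h x = (\<integral>p. D p * h (x + fst p * snd p) \<partial>(lborel \<Otimes>\<^sub>M \<nu>))"
    unfolding conv_op_def kS using D0 by (subst integral_distr) (auto simp: integral_density)
  also have "\<dots> = (\<integral>w. \<integral>\<beta>. D (\<beta>, w) * h (x + \<beta> * w) \<partial>lborel \<partial>\<nu>)"
    using P.integral_snd[OF int'] by (simp add: case_prod_beta')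
  finally show "conv_op \<kappa>S h x = (\<integral>w. (LBINT \<beta>:{0..1}. h (x + \<beta> * w) * (1 - \<beta>)) * w\<^sup>2 * c w \<partial>\<nu>)"
    by (simp add: in_eq)
  show "integrable \<nu> (\<lambda>w. (LBINT \<beta>:{0..1}. h (x + \<beta> * w) * (1 - \<beta>)) * w\<^sup>2 * c w)"
    using P.integrable_snd[OF int'] by (simp add: in_eq)
qed

lemma second_order_small: "second_order L\<epsilon>"
proof -
  have n: "finite_borel_measure (null_measure borel)"
    by (rule finite_borel_measure.intro) (auto simp: finite_borel_measure_axioms_def intro!: finite_measureI)
  have "L\<epsilon> g = (\<lambda>x. 0 * g x + b_trunc b \<nu> c * deriv g x + \<sigma>\<^sup>2 / 2 * deriv (deriv g) x
      + conv_op (null_measure borel) g x + conv_op \<kappa>S (deriv (deriv g)) x)" for g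
    by (auto simp: small_jump_generator_def conv_op_def)
  then show ?thesis unfolding second_order_def using n finite_small by blast
qed

text \<open>The integrand is split by 1 = c + (1 - c). With c it is a Taylor remainder, averaged by
  the small jump kernel; with 1 - c each term is integrable by itself, and the compensator changes
  the drift b into \<open>b_trunc\<close>.\<close>

lemma generator_decomp:
  assumes g: "Cb 2 g"
  shows "L g x = L\<epsilon> g x + conv_op \<kappa>I g x - lam * g x"
proof -
  note g2 = Cb_2D[OF g]
  note [measurable] = Cb_measurable[OF g]
  obtain B where B: "\<And>x. \<bar>g x\<bar> \<le> B" using Cb_bound[OF g] by auto
  have i1: "integrable \<nu> (\<lambda>u. g (x + u) * (1 - c u))" using B by (intro integrable_one_minus_c[where B = B]) auto
  have i2: "integrable \<nu> (\<lambda>u. 1 * (1 - c u))" by (intro integrable_one_minus_c[where B = 1]) auto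
  have i3: "integrable \<nu> (\<lambda>u. (u * indicator {-1..1} u) * (1 - c u))"
    by (intro integrable_one_minus_c[where B = 1]) (auto simp: indicator_def abs_le_iff)
  note i4 = integrable_small[OF g2(5), of x]
  have "g (u + x) - g x - u * deriv g x * indicator {-1..1} u
     = (LBINT \<beta>:{0..1}. deriv (deriv g) (x + \<beta> * u) * (1 - \<beta>)) * u\<^sup>2 * c u + g (x + u) * (1 - c u)
        - g x * (1 * (1 - c u)) - deriv g x * ((u * indicator {-1..1} u) * (1 - c u))" for u
  proof -
    have "(LBINT \<beta>:{0..1}. deriv (deriv g) (x + \<beta> * u) * (1 - \<beta>)) * u\<^sup>2 * c u = (g (x + u) - g x - u * deriv g x) * c u"
      by (simp add: taylor_second_order[OF g] mult.commute)
    moreover have "c u = c u * indicator {-1..1} u"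
    proof (cases "\<epsilon> < \<bar>u\<bar>")
      case False
      then show ?thesis using eps by (auto simp: indicator_def)
    qed (use c_facts(5) in simp)
    ultimately show ?thesis
      by (cases "u \<in> {-1..1}") (auto simp: algebra_simps)
  qed
  then have int: "(\<integral>u. g (u + x) - g x - u * deriv g x * indicator {-1..1} u \<partial>\<nu>)
     = conv_op \<kappa>S (deriv (deriv g)) x + conv_op \<kappa>I g x - g x * lam - deriv g x * (\<integral>u. (u * indicator {-1..1} u) * (1 - c u) \<partial>\<nu>)"
    using i1 i2 i3 i4 by (simp add: conv_op_small[OF g2(5)] conv_op_large lambda_trunc_def)
  have bt: "(\<integral>u. (u * indicator {-1..1} u) * (1 - c u) \<partial>\<nu>) = b - b_trunc b \<nu> c"
    unfolding b_trunc_def set_lebesgue_integral_def by (simp add: mult_ac)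
  show ?thesis
    unfolding levy_generator_def small_jump_generator_def int bt by (simp add: algebra_simps)
qed

lemma second_order_generator: "second_order L"
proof -
  have "L g = (\<lambda>x. (- lam) * g x + b_trunc b \<nu> c * deriv g x + \<sigma>\<^sup>2 / 2 * deriv (deriv g) x
      + conv_op \<kappa>I g x + conv_op \<kappa>S (deriv (deriv g)) x)" if "Cb 2 g" for g
    using generator_decomp[OF that] by (auto simp: small_jump_generator_def)
  then show ?thesis unfolding second_order_def using finite_large finite_small by blast
qed

text \<open>As c vanishes beyond \<epsilon>, the value at x depends on g only within distance
  \<epsilon>. Convolution with \<open>\<kappa>I\<close> has no such locality, which is the reason
  for splitting the generator.\<close>

lemma small_generator_local:
  assumes g: "Cb 2 g" and z: "\<And>x. x < a \<Longrightarrow> g x = 0" and x: "x < a - \<epsilon>"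
  shows "L\<epsilon> g x = 0"
proof -
  note g2 = Cb_2D[OF g]
  have d1: "deriv g y = 0" if "y < a" for y
  proof (rule DERIV_imp_deriv)
    have "((\<lambda>_. 0) has_real_derivative 0) (at y)" by simp
    then show "(g has_real_derivative 0) (at y)"
      by (rule has_field_derivative_transform_within_open[of _ _ _ "{..<a}"]) (use that z in auto)
  qed
  have d2: "deriv (deriv g) y = 0" if "y < a" for y
  proof (rule DERIV_imp_deriv)
    have "((\<lambda>_. 0) has_real_derivative 0) (at y)" by simp
    then show "(deriv g has_real_derivative 0) (at y)"
      by (rule has_field_derivative_transform_within_open[of _ _ _ "{..<a}"]) (use that d1 in auto)
  qed
  have z0: "(LBINT \<beta>:{0..1}. deriv (deriv g) (x + \<beta> * w) * (1 - \<beta>)) * w\<^sup>2 * c w = 0" for w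
  proof (cases "\<bar>w\<bar> \<le> \<epsilon>")
    case True
    have eq: "indicator {0..1} \<beta> *\<^sub>R (deriv (deriv g) (x + \<beta> * w) * (1 - \<beta>)) = 0" for \<beta>
    proof (cases "\<beta> \<in> {0..1}")
      case b: True
      have "\<beta> * w \<le> \<beta> * \<bar>w\<bar>" using b by (intro mult_left_mono) auto
      also have "\<dots> \<le> 1 * \<bar>w\<bar>" using b by (intro mult_right_mono) auto
      finally have "\<beta> * w \<le> 1 * \<bar>w\<bar>" .
      then have "x + \<beta> * w < a" using x True by linarith
      then show ?thesis by (simp add: d2)
    qed simp
    show ?thesis unfolding set_lebesgue_integral_def eq by simp
  next
    case False
    then show ?thesis using c_facts(5)[of w] by simp
  qed
  have "conv_op \<kappa>S (deriv (deriv g)) x = 0" unfolding conv_op_small[OF g2(5)] z0 by simp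
  then show ?thesis using x eps d1[of x] d2[of x] by (simp add: small_jump_generator_def)
qed

end

section \<open>The action on characters\<close>

text \<open>The complex amplitude absorbs all phases: the translation invariant operators used here
  act on these functions by multiplying K with a complex number.\<close>

definition cexp :: "complex \<Rightarrow> real \<Rightarrow> real \<Rightarrow> real" where
  "cexp K u x = Re (K * iexp (u * x))"

lemma cexp_cos: "(\<lambda>x. cos (u * x + \<theta>)) = cexp (iexp \<theta>) u"
proof
  fix x
  have "iexp \<theta> * iexp (u * x) = cis (u * x + \<theta>)"
    by (simp add: cis_conv_exp exp_add[symmetric] algebra_simps)
  then show "cos (u * x + \<theta>) = cexp (iexp \<theta>) u x" by (simp add: cexp_def)
qed

lemma cexp_eq: "cexp K u x = Re K * cos (u * x + 0) + Im K * cos (u * x + pi / 2)"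
proof -
  have "iexp (u * x) = cis (u * x)" by (simp add: cis_conv_exp)
  then show ?thesis by (simp add: cexp_def cos_add)
qed

lemma cexp_sin_cos: "cexp K u x = Re K * cos (u * x) - Im K * sin (u * x)"
  unfolding cexp_eq by (simp add: cos_add)

lemma cexp_trig: "cexp K u \<in> trig"
  unfolding cexp_eq[abs_def] by (intro trig.intros)

lemma cexp_Cb: "Cb r (cexp K u)"
  by (rule trig_Cb[OF cexp_trig])

lemma cexp_deriv: "deriv (cexp K u) = cexp (K * (\<i> * u)) u"
proof
  fix x
  have "((\<lambda>x. Re K * cos (u * x) - Im K * sin (u * x)) has_real_derivative
      Re (K * (\<i> * u)) * cos (u * x) - Im (K * (\<i> * u)) * sin (u * x)) (at x)"
    by (auto intro!: derivative_eq_intros simp: algebra_simps)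
  then show "deriv (cexp K u) x = cexp (K * (\<i> * u)) u x"
    unfolding cexp_sin_cos[abs_def] by (rule DERIV_imp_deriv)
qed

context finite_borel_measure
begin

lemma integrable_iexp_char: "integrable M (\<lambda>x. iexp (u * x))"
  by (rule integrable_const_bound[where B = 1]) (use M_is_borel in \<open>auto cong: measurable_cong_sets\<close>)

lemma conv_op_cexp: "conv_op M (cexp K u) = cexp (K * char M u) u"
proof
  fix x
  have "conv_op M (cexp K u) x = (\<integral>v. Re ((K * iexp (u * x)) * iexp (u * v)) \<partial>M)"
    unfolding conv_op_def cexp_def
    by (intro Bochner_Integration.integral_cong arg_cong[where f = Re])
      (auto simp: exp_add[symmetric] algebra_simps)
  also have "\<dots> = Re (\<integral>v. (K * iexp (u * x)) * iexp (u * v) \<partial>M)"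
    using integrable_iexp_char by (intro integral_Re) auto
  also have "(\<integral>v. (K * iexp (u * x)) * iexp (u * v) \<partial>M) = (K * iexp (u * x)) * char M u"
    unfolding char_def by (rule integral_mult_right_zero)
  also have "(K * iexp (u * x)) * char M u = K * char M u * iexp (u * x)" by (simp only: mult_ac)
  finally show "conv_op M (cexp K u) x = cexp (K * char M u) u x"
    by (simp only: cexp_def[of "K * char M u"])
qed

lemma conv_op_pow_cexp: "(conv_op M ^^ k) (cexp K u) = cexp (K * char M u ^ k) u"
  by (induction k) (auto simp: conv_op_cexp mult_ac)

lemma Cb_conv_op_pow: "Cb r g \<Longrightarrow> Cb r ((conv_op M ^^ k) g)"
  by (induction k) (auto intro: Cb_conv_op)

lemma conv_op_pow_bound: "(\<And>x. \<bar>g x\<bar> \<le> B) \<Longrightarrow> \<bar>(conv_op M ^^ k) g x\<bar> \<le> B * measure M UNIV ^ k"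
proof (induction k arbitrary: x)
  case (Suc k)
  from conv_op_bound[OF Suc.IH[OF Suc.prems], where x = x] show ?case by (simp add: mult_ac)
qed simp

lemma conv_op_pow_nonneg: "(\<And>x. 0 \<le> g x) \<Longrightarrow> 0 \<le> (conv_op M ^^ k) g x"
  by (induction k arbitrary: x) (auto intro!: conv_op_nonneg)

lemma conv_op_pow_lincomb:
  assumes "Cb r f" "Cb r g"
  shows "(conv_op M ^^ k) (\<lambda>x. a * f x + b * g x) = (\<lambda>x. a * (conv_op M ^^ k) f x + b * (conv_op M ^^ k) g x)"
  by (induction k) (simp_all add: conv_op_lincomb[OF Cb_conv_op_pow[OF assms(1)] Cb_conv_op_pow[OF assms(2)]])

lemma conv_op_pow_tendsto:
  assumes f: "\<And>j. Cb 0 (f j)" and g: "Cb 0 g" and b: "\<And>j x. \<bar>f j x\<bar> \<le> B" and l: "\<And>x. (\<lambda>j. f j x) \<longlonglongrightarrow> g x"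
  shows "(\<lambda>j. (conv_op M ^^ k) (f j) x) \<longlonglongrightarrow> (conv_op M ^^ k) g x"
proof (induction k arbitrary: x)
  case (Suc k)
  have "(\<lambda>j. conv_op M ((conv_op M ^^ k) (f j)) x) \<longlonglongrightarrow> conv_op M ((conv_op M ^^ k) g) x"
    by (rule conv_op_tendsto[OF _ _ conv_op_pow_bound[OF b] Suc])
      (auto intro!: Cb_measurable[OF Cb_conv_op_pow] f g)
  then show ?case by simp
qed (use l in simp)

end

text \<open>Convolution with \<open>\<pi>\<close> composed with exp (\<tau> I), where I is
  convolution with \<open>\<kappa>\<close>. Negative \<tau> takes jumps out of a law, at the price
  of an alternating series.\<close>

definition exp_conv :: "real measure \<Rightarrow> real measure \<Rightarrow> real \<Rightarrow> (real \<Rightarrow> real) \<Rightarrow> real \<Rightarrow> real" where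
  "exp_conv \<pi> \<kappa> \<tau> g x = (\<Sum>k. \<tau> ^ k / fact k * conv_op \<pi> ((conv_op \<kappa> ^^ k) g) x)"

lemma summable_exp_real: "summable (\<lambda>k. C * (a ^ k / fact k) :: real)"
  using summable_exp_generic[of a] by (intro summable_mult) (simp add: divide_inverse mult.commute)

lemma
  assumes p: "finite_borel_measure \<pi>" and k: "finite_borel_measure \<kappa>"
  shows exp_conv_term_bound: "(\<And>x. \<bar>g x\<bar> \<le> B) \<Longrightarrow> \<bar>\<tau> ^ k / fact k * conv_op \<pi> ((conv_op \<kappa> ^^ k) g) x\<bar>
      \<le> B * measure \<pi> UNIV * ((\<bar>\<tau>\<bar> * measure \<kappa> UNIV) ^ k / fact k)"
    and exp_conv_summable: "Cb 0 g \<Longrightarrow> summable (\<lambda>k. \<tau> ^ k / fact k * conv_op \<pi> ((conv_op \<kappa> ^^ k) g) x)"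
    and exp_conv_lincomb: "Cb 0 f \<Longrightarrow> Cb 0 g \<Longrightarrow> exp_conv \<pi> \<kappa> \<tau> (\<lambda>x. a * f x + b * g x) x = a * exp_conv \<pi> \<kappa> \<tau> f x + b * exp_conv \<pi> \<kappa> \<tau> g x"
    and exp_conv_cexp: "exp_conv \<pi> \<kappa> \<tau> (cexp K u) x = cexp (K * (char \<pi> u * exp (\<tau> * char \<kappa> u))) u x"
    and exp_conv_tendsto: "(\<And>j. Cb 0 (h j)) \<Longrightarrow> Cb 0 g \<Longrightarrow> (\<And>j x. \<bar>h j x\<bar> \<le> B) \<Longrightarrow> (\<And>x. (\<lambda>j. h j x) \<longlonglongrightarrow> g x) \<Longrightarrow>
       (\<lambda>j. exp_conv \<pi> \<kappa> \<tau> (h j) x) \<longlonglongrightarrow> exp_conv \<pi> \<kappa> \<tau> g x"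
    and exp_conv_nonneg: "0 \<le> \<tau> \<Longrightarrow> (\<And>x. 0 \<le> g x) \<Longrightarrow> Cb 0 g \<Longrightarrow> 0 \<le> exp_conv \<pi> \<kappa> \<tau> g x"
proof -
  interpret P: finite_borel_measure \<pi> by fact
  interpret K: finite_borel_measure \<kappa> by fact
  show bd: "\<bar>\<tau> ^ k / fact k * conv_op \<pi> ((conv_op \<kappa> ^^ k) g) x\<bar>
      \<le> B * measure \<pi> UNIV * ((\<bar>\<tau>\<bar> * measure \<kappa> UNIV) ^ k / fact k)" if "\<And>x. \<bar>g x\<bar> \<le> B" for g B k x
  proof -
    have "\<bar>conv_op \<pi> ((conv_op \<kappa> ^^ k) g) x\<bar> \<le> B * measure \<kappa> UNIV ^ k * measure \<pi> UNIV"
      by (rule P.conv_op_bound[OF K.conv_op_pow_bound[OF that]])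
    then have "\<bar>\<tau>\<bar> ^ k / fact k * \<bar>conv_op \<pi> ((conv_op \<kappa> ^^ k) g) x\<bar> \<le> \<bar>\<tau>\<bar> ^ k / fact k * (B * measure \<kappa> UNIV ^ k * measure \<pi> UNIV)"
      by (intro mult_left_mono) auto
    then show ?thesis by (simp add: abs_mult power_abs power_mult_distrib mult_ac)
  qed
  show sm: "summable (\<lambda>k. \<tau> ^ k / fact k * conv_op \<pi> ((conv_op \<kappa> ^^ k) g) x)" if g: "Cb 0 g" for g x
  proof -
    obtain B where "\<And>x. \<bar>g x\<bar> \<le> B" using Cb_bound[OF g] by auto
    from bd[OF this] show ?thesis
      by (intro summable_comparison_test'[OF summable_exp_real]) auto
  qed
  show "exp_conv \<pi> \<kappa> \<tau> (\<lambda>x. a * f x + b * g x) x = a * exp_conv \<pi> \<kappa> \<tau> f x + b * exp_conv \<pi> \<kappa> \<tau> g x"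
    if f: "Cb 0 f" and g: "Cb 0 g" for f g
  proof -
    have "conv_op \<pi> ((conv_op \<kappa> ^^ k) (\<lambda>x. a * f x + b * g x)) x
       = a * conv_op \<pi> ((conv_op \<kappa> ^^ k) f) x + b * conv_op \<pi> ((conv_op \<kappa> ^^ k) g) x" for k
      unfolding K.conv_op_pow_lincomb[OF f g] P.conv_op_lincomb[OF K.Cb_conv_op_pow[OF f] K.Cb_conv_op_pow[OF g]] ..
    then have "exp_conv \<pi> \<kappa> \<tau> (\<lambda>x. a * f x + b * g x) x
       = (\<Sum>k. a * (\<tau> ^ k / fact k * conv_op \<pi> ((conv_op \<kappa> ^^ k) f) x) + b * (\<tau> ^ k / fact k * conv_op \<pi> ((conv_op \<kappa> ^^ k) g) x))"
      unfolding exp_conv_def by (simp only:) (simp only: ring_distribs mult_ac)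
    also have "\<dots> = a * exp_conv \<pi> \<kappa> \<tau> f x + b * exp_conv \<pi> \<kappa> \<tau> g x"
      unfolding exp_conv_def using sm[OF f] sm[OF g]
      by (subst suminf_add[symmetric]) (auto intro!: summable_mult simp only: suminf_mult)
    finally show ?thesis .
  qed
  show "exp_conv \<pi> \<kappa> \<tau> (cexp K u) x = cexp (K * (char \<pi> u * exp (\<tau> * char \<kappa> u))) u x"
  proof -
    define z where "z = K * char \<pi> u * iexp (u * x)"
    have t: "\<tau> ^ k / fact k * conv_op \<pi> ((conv_op \<kappa> ^^ k) (cexp K u)) x = Re (z * ((\<tau> * char \<kappa> u) ^ k /\<^sub>R fact k))" for k
    proof -
      have "z * ((\<tau> * char \<kappa> u) ^ k /\<^sub>R fact k) = (\<tau> ^ k / fact k) *\<^sub>R (K * char \<kappa> u ^ k * char \<pi> u * iexp (u * x))"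
        by (simp add: z_def scaleR_conv_of_real power_mult_distrib divide_inverse mult_ac)
      then show ?thesis by (simp add: K.conv_op_pow_cexp P.conv_op_cexp cexp_def)
    qed
    have "(\<lambda>k. z * ((\<tau> * char \<kappa> u) ^ k /\<^sub>R fact k)) sums (z * exp (\<tau> * char \<kappa> u))"
      by (intro sums_mult exp_converges)
    then have "(\<lambda>k. Re (z * ((\<tau> * char \<kappa> u) ^ k /\<^sub>R fact k))) sums Re (z * exp (\<tau> * char \<kappa> u))"
      by (rule sums_Re)
    then show ?thesis unfolding exp_conv_def t by (simp add: sums_iff cexp_def z_def mult_ac)
  qed
  show "(\<lambda>j. exp_conv \<pi> \<kappa> \<tau> (h j) x) \<longlonglongrightarrow> exp_conv \<pi> \<kappa> \<tau> g x"
    if h: "\<And>j. Cb 0 (h j)" and g: "Cb 0 g" and b: "\<And>j x. \<bar>h j x\<bar> \<le> B" and l: "\<And>x. (\<lambda>j. h j x) \<longlonglongrightarrow> g x"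
  proof -
    have "(\<lambda>j. conv_op \<pi> ((conv_op \<kappa> ^^ k) (h j)) x) \<longlonglongrightarrow> conv_op \<pi> ((conv_op \<kappa> ^^ k) g) x" for k
      by (rule P.conv_op_tendsto[OF _ _ K.conv_op_pow_bound[OF b] K.conv_op_pow_tendsto[OF h g b l]])
        (auto intro!: Cb_measurable[OF K.Cb_conv_op_pow] h g)
    then have "(\<lambda>j. \<tau> ^ k / fact k * conv_op \<pi> ((conv_op \<kappa> ^^ k) (h j)) x) \<longlonglongrightarrow> \<tau> ^ k / fact k * conv_op \<pi> ((conv_op \<kappa> ^^ k) g) x" for k
      by (intro tendsto_intros)
    moreover have "\<forall>\<^sub>F (k, j) in sequentially \<times>\<^sub>F sequentially. norm (\<tau> ^ k / fact k * conv_op \<pi> ((conv_op \<kappa> ^^ k) (h j)) x)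
        \<le> B * measure \<pi> UNIV * ((\<bar>\<tau>\<bar> * measure \<kappa> UNIV) ^ k / fact k)"
      by (intro always_eventually allI) (simp only: split_paired_all prod.case real_norm_def bd[OF b])
    \<comment> \<open>Limit and series are exchanged with an exponential majorant that does not
      depend on j.\<close>
    ultimately show ?thesis unfolding exp_conv_def
      using tannerys_theorem[OF _ _ summable_exp_real] by fastforce
  qed
  show "0 \<le> exp_conv \<pi> \<kappa> \<tau> g x" if "0 \<le> \<tau>" "\<And>x. 0 \<le> g x" "Cb 0 g"
    unfolding exp_conv_def using that
    by (intro suminf_nonneg sm mult_nonneg_nonneg P.conv_op_nonneg K.conv_op_pow_nonneg) auto
qed

lemma Cb_2_imp_0: "Cb 2 g \<Longrightarrow> Cb 0 g"
  by (rule Cb_2D)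

text \<open>With complex amplitudes as generators, the base case of an operator identity becomes an
  identity between two complex factors.\<close>

lemma trig_induct_char [consumes 1, case_names char lincomb]:
  assumes "f \<in> trig" "\<And>K u. P (cexp K u)"
    "\<And>f g a b. f \<in> trig \<Longrightarrow> g \<in> trig \<Longrightarrow> P f \<Longrightarrow> P g \<Longrightarrow> P (\<lambda>x. a * f x + b * g x)"
  shows "P f"
  using assms(1) by (induction rule: trig.induct) (auto simp: cexp_cos intro: assms)

section \<open>Dynkin's formula and the removal of large jumps\<close>

lemma real_distribution_finite: "real_distribution \<pi> \<Longrightarrow> finite_borel_measure \<pi>"
  using real_distribution.finite_borel_measure_M .

lemma measure_real_distribution: "real_distribution \<pi> \<Longrightarrow> measure \<pi> UNIV = 1"
  by (metis prob_space.prob_space real_distribution.axioms(1) real_distribution.space_eq_univ)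

locale levy_process_truncation = levy_truncation \<sigma> b \<nu> \<epsilon> c + prob_space M
  for M :: "'w measure" and \<sigma> b \<nu> \<epsilon> c +
  fixes X :: "real \<Rightarrow> 'w \<Rightarrow> real"
  assumes X: "levy_triplet M X \<sigma> b \<nu>"
begin

abbreviation "law t \<equiv> distr M borel (X t)"
abbreviation "\<Psi> \<equiv> levy_exponent \<sigma> b \<nu>"

lemma X_measurable: "0 \<le> t \<Longrightarrow> X t \<in> borel_measurable M"
  using X unfolding levy_triplet_def levy_process_def by simp

lemma law_real: "0 \<le> t \<Longrightarrow> real_distribution (law t)"
  using X_measurable by (intro real_distribution_distr)

lemma law_finite: "0 \<le> t \<Longrightarrow> finite_borel_measure (law t)"
  by (intro real_distribution_finite law_real)

lemma conv_op_law: "0 \<le> t \<Longrightarrow> g \<in> borel_measurable borel \<Longrightarrow> conv_op (law t) g x = expectation (\<lambda>w. g (x + X t w))"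
  unfolding conv_op_def using X_measurable[of t] by (subst integral_distr) auto

lemma law_0: "Cb r g \<Longrightarrow> conv_op (law 0) g x = g x"
proof -
  assume g: "Cb r g"
  have [measurable]: "g \<in> borel_measurable borel" "X 0 \<in> borel_measurable M"
    using Cb_measurable[OF g] X_measurable by auto
  have "AE w in M. X 0 w = 0" using X unfolding levy_triplet_def levy_process_def by simp
  then have "expectation (\<lambda>w. g (x + X 0 w)) = expectation (\<lambda>w. g x)"
    by (intro integral_cong_AE) auto
  then show ?thesis by (simp add: conv_op_law prob_space)
qed

text \<open>\<open>char_levy_remove_jumps\<close> with nothing removed; it concerns positive times,
  so time 0 is treated by \<open>X 0\<close> being almost surely 0.\<close>

lemma char_law:
  assumes "0 \<le> t"
  shows "char (law t) u = exp (t * \<Psi> u)"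
proof (cases "t = 0")
  case True
  have [measurable]: "X 0 \<in> borel_measurable M" using X_measurable by auto
  have "AE w in M. X 0 w = 0" using X unfolding levy_triplet_def levy_process_def by simp
  then have "(CLINT w|M. iexp (u * X 0 w)) = (CLINT w|M. 1)"
    by (intro integral_cong_AE) auto
  then show ?thesis using True by (simp add: char_def integral_distr prob_space)
next
  case False
  then have t: "0 < t" using assms by simp
  have [measurable]: "X t \<in> borel_measurable M" using X_measurable assms by auto
  obtain Z where [measurable]: "Z \<in> borel_measurable M" and Z: "{} = {} \<Longrightarrow> AE w in M. Z w = 0" and
    c: "\<And>u. char (distr M borel (\<lambda>w. X t w - Z w)) u = exp (t * (\<Psi> u - (CLINT z:{}|\<nu>. iexp (u * z) - 1)))"
    by (rule char_levy_remove_jumps[OF X, of "{}" 1 t]) (use t in auto)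
  have "AE w in M. Z w = 0" using Z by simp
  then have "AE w in M. X t w - Z w = X t w" by eventually_elim simp
  then have "distr M borel (\<lambda>w. X t w - Z w) = law t"
    by (intro distr_cong_AE) auto
  then show ?thesis using c[of u] by (simp add: set_lebesgue_integral_def)
qed

text \<open>Characters are eigenfunctions: each term of the generator multiplies the amplitude by
  the matching term of the exponent.\<close>

lemma generator_cexp: "L (cexp K u) = cexp (K * \<Psi> u) u"
proof
  fix x
  define z where "z = K * iexp (u * x)"
  have i: "integrable \<nu> (\<lambda>v. iexp (u * v) - 1 - \<i> * (u * v * indicator {-1..1} v))"
    by (rule levy_exponent_integrable[OF lev])
  have "cexp K u (v + x) - cexp K u x - v * deriv (cexp K u) x * indicator {-1..1} v
     = Re (z * (iexp (u * v) - 1 - \<i> * (u * v * indicator {-1..1} v)))" for v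
  proof -
    have "cexp K u (v + x) = Re (z * iexp (u * v))"
      by (simp add: cexp_def z_def exp_add[symmetric] algebra_simps)
    moreover have "v * deriv (cexp K u) x * indicator {-1..1} v = Re (z * (\<i> * (u * v * indicator {-1..1} v)))"
    proof -
      have "z * (\<i> * (u * v * indicator {-1..1} v)) = (v * indicator {-1..1} v) *\<^sub>R (K * (\<i> * u) * iexp (u * x))"
        by (simp add: z_def scaleR_conv_of_real mult_ac)
      then show ?thesis by (simp add: cexp_deriv cexp_def)
    qed
    ultimately show ?thesis by (simp add: cexp_def z_def ring_distribs)
  qed
  then have "(\<integral>v. cexp K u (v + x) - cexp K u x - v * deriv (cexp K u) x * indicator {-1..1} v \<partial>\<nu>)
     = (\<integral>v. Re (z * (iexp (u * v) - 1 - \<i> * (u * v * indicator {-1..1} v))) \<partial>\<nu>)"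
    by (simp only:)
  also have "\<dots> = Re (CLINT v|\<nu>. z * (iexp (u * v) - 1 - \<i> * (u * v * indicator {-1..1} v)))"
    by (intro integral_Re integrable_mult_right i)
  also have "\<dots> = Re (z * (CLINT v|\<nu>. iexp (u * v) - 1 - \<i> * (u * v * indicator {-1..1} v)))"
    by (simp only: integral_mult_right_zero)
  finally have "(\<integral>v. cexp K u (v + x) - cexp K u x - v * deriv (cexp K u) x * indicator {-1..1} v \<partial>\<nu>)
     = Re (z * (CLINT v|\<nu>. iexp (u * v) - 1 - \<i> * (u * v * indicator {-1..1} v)))" .
  moreover have "b * deriv (cexp K u) x = Re (z * (\<i> * (u * b)))"
  proof -
    have "z * (\<i> * (u * b)) = b *\<^sub>R (K * (\<i> * u) * iexp (u * x))"
      by (simp add: z_def scaleR_conv_of_real mult_ac)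
    then show ?thesis by (simp add: cexp_deriv cexp_def)
  qed
  moreover have "\<sigma>\<^sup>2 / 2 * deriv (deriv (cexp K u)) x = Re (z * (- (\<sigma>\<^sup>2 * u\<^sup>2 / 2 :: real)))"
  proof -
    have "z * (- (\<sigma>\<^sup>2 * u\<^sup>2 / 2 :: real)) = (\<sigma>\<^sup>2 / 2) *\<^sub>R (K * (\<i> * u) * (\<i> * u) * iexp (u * x))"
      by (simp add: z_def scaleR_conv_of_real power2_eq_square mult_ac)
    then show ?thesis by (simp add: cexp_deriv cexp_def)
  qed
  ultimately have "L (cexp K u) x = Re (z * (- (\<sigma>\<^sup>2 * u\<^sup>2 / 2 :: real))) + Re (z * (\<i> * (u * b)))
     + Re (z * (CLINT v|\<nu>. iexp (u * v) - 1 - \<i> * (u * v * indicator {-1..1} v)))"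
    unfolding levy_generator_def by presburger
  also have "\<dots> = Re (z * \<Psi> u)"
    unfolding levy_exponent_def by (simp add: ring_distribs)
  finally show "L (cexp K u) x = cexp (K * \<Psi> u) u x" by (simp add: cexp_def z_def mult_ac)
qed

lemma generator_Cb0: "Cb 2 g \<Longrightarrow> Cb 0 (L g)"
  using second_order_Cb[OF second_order_generator, of 0 g] by (simp add: numeral_2_eq_2 del: Cb.simps)

text \<open>Stated in integrated form, which survives bounded pointwise limits. For a character it
  is the fundamental theorem applied to exp (r \<Psi> u) as a function of r.\<close>

theorem dynkin:
  assumes "Cb 2 g"
  shows "0 \<le> t \<Longrightarrow> ((\<lambda>r. conv_op (law r) (L g) x) has_integral (conv_op (law t) g x - g x)) {0..t}"
proof -
  define P where "P g \<longleftrightarrow> Cb 2 g \<and> (\<forall>t x. 0 \<le> t \<longrightarrow>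
     ((\<lambda>r. conv_op (law r) (L g) x) has_integral (conv_op (law t) g x - g x)) {0..t})" for g
  have "P g"
  proof (rule trig_bp_dense[OF _ _ assms])
    fix f assume "f \<in> trig"
    then show "P f"
    proof (induction rule: trig_induct_char)
      case (char K u)
      have "((\<lambda>r. conv_op (law r) (L (cexp K u)) x) has_integral (conv_op (law t) (cexp K u) x - cexp K u x)) {0..t}"
        if t: "0 \<le> t" for t x
      proof -
        define z where "z = K * iexp (u * x)"
        have cv: "conv_op (law r) (cexp K' u) x = Re (K' * iexp (u * x) * exp (r * \<Psi> u))" if "0 \<le> r" for r K'
        proof -
          have "K' * exp (r * \<Psi> u) * iexp (u * x) = K' * iexp (u * x) * exp (r * \<Psi> u)" by (simp only: mult_ac)
          then show ?thesis
            by (simp only: finite_borel_measure.conv_op_cexp[OF law_finite[OF that]] char_law[OF that] cexp_def)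
        qed
        have "((\<lambda>r. z * exp (r * \<Psi> u)) has_vector_derivative z * \<Psi> u * exp (r * \<Psi> u)) (at r within {0..t})" for r
          by (auto intro!: derivative_eq_intros has_vector_derivative_real_field simp: algebra_simps)
        from bounded_linear.has_vector_derivative[OF bounded_linear_Re this]
        have int: "((\<lambda>r. Re (z * \<Psi> u * exp (r * \<Psi> u))) has_integral (Re (z * exp (t * \<Psi> u)) - Re (z * exp (0 * \<Psi> u)))) {0..t}"
          using fundamental_theorem_of_calculus[OF t, of "\<lambda>r. Re (z * exp (r * \<Psi> u))" "\<lambda>r. Re (z * \<Psi> u * exp (r * \<Psi> u))"]
          by simp
        have e1: "conv_op (law r) (L (cexp K u)) x = Re (z * \<Psi> u * exp (r * \<Psi> u))" if "r \<in> {0..t}" for r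
        proof -
          have "K * \<Psi> u * iexp (u * x) * exp (r * \<Psi> u) = z * \<Psi> u * exp (r * \<Psi> u)"
            by (simp only: z_def mult_ac)
          then show ?thesis using that cv[of r "K * \<Psi> u"] by (simp only: generator_cexp atLeastAtMost_iff)
        qed
        have e2: "conv_op (law t) (cexp K u) x - cexp K u x = Re (z * exp (t * \<Psi> u)) - Re (z * exp (0 * \<Psi> u))"
          unfolding cv[OF t] cexp_def z_def by simp
        show ?thesis unfolding e2 by (rule has_integral_eq[OF e1[symmetric] int])
      qed
      then show ?case unfolding P_def using cexp_Cb by blast
    next
      case (lincomb f g a b)
      then have C: "Cb 2 f" "Cb 2 g" by (auto simp: P_def)
      note LC = generator_Cb0
      have "((\<lambda>r. conv_op (law r) (L (\<lambda>x. a * f x + b * g x)) x) has_integral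
         (conv_op (law t) (\<lambda>x. a * f x + b * g x) x - (a * f x + b * g x))) {0..t}"
        if t: "0 \<le> t" for t x
      proof -
        have int: "((\<lambda>r. a * conv_op (law r) (L f) x + b * conv_op (law r) (L g) x) has_integral
           (a * (conv_op (law t) f x - f x) + b * (conv_op (law t) g x - g x))) {0..t}"
          using lincomb t by (intro has_integral_add has_integral_mult_right) (auto simp: P_def)
        have e1: "conv_op (law r) (L (\<lambda>x. a * f x + b * g x)) x = a * conv_op (law r) (L f) x + b * conv_op (law r) (L g) x"
          if "r \<in> {0..t}" for r
          unfolding second_order_lincomb[OF second_order_generator C]
          using that finite_borel_measure.conv_op_lincomb[OF law_finite LC[OF C(1)] LC[OF C(2)]] by simp
        have e2: "conv_op (law t) (\<lambda>x. a * f x + b * g x) x - (a * f x + b * g x)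
           = a * (conv_op (law t) f x - f x) + b * (conv_op (law t) g x - g x)"
          using finite_borel_measure.conv_op_lincomb[OF law_finite[OF t] C] by (simp add: algebra_simps)
        show ?thesis unfolding e2 by (rule has_integral_eq[OF e1[symmetric] int])
      qed
      then show ?case unfolding P_def using Cb_lincomb[OF C] by blast
    qed
  next
    fix f g assume Pf: "\<And>k. P (f k)" and bp: "bp_conv2 f g"
    have C: "\<And>k. Cb 2 (f k)" "Cb 2 g" using bp by (auto simp: bp_conv2_def)
    obtain B where B: "\<And>k x. \<bar>f k x\<bar> \<le> B" using bp unfolding bp_conv2_def by blast
    have lf: "(\<lambda>k. f k x) \<longlonglongrightarrow> g x" for x using bp by (auto simp: bp_conv2_def)
    note LC = generator_Cb0
    obtain B' where B': "\<And>k x. \<bar>L (f k) x\<bar> \<le> B'" using second_order_bp(2)[OF second_order_generator bp] by blast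
    have lc: "(\<lambda>k. conv_op (law r) (L (f k)) x) \<longlonglongrightarrow> conv_op (law r) (L g) x" if "0 \<le> r" for r x
      by (rule finite_borel_measure.conv_op_tendsto[OF law_finite[OF that] _ _ B' second_order_bp(1)[OF second_order_generator bp]])
        (auto intro: Cb_measurable[OF LC] C)
    have lg: "(\<lambda>k. conv_op (law r) (f k) x) \<longlonglongrightarrow> conv_op (law r) g x" if "0 \<le> r" for r x
      by (rule finite_borel_measure.conv_op_tendsto[OF law_finite[OF that] _ _ B lf])
        (auto intro: Cb_measurable C)
    have bd: "\<bar>conv_op (law r) (L (f k)) x\<bar> \<le> B'" if "0 \<le> r" for r k x
      using finite_borel_measure.conv_op_bound[OF law_finite[OF that] B', where x = x]
        measure_real_distribution[OF law_real[OF that]] by simp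
    have "((\<lambda>r. conv_op (law r) (L g) x) has_integral (conv_op (law t) g x - g x)) {0..t}" if t: "0 \<le> t" for t x
    proof (rule has_integral_dominated_convergence)
      show "((\<lambda>r. conv_op (law r) (L (f k)) x) has_integral (conv_op (law t) (f k) x - f k x)) {0..t}" for k
        using Pf t unfolding P_def by blast
      show "(\<lambda>r. B') integrable_on {0..t}" by (rule integrable_const_ivl)
      show "(\<lambda>k. conv_op (law t) (f k) x - f k x) \<longlonglongrightarrow> conv_op (law t) g x - g x"
        by (intro tendsto_intros lg lf t)
    qed (use bd lc in auto)
    then show "P g" using C unfolding P_def by blast
  qed
  then show "0 \<le> t \<Longrightarrow> ((\<lambda>r. conv_op (law r) (L g) x) has_integral (conv_op (law t) g x - g x)) {0..t}"
    unfolding P_def by blast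
qed

text \<open>After removing the large jumps from the law, a positive operator remains: the jumps larger
  than \<open>\<epsilon> / 2\<close> are removed pathwise, and the part \<open>c \<nu>\<close> of them that belongs to the small jumps
  is put back by the exponential of a positive operator.\<close>

theorem exp_conv_law_nonneg:
  assumes t: "0 < t" and g: "Cb 2 g" "\<And>x. 0 \<le> g x"
  shows "0 \<le> exp_conv (law t) \<kappa>I (- t) g x"
proof -
  define D where "D = {z::real. \<epsilon> / 2 < \<bar>z\<bar>}"
  have D: "D \<in> sets borel" "0 < \<epsilon> / 2" "D \<subseteq> {z. \<epsilon> / 2 < \<bar>z\<bar>}" using eps by (auto simp: D_def)
  note [measurable] = D(1)
  have Dfin: "emeasure \<nu> D < \<infinity>" by (rule levy_measure_facts(2)[OF lev D])
  \<comment> \<open>On D the measure \<nu> is the sum of \<open>\<kappa>I\<close> and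
    \<open>\<kappa>K\<close>, both finite; outside D, \<open>\<kappa>I\<close> vanishes because c =
    1 there.\<close>
  define \<kappa>K where "\<kappa>K = density \<nu> (\<lambda>x. ennreal (indicator D x * c x))"
  have nn: "0 \<le> indicator D x * c x" "indicator D x * c x \<le> indicator D x" for x
    using c_facts(2,3)[of x] by (auto simp: indicator_def)
  have K: "finite_borel_measure \<kappa>K"
  proof (rule finite_borel_measure.intro, rule finite_measureI)
    have "emeasure \<kappa>K (space \<kappa>K) = (\<integral>\<^sup>+x. ennreal (indicator D x * c x) \<partial>\<nu>)"
      unfolding \<kappa>K_def by (simp add: emeasure_density)
    also have "\<dots> \<le> (\<integral>\<^sup>+x. indicator D x \<partial>\<nu>)"
      using c_facts(3) by (intro nn_integral_mono) (auto simp: indicator_def)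
    also have "\<dots> < \<infinity>" using Dfin by simp
    finally show "emeasure \<kappa>K (space \<kappa>K) \<noteq> \<infinity>" by simp
  qed (simp add: \<kappa>K_def finite_borel_measure_axioms_def)
  obtain Z where [measurable]: "Z \<in> borel_measurable M" and
    cZ: "\<And>u. char (distr M borel (\<lambda>w. X t w - Z w)) u = exp (t * (\<Psi> u - (CLINT z:D|\<nu>. iexp (u * z) - 1)))"
    by (rule char_levy_remove_jumps[OF X D t]) blast
  have [measurable]: "X t \<in> borel_measurable M" using X_measurable t by auto
  define \<pi> where "\<pi> = distr M borel (\<lambda>w. X t w - Z w)"
  have pi: "finite_borel_measure \<pi>"
    unfolding \<pi>_def by (intro real_distribution_finite real_distribution_distr) measurable
  have lt: "finite_borel_measure (law t)" using t by (intro law_finite) simp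
  have charD: "(CLINT z:D|\<nu>. iexp (u * z) - 1) = char \<kappa>I u + char \<kappa>K u - measure \<nu> D" for u
  proof -
    have "char \<kappa>I u = (CLINT z|\<nu>. (1 - c z) *\<^sub>R iexp (u * z))"
      unfolding char_def large_jump_kernel_def using one_minus_c_le(2) by (subst integral_density) auto
    moreover have "char \<kappa>K u = (CLINT z|\<nu>. (indicator D z * c z) *\<^sub>R iexp (u * z))"
      unfolding char_def \<kappa>K_def using nn(1) by (subst integral_density) auto
    moreover have i1: "integrable \<nu> (\<lambda>z. (1 - c z) *\<^sub>R iexp (u * z))"
    proof (rule Bochner_Integration.integrable_bound)
      show "integrable \<nu> (\<lambda>z. 1 * (1 - c z))" by (intro integrable_one_minus_c[where B = 1]) auto
    qed (use one_minus_c_le(2) in auto)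
    moreover have i2: "integrable \<nu> (\<lambda>z. (indicator D z * c z) *\<^sub>R iexp (u * z))"
    proof (rule Bochner_Integration.integrable_bound)
      show "integrable \<nu> (indicator D :: real \<Rightarrow> real)" using Dfin by simp
    qed (use nn in auto)
    moreover have i3: "integrable \<nu> (\<lambda>z. indicator D z *\<^sub>R (1::complex))"
      using Dfin by simp
    moreover have "indicator D z *\<^sub>R (iexp (u * z) - 1) = (1 - c z) *\<^sub>R iexp (u * z) + (indicator D z * c z) *\<^sub>R iexp (u * z) - indicator D z *\<^sub>R (1::complex)" for z
      using c_facts(4)[of z] by (cases "z \<in> D") (auto simp: D_def algebra_simps)
    ultimately show ?thesis
      unfolding set_lebesgue_integral_def using Dfin by (simp add: scaleR_conv_of_real)
  qed
  \<comment> \<open>The alternating series becomes a positive scalar times a series whose terms are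
    nonnegative for nonnegative g. On characters both sides have the same exponent by
    \<open>charD\<close>.\<close>
  define P where "P g \<longleftrightarrow> Cb 2 g \<and> (\<forall>x. exp_conv (law t) \<kappa>I (- t) g x = exp (- t * measure \<nu> D) * exp_conv \<pi> \<kappa>K t g x)" for g
  have "P g"
  proof (rule trig_bp_dense[OF _ _ g(1)])
    fix f assume "f \<in> trig"
    then show "P f"
    proof (induction rule: trig_induct_char)
      case (char K u)
      have Re_mult: "Re (of_real e * z * w) = e * Re (z * w)" for e z w
        by (simp add: algebra_simps)
      have "exp_conv (law t) \<kappa>I (- t) (cexp K u) x = exp (- t * measure \<nu> D) * exp_conv \<pi> \<kappa>K t (cexp K u) x" for x
      proof -
        have "char (law t) u * exp (of_real (- t) * char \<kappa>I u) = of_real (exp (- t * measure \<nu> D)) * (char \<pi> u * exp (t * char \<kappa>K u))"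
          unfolding \<pi>_def cZ charD char_law[OF less_imp_le[OF t]] exp_of_real[symmetric] exp_add[symmetric]
          by (rule arg_cong[where f = exp]) (simp add: algebra_simps)
        then have "exp_conv (law t) \<kappa>I (- t) (cexp K u) x = cexp (of_real (exp (- t * measure \<nu> D)) * (K * (char \<pi> u * exp (t * char \<kappa>K u)))) u x"
          unfolding exp_conv_cexp[OF lt finite_large] by (simp add: mult_ac)
        also have "\<dots> = exp (- t * measure \<nu> D) * exp_conv \<pi> \<kappa>K t (cexp K u) x"
          unfolding exp_conv_cexp[OF pi K] cexp_def by (rule Re_mult)
        finally show ?thesis .
      qed
      then show ?case unfolding P_def using cexp_Cb by blast
    next
      case (lincomb f g a b)
      then have C: "Cb 2 f" "Cb 2 g" by (auto simp: P_def)
      show ?case unfolding P_def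
        using lincomb Cb_lincomb[OF C]
        by (simp add: P_def exp_conv_lincomb[OF lt finite_large Cb_2_imp_0[OF C(1)] Cb_2_imp_0[OF C(2)]]
          exp_conv_lincomb[OF pi K Cb_2_imp_0[OF C(1)] Cb_2_imp_0[OF C(2)]] algebra_simps)
    qed
  next
    fix f g assume Pf: "\<And>k. P (f k)" and bp: "bp_conv2 f g"
    have C: "\<And>k. Cb 0 (f k)" "Cb 0 g" "Cb 2 g" using bp Cb_2_imp_0 by (auto simp: bp_conv2_def simp del: Cb.simps)
    obtain B where B: "\<And>k x. \<bar>f k x\<bar> \<le> B" using bp unfolding bp_conv2_def by blast
    have lf: "(\<lambda>k. f k x) \<longlonglongrightarrow> g x" for x using bp by (auto simp: bp_conv2_def)
    have "exp_conv (law t) \<kappa>I (- t) g x = exp (- t * measure \<nu> D) * exp_conv \<pi> \<kappa>K t g x" for x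
    proof (rule LIMSEQ_unique)
      show "(\<lambda>k. exp_conv (law t) \<kappa>I (- t) (f k) x) \<longlonglongrightarrow> exp_conv (law t) \<kappa>I (- t) g x"
        by (rule exp_conv_tendsto[OF lt finite_large C(1,2) B lf])
      have "(\<lambda>k. exp_conv \<pi> \<kappa>K t (f k) x) \<longlonglongrightarrow> exp_conv \<pi> \<kappa>K t g x"
        by (rule exp_conv_tendsto[OF pi K C(1,2) B lf])
      then show "(\<lambda>k. exp_conv (law t) \<kappa>I (- t) (f k) x) \<longlonglongrightarrow> exp (- t * measure \<nu> D) * exp_conv \<pi> \<kappa>K t g x"
        using Pf by (auto simp: P_def intro!: tendsto_intros)
    qed
    then show "P g" using C unfolding P_def by blast
  qed
  then show ?thesis
    unfolding P_def using exp_conv_nonneg[OF pi K _ g(2) Cb_2_imp_0[OF g(1)]] t by simp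
qed

end

section \<open>Iterates of commuting operators\<close>

text \<open>The induction step of the binomial theorem, for an array in place of products of
  numbers, because operators are multiplied in \<open>operator_binomial\<close>.\<close>

lemma pascal_sum:
  fixes a :: "nat \<Rightarrow> nat \<Rightarrow> real"
  shows "(\<Sum>k\<le>p. real (p choose k) * a (Suc (p - k)) k) + (\<Sum>k\<le>p. real (p choose k) * a (p - k) (Suc k))
    = (\<Sum>k\<le>Suc p. real (Suc p choose k) * a (Suc p - k) k)"
proof -
  have "(\<Sum>k\<le>Suc p. real (Suc p choose k) * a (Suc p - k) k)
     = a (Suc p) 0 + (\<Sum>k\<le>p. real (Suc p choose Suc k) * a (p - k) (Suc k))"
    by (subst sum.atMost_Suc_shift) simp
  also have "(\<Sum>k\<le>p. real (Suc p choose Suc k) * a (p - k) (Suc k))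
     = (\<Sum>k\<le>p. real (p choose k) * a (p - k) (Suc k)) + (\<Sum>k\<le>p. real (p choose Suc k) * a (p - k) (Suc k))"
    by (simp add: ring_distribs sum.distrib)
  also have "(\<Sum>k\<le>p. real (p choose Suc k) * a (p - k) (Suc k)) = (\<Sum>k<p. real (p choose Suc k) * a (p - k) (Suc k))"
    by (simp add: lessThan_Suc_atMost[symmetric])
  also have "\<dots> = (\<Sum>k<p. real (p choose Suc k) * a (Suc (p - Suc k)) (Suc k))"
    by (intro sum.cong) (auto simp: Suc_diff_Suc)
  also have "a (Suc p) 0 + ((\<Sum>k\<le>p. real (p choose k) * a (p - k) (Suc k)) + (\<Sum>k<p. real (p choose Suc k) * a (Suc (p - Suc k)) (Suc k)))
     = (\<Sum>k\<le>p. real (p choose k) * a (Suc (p - k)) k) + (\<Sum>k\<le>p. real (p choose k) * a (p - k) (Suc k))"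
    by (cases p) (simp_all add: sum.atMost_Suc_shift lessThan_Suc_atMost del: sum.atMost_Suc binomial_Suc_Suc)
  finally show ?thesis by simp
qed

text \<open>Linearity is claimed only on an invariant subspace, as the operators are built from
  derivatives and integrals that are meaningless for general functions.\<close>

definition linear_on_space :: "(real \<Rightarrow> real) set \<Rightarrow> ((real \<Rightarrow> real) \<Rightarrow> real \<Rightarrow> real) \<Rightarrow> bool" where
  "linear_on_space V T \<longleftrightarrow> (\<forall>f\<in>V. T f \<in> V) \<and>
     (\<forall>f\<in>V. \<forall>g\<in>V. \<forall>a b. T (\<lambda>x. a * f x + b * g x) = (\<lambda>x. a * T f x + b * T g x))"

lemma linear_on_space_pow: "linear_on_space V T \<Longrightarrow> g \<in> V \<Longrightarrow> (T ^^ k) g \<in> V"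
  by (induction k) (auto simp: linear_on_space_def)

lemma linear_on_space_lincomb:
  "linear_on_space V T \<Longrightarrow> f \<in> V \<Longrightarrow> g \<in> V \<Longrightarrow> T (\<lambda>x. a * f x + b * g x) = (\<lambda>x. a * T f x + b * T g x)"
  by (simp add: linear_on_space_def)

lemma linear_on_space_sum:
  assumes T: "linear_on_space V T" and V: "\<And>f g a b. f \<in> V \<Longrightarrow> g \<in> V \<Longrightarrow> (\<lambda>x. a * f x + b * g x) \<in> V"
    and "V \<noteq> {}" "finite A" "\<And>i. i \<in> A \<Longrightarrow> f i \<in> V"
  shows "(\<lambda>x. \<Sum>i\<in>A. w i * f i x) \<in> V \<and> T (\<lambda>x. \<Sum>i\<in>A. w i * f i x) = (\<lambda>x. \<Sum>i\<in>A. w i * T (f i) x)"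
  using assms(4,5)
proof (induction A rule: finite_induct)
  case empty
  obtain h where h: "h \<in> V" using assms(3) by auto
  show ?case using V[OF h h, of 0 0] linear_on_space_lincomb[OF T h h, of 0 0] by simp
next
  case (insert i A)
  then have IH: "(\<lambda>x. \<Sum>i\<in>A. w i * f i x) \<in> V" "T (\<lambda>x. \<Sum>i\<in>A. w i * f i x) = (\<lambda>x. \<Sum>i\<in>A. w i * T (f i) x)"
    and fi: "f i \<in> V" by auto
  show ?case
    using insert.hyps V[OF fi IH(1), of "w i" 1] linear_on_space_lincomb[OF T fi IH(1), of "w i" 1] IH(2) by simp
qed

lemma operator_binomial:
  assumes A: "linear_on_space V A" and B: "linear_on_space V B"
    and V: "\<And>f g a b. f \<in> V \<Longrightarrow> g \<in> V \<Longrightarrow> (\<lambda>x. a * f x + b * g x) \<in> V"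
    and comm: "\<And>f. f \<in> V \<Longrightarrow> A (B f) = B (A f)"
    and T: "\<And>f. f \<in> V \<Longrightarrow> T f = (\<lambda>x. A f x + B f x)"
    and g: "g \<in> V"
  shows "(T ^^ p) g = (\<lambda>x. \<Sum>k\<le>p. real (p choose k) * (A ^^ (p - k)) ((B ^^ k) g) x)"
proof (induction p)
  case (Suc p)
  define f where "f k = (A ^^ (p - k)) ((B ^^ k) g)" for k
  have f: "f k \<in> V" for k unfolding f_def by (intro linear_on_space_pow[OF A] linear_on_space_pow[OF B] g)
  have comm': "B ((A ^^ j) h) = (A ^^ j) (B h)" if "h \<in> V" for j h
    using that by (induction j) (auto simp: comm[symmetric] linear_on_space_pow[OF A])
  have ne: "V \<noteq> {}" using g by auto
  have SA: "(\<lambda>x. \<Sum>k\<le>p. real (p choose k) * f k x) \<in> V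
      \<and> A (\<lambda>x. \<Sum>k\<le>p. real (p choose k) * f k x) = (\<lambda>x. \<Sum>k\<le>p. real (p choose k) * A (f k) x)"
    by (rule linear_on_space_sum[OF A V ne finite_atMost f])
  have SB: "(\<lambda>x. \<Sum>k\<le>p. real (p choose k) * f k x) \<in> V
      \<and> B (\<lambda>x. \<Sum>k\<le>p. real (p choose k) * f k x) = (\<lambda>x. \<Sum>k\<le>p. real (p choose k) * B (f k) x)"
    by (rule linear_on_space_sum[OF B V ne finite_atMost f])
  have "(T ^^ Suc p) g = T (\<lambda>x. \<Sum>k\<le>p. real (p choose k) * f k x)" by (simp add: Suc f_def)
  also have "\<dots> = (\<lambda>x. (\<Sum>k\<le>p. real (p choose k) * A (f k) x) + (\<Sum>k\<le>p. real (p choose k) * B (f k) x))"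
    unfolding T[OF conjunct1[OF SA]] conjunct2[OF SA] conjunct2[OF SB] ..
  also have "\<dots> = (\<lambda>x. (\<Sum>k\<le>p. real (p choose k) * (A ^^ Suc (p - k)) ((B ^^ k) g) x) + (\<Sum>k\<le>p. real (p choose k) * (A ^^ (p - k)) ((B ^^ Suc k) g) x))"
    by (simp add: f_def comm' linear_on_space_pow[OF B g])
  also have "\<dots> = (\<lambda>x. \<Sum>k\<le>Suc p. real (Suc p choose k) * (A ^^ (Suc p - k)) ((B ^^ k) g) x)"
    by (intro ext pascal_sum)
  finally show ?case .
qed simp

text \<open>A common invariant domain on which all operators can be iterated without counting
  derivatives.\<close>

definition Cinf :: "(real \<Rightarrow> real) set" where "Cinf = {g. \<forall>r. Cb r g}"

lemma CinfD: "g \<in> Cinf \<Longrightarrow> Cb r g"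
  by (simp add: Cinf_def)

lemma Cinf_lincomb: "f \<in> Cinf \<Longrightarrow> g \<in> Cinf \<Longrightarrow> (\<lambda>x. a * f x + b * g x) \<in> Cinf"
  by (auto simp: Cinf_def intro: Cb_lincomb)

lemma CinfI: "(\<And>r. Cb r g) \<Longrightarrow> g \<in> Cinf"
  by (simp add: Cinf_def)

lemma second_order_Cinf:
  assumes "second_order T"
  shows "linear_on_space Cinf T"
  unfolding linear_on_space_def
proof (intro conjI ballI allI)
  show "T f \<in> Cinf" if "f \<in> Cinf" for f
    by (rule CinfI[OF second_order_Cb[OF assms CinfD[OF that]]])
  show "T (\<lambda>x. a * f x + b * g x) = (\<lambda>x. a * T f x + b * T g x)" if "f \<in> Cinf" "g \<in> Cinf" for f g a b
    by (rule second_order_lincomb[OF assms CinfD[OF that(1)] CinfD[OF that(2)]])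
qed

lemma conv_op_Cinf:
  assumes "finite_borel_measure \<kappa>"
  shows "linear_on_space Cinf (conv_op \<kappa>)"
  unfolding linear_on_space_def
proof (intro conjI ballI allI)
  show "conv_op \<kappa> f \<in> Cinf" if "f \<in> Cinf" for f
    by (rule CinfI[OF finite_borel_measure.Cb_conv_op[OF assms CinfD[OF that]]])
  show "conv_op \<kappa> (\<lambda>x. a * f x + b * g x) = (\<lambda>x. a * conv_op \<kappa> f x + b * conv_op \<kappa> g x)" if "f \<in> Cinf" "g \<in> Cinf" for f g a b
    by (rule finite_borel_measure.conv_op_lincomb[OF assms CinfD[OF that(1), of 0] CinfD[OF that(2), of 0]])
qed

lemma linear_on_space_scale:
  assumes "linear_on_space Cinf T"
  shows "linear_on_space Cinf (\<lambda>f x. a * T f x)"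
  unfolding linear_on_space_def
proof (intro conjI ballI allI)
  show "(\<lambda>x. a * T f x) \<in> Cinf" if "f \<in> Cinf" for f
    using linear_on_space_pow[OF assms that, of 1] by - (rule CinfI, rule Cb_cmult, rule CinfD, simp)
  show "(\<lambda>x. a * T (\<lambda>x. c * f x + d * g x) x) = (\<lambda>x. c * (a * T f x) + d * (a * T g x))" if "f \<in> Cinf" "g \<in> Cinf" for f g c d
    unfolding linear_on_space_lincomb[OF assms that] by (simp add: algebra_simps)
qed

lemma linear_on_space_add:
  assumes "linear_on_space Cinf S" "linear_on_space Cinf T"
  shows "linear_on_space Cinf (\<lambda>f x. S f x + T f x)"
  unfolding linear_on_space_def
proof (intro conjI ballI allI)
  show "(\<lambda>x. S f x + T f x) \<in> Cinf" if "f \<in> Cinf" for f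
    using linear_on_space_pow[OF assms(1) that, of 1] linear_on_space_pow[OF assms(2) that, of 1]
    by - (rule CinfI, rule Cb_add; rule CinfD, simp)
  show "(\<lambda>x. S (\<lambda>x. c * f x + d * g x) x + T (\<lambda>x. c * f x + d * g x) x)
      = (\<lambda>x. c * (S f x + T f x) + d * (S g x + T g x))" if "f \<in> Cinf" "g \<in> Cinf" for f g c d
    unfolding linear_on_space_lincomb[OF assms(1) that] linear_on_space_lincomb[OF assms(2) that]
    by (simp add: algebra_simps)
qed

lemma linear_on_space_id: "linear_on_space V (\<lambda>f. f)"
  by (simp add: linear_on_space_def)

lemma second_order_pow_Cb: "second_order T \<Longrightarrow> Cb (r + 2 * k) g \<Longrightarrow> Cb r ((T ^^ k) g)"
proof (induction k arbitrary: g)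
  case (Suc k)
  have "Cb (r + 2 * k + 2) g" using Suc.prems(2) by (simp del: Cb.simps add: add.assoc add.commute)
  then have "Cb (r + 2 * k) (T g)" by (rule second_order_Cb[OF Suc.prems(1)])
  from Suc.IH[OF Suc.prems(1) this] show ?case by (simp only: funpow_Suc_right comp_def)
qed simp

text \<open>Here derivatives are counted, since the lemma is applied to \<open>f_hat\<close>, whose
  smoothness is established only up to a finite order.\<close>

lemma second_order_pow_conv_op:
  "second_order T \<Longrightarrow> finite_borel_measure \<kappa> \<Longrightarrow> Cb (2 * k) g \<Longrightarrow> (T ^^ k) (conv_op \<kappa> g) = conv_op \<kappa> ((T ^^ k) g)"
proof (induction k)
  case (Suc k)
  have "Cb (2 * k) g" by (rule Cb_mono[OF Suc.prems(3)]) simp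
  then have "(T ^^ k) (conv_op \<kappa> g) = conv_op \<kappa> ((T ^^ k) g)" using Suc by blast
  moreover have "Cb 2 ((T ^^ k) g)"
    by (rule second_order_pow_Cb[OF Suc.prems(1)]) (use Suc.prems(3) in \<open>simp del: Cb.simps\<close>)
  ultimately show ?case using second_order_conv_op[OF Suc.prems(1,2)] by simp
qed simp

section \<open>Small time expansion\<close>

context levy_process_truncation
begin

lemma L_Cinf: "linear_on_space Cinf L"
  by (rule second_order_Cinf[OF second_order_generator])

lemma L_pow_Cinf: "g \<in> Cinf \<Longrightarrow> (L ^^ k) g \<in> Cinf"
  by (rule linear_on_space_pow[OF L_Cinf])

lemma I_pow_Cinf: "g \<in> Cinf \<Longrightarrow> (conv_op \<kappa>I ^^ k) g \<in> Cinf"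
  by (rule linear_on_space_pow[OF conv_op_Cinf[OF finite_large]])

lemma conv_op_law_continuous:
  assumes "Cb 2 g"
  shows "continuous_on {0..T} (\<lambda>t. conv_op (law t) g x)"
proof (cases "0 \<le> T")
  case True
  have "continuous_on {0..T} (\<lambda>t. g x + integral {0..t} (\<lambda>r. conv_op (law r) (L g) x))"
    using dynkin[OF assms True, of x] by (intro continuous_intros indefinite_integral_continuous_1) auto
  moreover have "conv_op (law t) g x = g x + integral {0..t} (\<lambda>r. conv_op (law r) (L g) x)" if "t \<in> {0..T}" for t
    using integral_unique[OF dynkin[OF assms, of t x]] that by simp
  ultimately show ?thesis by (metis (no_types, lifting) continuous_on_cong)
qed simp

text \<open>The integrand in Dynkin's formula is continuous in time, by the preceding lemma applied
  to \<open>L g\<close>, so the formula can be differentiated.\<close>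

lemma conv_op_law_deriv:
  assumes "g \<in> Cinf" "t \<in> {0..T}"
  shows "((\<lambda>t. conv_op (law t) g x) has_vector_derivative conv_op (law t) (L g) x) (at t within {0..T})"
proof -
  have g: "Cb 2 g" "Cb 2 (L g)"
    using assms(1) CinfD linear_on_space_pow[OF L_Cinf assms(1), of 1] by auto
  have "((\<lambda>t. integral {0..t} (\<lambda>r. conv_op (law r) (L g) x)) has_vector_derivative conv_op (law t) (L g) x) (at t within {0..T})"
    by (rule integral_has_vector_derivative[OF conv_op_law_continuous[OF g(2)] assms(2)])
  then have D: "((\<lambda>t. g x + integral {0..t} (\<lambda>r. conv_op (law r) (L g) x)) has_vector_derivative 0 + conv_op (law t) (L g) x) (at t within {0..T})"
    by (intro has_vector_derivative_add has_vector_derivative_const)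
  have e: "conv_op (law t) g x = g x + integral {0..t} (\<lambda>r. conv_op (law r) (L g) x)" if "t \<in> {0..T}" for t
    using integral_unique[OF dynkin[OF g(1), of t x]] that by simp
  show ?thesis
    using has_vector_derivative_transform[OF assms(2) e D] by simp
qed

text \<open>Each time derivative is one more application of L. Rescaling time to [0, 1] brings the
  integral remainder into the form of \<open>remainder_seq\<close>.\<close>

lemma law_taylor:
  assumes g: "g \<in> Cinf" and t: "0 \<le> t"
  shows "((\<lambda>\<alpha>. (1 - \<alpha>) ^ N / fact N * (t ^ Suc N * conv_op (law (\<alpha> * t)) ((L ^^ Suc N) g) x)) has_integral
     (conv_op (law t) g x - (\<Sum>j\<le>N. t ^ j / fact j * (L ^^ j) g x))) {0..1}"
proof -
  define Df where "Df i \<alpha> = t ^ i * conv_op (law (\<alpha> * t)) ((L ^^ i) g) x" for i \<alpha>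
  have D: "(Df i has_vector_derivative Df (Suc i) \<alpha>) (at \<alpha> within {0..1})" if "0 \<le> \<alpha>" "\<alpha> \<le> 1" for i \<alpha>
  proof -
    have "((\<lambda>\<alpha>. \<alpha> * t) has_vector_derivative t) (at \<alpha> within {0..1})"
      by (auto intro!: derivative_eq_intros simp: has_real_derivative_iff_has_vector_derivative[symmetric])
    moreover have sub: "(\<lambda>\<alpha>. \<alpha> * t) ` {0..1} \<subseteq> {0..t}" using t by (auto intro: mult_left_le_one_le)
    moreover have "((\<lambda>t. conv_op (law t) ((L ^^ i) g) x) has_vector_derivative conv_op (law (\<alpha> * t)) (L ((L ^^ i) g)) x) (at (\<alpha> * t) within (\<lambda>\<alpha>. \<alpha> * t) ` {0..1})"
      by (rule has_vector_derivative_within_subset[OF conv_op_law_deriv[OF L_pow_Cinf[OF g]] sub]) (use that t in \<open>auto intro: mult_left_le_one_le\<close>)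
    ultimately have "((\<lambda>t. conv_op (law t) ((L ^^ i) g) x) \<circ> (\<lambda>\<alpha>. \<alpha> * t) has_vector_derivative
        t *\<^sub>R conv_op (law (\<alpha> * t)) (L ((L ^^ i) g)) x) (at \<alpha> within {0..1})"
      by (intro vector_diff_chain_within)
    from has_vector_derivative_mult_right[OF this, of "t ^ i"]
    show ?thesis by (simp add: Df_def[abs_def] comp_def mult_ac)
  qed
  have "((\<lambda>\<alpha>. ((1 - \<alpha>) ^ (Suc N - 1) / fact (Suc N - 1)) *\<^sub>R Df (Suc N) \<alpha>) has_integral
     Df 0 1 - (\<Sum>i<Suc N. ((1 - 0) ^ i / fact i) *\<^sub>R Df i 0)) {0..1}"
    by (rule Taylor_has_integral) (use D in auto)
  \<comment> \<open>At \<alpha> = 0 the law is the point mass at 0, so the Taylor coefficients are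
    values of the iterates themselves.\<close>
  moreover have "conv_op (law 0) ((L ^^ i) g) x = (L ^^ i) g x" for i
    by (rule law_0[OF CinfD[OF L_pow_Cinf[OF g], of 0]])
  ultimately show ?thesis by (simp add: Df_def lessThan_Suc_atMost mult_ac)
qed

lemma conv_op_law_bound: "0 \<le> t \<Longrightarrow> (\<And>x. \<bar>g x\<bar> \<le> B) \<Longrightarrow> \<bar>conv_op (law t) g x\<bar> \<le> B"
  using finite_borel_measure.conv_op_bound[OF law_finite[of t], where g = g and B = B and x = x]
    measure_real_distribution[OF law_real] by auto

lemma law_taylor_bound:
  assumes g: "g \<in> Cinf" and t: "0 \<le> t" and B: "\<And>x. \<bar>(L ^^ Suc N) g x\<bar> \<le> B"
  shows "\<bar>conv_op (law t) g x - (\<Sum>j\<le>N. t ^ j / fact j * (L ^^ j) g x)\<bar> \<le> t ^ Suc N * B"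
proof -
  have B0: "0 \<le> B" using B by (meson abs_ge_zero order_trans)
  have "norm (conv_op (law t) g x - (\<Sum>j\<le>N. t ^ j / fact j * (L ^^ j) g x)) \<le> (t ^ Suc N * B) * measure lborel {0..1::real}"
  proof (rule has_integral_bound_real[OF _ finite.emptyI law_taylor[OF g t]])
    fix \<alpha> :: real assume a: "\<alpha> \<in> {0..1} - {}"
    have "\<bar>(1 - \<alpha>) ^ N / fact N\<bar> \<le> 1"
      using a power_le_one[of "1 - \<alpha>" N] fact_ge_1[of N, where 'a = real]
      by (auto simp: divide_le_eq intro: order_trans)
    moreover have "\<bar>t ^ Suc N * conv_op (law (\<alpha> * t)) ((L ^^ Suc N) g) x\<bar> \<le> t ^ Suc N * B"
      using conv_op_law_bound[of "\<alpha> * t" "(L ^^ Suc N) g" B x] B a t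
      by (auto simp: abs_mult simp del: power_Suc funpow.simps intro!: mult_left_mono)
    ultimately show "norm ((1 - \<alpha>) ^ N / fact N * (t ^ Suc N * conv_op (law (\<alpha> * t)) ((L ^^ Suc N) g) x)) \<le> t ^ Suc N * B"
      using mult_mono[of "\<bar>(1 - \<alpha>) ^ N / fact N\<bar>" 1 "\<bar>t ^ Suc N * conv_op (law (\<alpha> * t)) ((L ^^ Suc N) g) x\<bar>" "t ^ Suc N * B"] t B0
      by (simp add: abs_mult)
  qed (use t B0 in auto)
  then show ?thesis by simp
qed

text \<open>A partial sum of exp (- t I) applied to the law at time t. Cutting at n loses only
  O(t^(n+1)) for bounded g and leaves finitely many terms to expand.\<close>

definition trunc_exp :: "nat \<Rightarrow> real \<Rightarrow> (real \<Rightarrow> real) \<Rightarrow> real \<Rightarrow> real" where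
  "trunc_exp n t g x = (\<Sum>k\<le>n. (- t) ^ k / fact k * conv_op (law t) ((conv_op \<kappa>I ^^ k) g) x)"

text \<open>On \<open>Cb 2\<close> this is L - I by \<open>generator_decomp\<close>, and it is a
  local operator.\<close>

abbreviation "L0 \<equiv> (\<lambda>g x. L\<epsilon> g x - lam * g x)"

lemma L0_pow:
  assumes g: "g \<in> Cinf"
  shows "(L0 ^^ p) g x = (\<Sum>k\<le>p. real (p choose k) * ((-1) ^ k * (L ^^ (p - k)) ((conv_op \<kappa>I ^^ k) g) x))"
proof -
  define B where "B f x = (-1) * conv_op \<kappa>I f x" for f x
  have B: "linear_on_space Cinf B"
    unfolding B_def[abs_def] by (rule linear_on_space_scale[OF conv_op_Cinf[OF finite_large]])
  have Bk: "(B ^^ k) g = (\<lambda>x. (-1) ^ k * (conv_op \<kappa>I ^^ k) g x)" for k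
  proof (induction k)
    case (Suc k)
    have "(conv_op \<kappa>I ^^ k) g \<in> Cinf" by (rule I_pow_Cinf[OF g])
    then have "conv_op \<kappa>I (\<lambda>x. (-1) ^ k * (conv_op \<kappa>I ^^ k) g x + 0 * (conv_op \<kappa>I ^^ k) g x)
      = (\<lambda>x. (-1) ^ k * conv_op \<kappa>I ((conv_op \<kappa>I ^^ k) g) x + 0 * conv_op \<kappa>I ((conv_op \<kappa>I ^^ k) g) x)"
      by (intro linear_on_space_lincomb[OF conv_op_Cinf[OF finite_large]])
    then show ?case using Suc by (simp add: B_def[abs_def])
  qed simp
  have "(L0 ^^ p) g = (\<lambda>x. \<Sum>k\<le>p. real (p choose k) * (L ^^ (p - k)) ((B ^^ k) g) x)"
  proof (rule operator_binomial[OF L_Cinf B Cinf_lincomb _ _ g])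
    fix f assume f: "f \<in> Cinf"
    have "L (\<lambda>x. (-1) * conv_op \<kappa>I f x + 0 * conv_op \<kappa>I f x) = (\<lambda>x. (-1) * L (conv_op \<kappa>I f) x + 0 * L (conv_op \<kappa>I f) x)"
      using I_pow_Cinf[OF f, of 1] by (intro linear_on_space_lincomb[OF L_Cinf]) auto
    then show "L (B f) = B (L f)"
      using second_order_conv_op[OF second_order_generator finite_large CinfD[OF f]] by (simp add: B_def[abs_def])
    show "L0 f = (\<lambda>x. L f x + B f x)"
      using generator_decomp[OF CinfD[OF f]] by (auto simp: B_def)
  qed
  moreover have "(L ^^ j) (\<lambda>x. a * h x) x = a * (L ^^ j) h x" if "h \<in> Cinf" for j a h x
  proof -
    have "(L ^^ j) (\<lambda>x. a * h x) = (\<lambda>x. a * (L ^^ j) h x)"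
    proof (induction j)
      case (Suc j)
      have "L (\<lambda>x. a * (L ^^ j) h x + 0 * (L ^^ j) h x) = (\<lambda>x. a * L ((L ^^ j) h) x + 0 * L ((L ^^ j) h) x)"
        using L_pow_Cinf[OF that] by (intro linear_on_space_lincomb[OF L_Cinf])
      then show ?case using Suc by simp
    qed simp
    then show ?thesis by simp
  qed
  ultimately show ?thesis by (simp add: Bk I_pow_Cinf[OF g])
qed

text \<open>The terms with \<open>k \<ge> 1\<close> of \<open>trunc_exp\<close> involve only \<open>I\<^sup>k g\<close> and are expanded by Taylor's formula;
  collecting powers of \<open>t\<close> turns them into powers of \<open>L - I\<close>.\<close>

lemma trunc_exp_compare:
  assumes g: "g \<in> Cinf" and t: "0 \<le> t"
    and B: "\<And>k x. k \<in> {1..n} \<Longrightarrow> \<bar>(L ^^ (Suc (n - k))) ((conv_op \<kappa>I ^^ k) g) x\<bar> \<le> B" and B0: "0 \<le> B"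
  shows "\<bar>(conv_op (law t) g x - (\<Sum>p\<le>n. t ^ p / fact p * (L ^^ p) g x))
     - (trunc_exp n t g x - (\<Sum>p\<le>n. t ^ p / fact p * (L0 ^^ p) g x))\<bar> \<le> real n * B * t ^ Suc n"
proof -
  define P where "P k = conv_op (law t) ((conv_op \<kappa>I ^^ k) g) x" for k
  define Q where "Q k = (\<Sum>j\<le>n - k. t ^ j / fact j * (L ^^ j) ((conv_op \<kappa>I ^^ k) g) x)" for k
  have sum_split: "(\<Sum>k\<le>n. h k) = h 0 + (\<Sum>k\<in>{1..n}. h k)" for h :: "nat \<Rightarrow> real"
    by (simp add: atMost_atLeast0 sum.atLeast_Suc_atMost)
  have "(\<Sum>p\<le>n. t ^ p / fact p * (L0 ^^ p) g x)
     = (\<Sum>p\<le>n. \<Sum>k\<le>p. ((- t) ^ k / fact k) * (t ^ (p - k) / fact (p - k) * (L ^^ (p - k)) ((conv_op \<kappa>I ^^ k) g) x))"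
  proof (intro sum.cong refl)
    fix p
    have c: "t ^ p / fact p * (real (p choose k) * ((-1) ^ k * y)) = ((- t) ^ k / fact k) * (t ^ (p - k) / fact (p - k) * y)"
      if "k \<le> p" for k and y :: real
    proof -
      have "t ^ p = t ^ k * t ^ (p - k)" using that by (simp flip: power_add)
      moreover have "real (p choose k) = fact p / (fact k * fact (p - k))"
        using binomial_fact[OF that] by simp
      ultimately show ?thesis by (simp add: power_minus[of t k])
    qed
    show "t ^ p / fact p * (L0 ^^ p) g x = (\<Sum>k\<le>p. ((- t) ^ k / fact k) * (t ^ (p - k) / fact (p - k) * (L ^^ (p - k)) ((conv_op \<kappa>I ^^ k) g) x))"
      unfolding L0_pow[OF g] sum_distrib_left by (intro sum.cong refl c) simp
  qed
  \<comment> \<open>Collecting by the power k of I: the pairs k \<le> p \<le> n become pairs (k, j)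
    with k + j \<le> n.\<close>
  also have "\<dots> = (\<Sum>k\<le>n. ((- t) ^ k / fact k) * Q k)"
  proof -
    have "(\<Sum>p\<le>n. \<Sum>k\<le>p. ((- t) ^ k / fact k) * (t ^ (p - k) / fact (p - k) * (L ^^ (p - k)) ((conv_op \<kappa>I ^^ k) g) x))
      = (\<Sum>(k, j) | k + j \<le> n. ((- t) ^ k / fact k) * (t ^ j / fact j * (L ^^ j) ((conv_op \<kappa>I ^^ k) g) x))"
      by (subst sum.triangle_reindex_eq) simp
    also have "{(k, j). k + j \<le> n} = Sigma {..n} (\<lambda>k. {..n - k})" by auto
    finally show ?thesis by (simp add: sum.Sigma[symmetric] Q_def sum_distrib_left)
  qed
  finally have L0sum: "(\<Sum>p\<le>n. t ^ p / fact p * (L0 ^^ p) g x) = Q 0 + (\<Sum>k\<in>{1..n}. ((- t) ^ k / fact k) * Q k)"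
    by (simp add: sum_split)
  have te: "trunc_exp n t g x = P 0 + (\<Sum>k\<in>{1..n}. ((- t) ^ k / fact k) * P k)"
    unfolding trunc_exp_def by (simp add: sum_split P_def)
  \<comment> \<open>The terms \<open>P 0\<close> and \<open>Q 0\<close> cancel, so no bound on
    \<open>L ^^ Suc n\<close> of g itself enters.\<close>
  have "(conv_op (law t) g x - (\<Sum>p\<le>n. t ^ p / fact p * (L ^^ p) g x))
     - (trunc_exp n t g x - (\<Sum>p\<le>n. t ^ p / fact p * (L0 ^^ p) g x))
     = (\<Sum>k\<in>{1..n}. - ((- t) ^ k / fact k) * (P k - Q k))"
    unfolding L0sum te by (simp add: P_def Q_def right_diff_distrib sum_subtractf sum_negf)
  also have "\<bar>\<dots>\<bar> \<le> (\<Sum>k\<in>{1..n}. B * t ^ Suc n)"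
  proof (rule order_trans[OF sum_abs sum_mono])
    fix k assume k: "k \<in> {1..n}"
    have "\<bar>P k - Q k\<bar> \<le> t ^ Suc (n - k) * B"
      unfolding P_def Q_def by (rule law_taylor_bound[OF I_pow_Cinf[OF g] t B[OF k]])
    moreover have "\<bar>- ((- t) ^ k / fact k)\<bar> \<le> t ^ k"
      using t fact_ge_1[of k, where 'a = real] by (simp add: abs_divide power_abs divide_le_eq mult_le_cancel_left1)
    ultimately have "\<bar>- ((- t) ^ k / fact k)\<bar> * \<bar>P k - Q k\<bar> \<le> t ^ k * (t ^ Suc (n - k) * B)"
      using t by (intro mult_mono) auto
    also have "t ^ k * (t ^ Suc (n - k) * B) = B * t ^ Suc n"
    proof -
      have "t ^ k * t ^ Suc (n - k) = t ^ Suc n" using k by (simp flip: power_add power_Suc)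
      then show ?thesis by (simp add: mult_ac)
    qed
    finally show "\<bar>- ((- t) ^ k / fact k) * (P k - Q k)\<bar> \<le> B * t ^ Suc n" by (simp add: abs_mult)
  qed
  also have "\<dots> = real n * B * t ^ Suc n" by simp
  finally show ?thesis .
qed

text \<open>The full series is nonnegative by \<open>exp_conv_law_nonneg\<close>, and the terms
  beyond n add up to at most t^(n+1) exp \<Lambda>, because 0 \<le> g \<le> 1 and t \<le> 1. Cutting
  the series therefore spoils positivity only to the admissible order.\<close>

lemma trunc_exp_lower:
  assumes g: "Cb 2 g" "\<And>x. 0 \<le> g x" "\<And>x. g x \<le> 1" and t: "0 < t" "t \<le> 1"
  shows "- exp (measure \<kappa>I UNIV) * t ^ Suc n \<le> trunc_exp n t g x"
proof -
  define a where "a k = (- t) ^ k / fact k * conv_op (law t) ((conv_op \<kappa>I ^^ k) g) x" for k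
  define \<Lambda> where "\<Lambda> = measure \<kappa>I UNIV"
  have L0: "0 \<le> \<Lambda>" by (simp add: \<Lambda>_def)
  have lf: "finite_borel_measure (law t)" using t by (intro law_finite) simp
  have sm: "summable a" unfolding a_def by (rule exp_conv_summable[OF lf finite_large Cb_2_imp_0[OF g(1)]])
  have b: "\<bar>g x\<bar> \<le> 1" for x using g by simp
  have m1: "measure (law t) UNIV = 1" using t by (intro measure_real_distribution law_real) simp
  have bd: "\<bar>a (k + Suc n)\<bar> \<le> t ^ Suc n * (\<Lambda> ^ (k + Suc n) / fact (k + Suc n))" for k
  proof -
    have "\<bar>a (k + Suc n)\<bar> \<le> 1 * measure (law t) UNIV * ((\<bar>- t\<bar> * \<Lambda>) ^ (k + Suc n) / fact (k + Suc n))"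
      unfolding a_def \<Lambda>_def by (rule exp_conv_term_bound[OF lf finite_large b])
    also have "\<dots> = t ^ (k + Suc n) * (\<Lambda> ^ (k + Suc n) / fact (k + Suc n))"
      using t by (simp only: m1 power_mult_distrib) simp
    also have "\<dots> \<le> t ^ Suc n * (\<Lambda> ^ (k + Suc n) / fact (k + Suc n))"
      using t L0 by (intro mult_right_mono power_decreasing) auto
    finally show ?thesis .
  qed
  have se: "summable (\<lambda>k. \<Lambda> ^ k / fact k)" using summable_exp_real[of 1 \<Lambda>] by simp
  have sh: "summable (\<lambda>k. t ^ Suc n * (\<Lambda> ^ (k + Suc n) / fact (k + Suc n)))"
    using summable_ignore_initial_segment[OF se, of "Suc n"] by (rule summable_mult)
  have sa: "summable (\<lambda>k. a (k + Suc n))" by (rule summable_ignore_initial_segment[OF sm])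
  have "(\<Sum>k. a (k + Suc n)) \<le> (\<Sum>k. t ^ Suc n * (\<Lambda> ^ (k + Suc n) / fact (k + Suc n)))"
    using bd by (intro suminf_le sa sh) (meson abs_le_D1)
  also have "\<dots> = t ^ Suc n * (\<Sum>k. \<Lambda> ^ (k + Suc n) / fact (k + Suc n))"
    by (rule suminf_mult[OF summable_ignore_initial_segment[OF se]])
  also have "(\<Sum>k. \<Lambda> ^ (k + Suc n) / fact (k + Suc n)) \<le> exp \<Lambda>"
  proof -
    have "exp \<Lambda> = (\<Sum>k. \<Lambda> ^ k / fact k)"
      by (simp add: exp_def divide_inverse mult.commute)
    also have "\<dots> = (\<Sum>k. \<Lambda> ^ (k + Suc n) / fact (k + Suc n)) + (\<Sum>k<Suc n. \<Lambda> ^ k / fact k)"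
      by (rule suminf_split_initial_segment[OF se])
    finally show ?thesis using L0 by (simp add: sum_nonneg)
  qed
  finally have tail: "(\<Sum>k. a (k + Suc n)) \<le> t ^ Suc n * exp \<Lambda>" using t by (simp add: mult_left_mono)
  have "0 \<le> (\<Sum>k. a k)"
    using exp_conv_law_nonneg[OF t(1) g(1,2)] by (simp add: exp_conv_def a_def)
  also have "(\<Sum>k. a k) = (\<Sum>k. a (k + Suc n)) + (\<Sum>k<Suc n. a k)"
    by (rule suminf_split_initial_segment[OF sm])
  also have "(\<Sum>k<Suc n. a k) = trunc_exp n t g x"
    by (simp add: trunc_exp_def a_def lessThan_Suc_atMost)
  finally show ?thesis using tail by (simp add: \<Lambda>_def mult.commute)
qed

lemma trunc_exp_diff:
  assumes "f \<in> Cinf" "g \<in> Cinf" "0 \<le> t"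
  shows "trunc_exp n t (\<lambda>x. 1 * f x + (-1) * g x) x = trunc_exp n t f x - trunc_exp n t g x"
proof -
  have "conv_op (law t) ((conv_op \<kappa>I ^^ k) (\<lambda>x. 1 * f x + (-1) * g x)) x
     = conv_op (law t) ((conv_op \<kappa>I ^^ k) f) x - conv_op (law t) ((conv_op \<kappa>I ^^ k) g) x" for k
    unfolding finite_borel_measure.conv_op_pow_lincomb[OF finite_large CinfD[OF assms(1), of 0] CinfD[OF assms(2), of 0]]
      finite_borel_measure.conv_op_lincomb[OF law_finite[OF assms(3)] CinfD[OF I_pow_Cinf[OF assms(1)], of 0] CinfD[OF I_pow_Cinf[OF assms(2)], of 0]]
    by simp
  then show ?thesis unfolding trunc_exp_def by (simp only:) (simp add: right_diff_distrib sum_subtractf)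
qed

text \<open>A sandwich: \<open>trunc_exp\<close> of g and of f - g are both bounded below by - E, so
  that of g is controlled by that of f, whose Taylor remainder is bounded. The bound
  \<open>Bf\<close> starts at k = 0 but \<open>Bg\<close> at k = 1, since k = 0 would involve
  \<open>L ^^ Suc n\<close> of g, for which no bound uniform in m is at hand when g is
  \<open>fm m\<close>.\<close>

theorem expansion_bound:
  assumes f: "f \<in> Cinf" "\<And>z. 0 \<le> f z" "\<And>z. f z \<le> 1"
    and g: "g \<in> Cinf" "\<And>z. 0 \<le> g z" "\<And>z. g z \<le> f z"
    and L0: "\<And>p. p \<le> n \<Longrightarrow> (L0 ^^ p) f x = 0" "\<And>p. p \<le> n \<Longrightarrow> (L0 ^^ p) g x = 0"
    and Bf: "\<And>k z. k \<le> n \<Longrightarrow> \<bar>(L ^^ (Suc (n - k))) ((conv_op \<kappa>I ^^ k) f) z\<bar> \<le> Bf"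
    and Bg: "\<And>k z. k \<in> {1..n} \<Longrightarrow> \<bar>(L ^^ (Suc (n - k))) ((conv_op \<kappa>I ^^ k) g) z\<bar> \<le> Bg" "0 \<le> Bg"
    and t: "0 < t" "t \<le> 1"
  shows "\<bar>conv_op (law t) g x - (\<Sum>p\<le>n. t ^ p / fact p * (L ^^ p) g x)\<bar>
     \<le> (Bf + real n * Bf + real n * Bg + exp (measure \<kappa>I UNIV)) * t ^ Suc n"
proof -
  have t0: "0 \<le> t" using t by simp
  define E where "E = exp (measure \<kappa>I UNIV) * t ^ Suc n"
  have g1: "g z \<le> 1" for z using g(3) f(3) order_trans by blast
  have Bf0: "0 \<le> Bf" using Bf[of 0 0] by (meson abs_ge_zero order_trans le0)
  have z: "(\<Sum>p\<le>n. t ^ p / fact p * (L0 ^^ p) h x) = 0" if "\<And>p. p \<le> n \<Longrightarrow> (L0 ^^ p) h x = 0" for h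
    using that by (intro sum.neutral) auto
  have "\<bar>conv_op (law t) f x - (\<Sum>p\<le>n. t ^ p / fact p * (L ^^ p) f x)\<bar> \<le> t ^ Suc n * Bf"
    using Bf[of 0] by (intro law_taylor_bound f t0) simp
  moreover have "\<bar>(conv_op (law t) f x - (\<Sum>p\<le>n. t ^ p / fact p * (L ^^ p) f x)) - (trunc_exp n t f x - 0)\<bar> \<le> real n * Bf * t ^ Suc n"
  proof -
    have "\<bar>(L ^^ (Suc (n - k))) ((conv_op \<kappa>I ^^ k) f) z\<bar> \<le> Bf" if "k \<in> {1..n}" for k z using Bf that by simp
    from trunc_exp_compare[OF f(1) t0 this Bf0, where x = x] show ?thesis using z[OF L0(1)] by simp
  qed
  ultimately have Sf: "trunc_exp n t f x \<le> (Bf + real n * Bf) * t ^ Suc n"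
    by (simp add: algebra_simps del: power_Suc)
  have h: "(\<lambda>x. 1 * f x + (-1) * g x) \<in> Cinf" by (rule Cinf_lincomb[OF f(1) g(1)])
  have h0: "0 \<le> 1 * f z + (-1) * g z" for z using g(3)[of z] by simp
  have h1: "1 * f z + (-1) * g z \<le> 1" for z using f(3)[of z] g(2)[of z] by simp
  have gl: "- E \<le> trunc_exp n t g x"
    using trunc_exp_lower[OF CinfD[OF g(1)] g(2) g1 t, of n x] by (simp add: E_def)
  have hl: "- E \<le> trunc_exp n t (\<lambda>x. 1 * f x + (-1) * g x) x"
    using trunc_exp_lower[OF CinfD[OF h] h0 h1 t, of n x] by (simp add: E_def)
  have Sg: "\<bar>trunc_exp n t g x\<bar> \<le> (Bf + real n * Bf) * t ^ Suc n + E"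
  proof -
    have "0 \<le> (Bf + real n * Bf) * t ^ Suc n" using Bf0 t0 by simp
    then show ?thesis
      using gl hl Sf unfolding trunc_exp_diff[OF f(1) g(1) t0] by linarith
  qed
  have "\<bar>(conv_op (law t) g x - (\<Sum>p\<le>n. t ^ p / fact p * (L ^^ p) g x)) - (trunc_exp n t g x - 0)\<bar> \<le> real n * Bg * t ^ Suc n"
    using trunc_exp_compare[OF g(1) t0 Bg, where x = x] z[OF L0(2)] by simp
  then have "\<bar>conv_op (law t) g x - (\<Sum>p\<le>n. t ^ p / fact p * (L ^^ p) g x)\<bar> \<le> (Bf + real n * Bf) * t ^ Suc n + E + real n * Bg * t ^ Suc n"
    using Sg by linarith
  then show ?thesis by (simp add: E_def algebra_simps)
qed

end

section \<open>Smoothness of tail integrals and mollifiers\<close>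

lemma Cb_affine: "Cb r h \<Longrightarrow> Cb r (\<lambda>x. h (a * x + q))"
proof (induction r arbitrary: h)
  case 0
  then have "continuous_on UNIV h" "bounded (range h)" by auto
  moreover have "range (\<lambda>x. h (a * x + q)) \<subseteq> range h" by auto
  ultimately show ?case
    by (auto intro!: continuous_on_compose2[of UNIV h] continuous_intros intro: bounded_subset)
next
  case (Suc r)
  have "((\<lambda>x. h (a * x + q)) has_real_derivative a * deriv h (a * x + q)) (at x)" for x
  proof -
    have "((\<lambda>x. a * x + q) has_real_derivative a) (at x)" by (auto intro!: derivative_eq_intros)
    from DERIV_chain2[OF Cb_has_deriv[OF Suc.prems] this] show ?thesis by (simp add: mult.commute)
  qed
  moreover have "bounded (range (\<lambda>x. h (a * x + q)))"
    by (rule bounded_subset[OF Cb_bounded[OF Suc.prems]]) auto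
  ultimately show ?case
    by (rule Cb_SucI) (rule Cb_cmult[OF Suc.IH[OF Cb_deriv[OF Suc.prems]]])
qed

lemma tail_integral_has_deriv:
  fixes h :: "real \<Rightarrow> real"
  assumes c: "continuous_on UNIV h" and i: "integrable lborel h"
  shows "((\<lambda>z. LBINT u:{z..}. h u) has_real_derivative - h z) (at z)"
proof -
  have ii: "set_integrable lborel A h" if "A \<in> sets borel" for A
    unfolding set_integrable_def using i that by (intro integrable_mult_indicator) auto
  define a b where "a = z - 1" and "b = z + 1"
  \<comment> \<open>Near z the tail differs from the fixed tail over {a..} by an integral over a
    compact interval, to which the fundamental theorem applies.\<close>
  have eq: "(LBINT u:{a..}. h u) - integral {a..w} h = (LBINT u:{w..}. h u)" if "w \<in> {a<..<b}" for w
  proof -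
    have un: "{a..} = {a..w} \<union> {w..}" using that by auto
    have "(LBINT u:{a..w} \<union> {w..}. h u) = (LBINT u:{a..w}. h u) + (LBINT u:{w..}. h u)"
    proof (rule set_integral_Un_AE)
      show "AE x in lborel. \<not> (x \<in> {a..w} \<and> x \<in> {w..})"
        using AE_lborel_singleton[of w] by eventually_elim auto
    qed (auto intro: ii)
    moreover have "(LBINT u:{a..w}. h u) = integral {a..w} h"
      by (rule set_borel_integral_eq_integral) (rule ii, simp)
    ultimately show ?thesis by (simp add: un[symmetric])
  qed
  have "((\<lambda>w. integral {a..w} h) has_real_derivative h z) (at z within {a..b})"
    by (rule integral_has_real_derivative) (auto simp: a_def b_def intro: continuous_on_subset[OF c])
  then have "((\<lambda>w. integral {a..w} h) has_real_derivative h z) (at z within {a<..<b})"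
    by (rule DERIV_subset) auto
  moreover have "at z within {a<..<b} = at z"
    by (rule at_within_open) (auto simp: a_def b_def)
  ultimately have "((\<lambda>w. (LBINT u:{a..}. h u) - integral {a..w} h) has_real_derivative 0 - h z) (at z)"
    by (intro DERIV_diff DERIV_const) simp
  then have "((\<lambda>z. LBINT u:{z..}. h u) has_real_derivative 0 - h z) (at z)"
    by (rule has_field_derivative_transform_within_open[of _ _ _ "{a<..<b}"]) (auto simp: a_def b_def eq[unfolded a_def b_def])
  then show ?thesis by simp
qed

lemma Cb_tail_integral:
  assumes h: "Cb r h" and i: "integrable lborel h"
  shows "Cb (Suc r) (\<lambda>x. LBINT u:{y - x..}. h u)"
proof (rule Cb_SucI)
  show "((\<lambda>x. LBINT u:{y - x..}. h u) has_real_derivative h (- 1 * x + y)) (at x)" for x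
  proof -
    have "((\<lambda>x. y - x) has_real_derivative - 1) (at x)" by (auto intro!: derivative_eq_intros)
    from DERIV_chain2[OF tail_integral_has_deriv[OF Cb_continuous[OF h] i] this] show ?thesis by simp
  qed
  have "\<bar>LBINT u:{y - x..}. h u\<bar> \<le> (LBINT u. \<bar>h u\<bar>)" for x
  proof -
    have "norm (LBINT u:{y - x..}. h u) \<le> (LBINT u. norm (indicator {y - x..} u *\<^sub>R h u))"
      unfolding set_lebesgue_integral_def by (rule integral_norm_bound)
    also have "\<dots> \<le> (LBINT u. \<bar>h u\<bar>)"
      using i by (intro integral_mono' ) (auto simp: indicator_def)
    finally show ?thesis by simp
  qed
  then show "bounded (range (\<lambda>x. LBINT u:{y - x..}. h u))" by (auto simp: bounded_iff)
  show "Cb r (\<lambda>x. h (- 1 * x + y))" by (rule Cb_affine[OF h])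
qed

lemma deriv_cong_open:
  assumes "open U" "x \<in> U" "\<And>z. z \<in> U \<Longrightarrow> f z = g z"
  shows "deriv f x = deriv g x"
  using assms by (intro deriv_cong_ev refl eventually_nhds[THEN iffD2]) auto

lemma deriv_pow_cong_open:
  assumes "open U" "x \<in> U" "\<And>z. z \<in> U \<Longrightarrow> f z = g z"
  shows "(deriv ^^ k) f x = (deriv ^^ k) g x"
  using assms(2)
proof (induction k arbitrary: x)
  case (Suc k)
  have "deriv ((deriv ^^ k) f) x = deriv ((deriv ^^ k) g) x"
    by (rule deriv_cong_open[OF assms(1) Suc.prems Suc.IH])
  then show ?case by simp
qed (use assms in simp)

lemma deriv_pow_zero: "(deriv ^^ k) (\<lambda>x. 0) = (\<lambda>x::real. 0::real)"
  by (induction k) auto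

lemma bounded_range_compact:
  fixes f :: "real \<Rightarrow> real"
  assumes "continuous_on UNIV f" "\<And>x. R < \<bar>x\<bar> \<Longrightarrow> \<bar>f x\<bar> \<le> B"
  shows "bounded (range f)"
proof -
  have "bounded (f ` {-R..R})"
    by (intro compact_imp_bounded compact_continuous_image continuous_on_subset[OF assms(1)]) auto
  then obtain C where "\<forall>z\<in>f ` {-R..R}. norm z \<le> C"
    unfolding bounded_iff by blast
  then have C: "\<And>x. x \<in> {-R..R} \<Longrightarrow> \<bar>f x\<bar> \<le> C" by simp
  have "\<bar>f x\<bar> \<le> max B C" for x
  proof (cases "R < \<bar>x\<bar>")
    case False
    then have "x \<in> {-R..R}" by auto
    then show ?thesis using C by (simp add: le_max_iff_disj)
  qed (use assms(2) in \<open>simp add: le_max_iff_disj\<close>)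
  then show ?thesis by (auto simp: bounded_iff)
qed

lemma Cb_by_derivs:
  assumes "\<And>k x. k < Suc r \<Longrightarrow> (deriv ^^ (j + k)) f differentiable (at x)"
    and "\<And>k. k \<le> r \<Longrightarrow> bounded (range ((deriv ^^ (j + k)) f))"
  shows "Cb r ((deriv ^^ j) f)"
  using assms
proof (induction r arbitrary: j)
  case 0
  then show ?case
    using 0(1)[of 0] 0(2)[of 0]
    by (auto intro!: continuous_at_imp_continuous_on differentiable_imp_continuous_within)
next
  case (Suc r)
  have "Cb r ((deriv ^^ Suc j) f)"
  proof (rule Suc.IH)
    show "(deriv ^^ (Suc j + k)) f differentiable (at x)" if "k < Suc r" for k x
      using Suc.prems(1)[of "Suc k" x] that by simp
    show "bounded (range ((deriv ^^ (Suc j + k)) f))" if "k \<le> r" for k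
      using Suc.prems(2)[of "Suc k"] that by simp
  qed
  then show ?case using Suc.prems(1)[of 0] Suc.prems(2)[of 0] by simp
qed

lemma smooth_compact_Cinf:
  assumes "smooth f" "\<And>x. R < \<bar>x\<bar> \<Longrightarrow> f x = 0"
  shows "f \<in> Cinf"
proof (rule CinfI)
  fix r
  have d: "(deriv ^^ k) f differentiable (at x)" for k x using assms(1) by (simp add: smooth_def)
  have z: "(deriv ^^ k) f x = 0" if "R < \<bar>x\<bar>" for k x
  proof -
    have "open {x::real. R < \<bar>x\<bar>}" by (intro open_Collect_less continuous_intros)
    from deriv_pow_cong_open[OF this, of x f "\<lambda>_. 0" k] show ?thesis using that assms(2) by (simp add: deriv_pow_zero)
  qed
  have "Cb r ((deriv ^^ 0) f)"
  proof (rule Cb_by_derivs)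
    show "bounded (range ((deriv ^^ (0 + k)) f))" for k
      by (rule bounded_range_compact[where R = R and B = 0])
        (auto simp: z intro!: continuous_at_imp_continuous_on differentiable_imp_continuous_within d)
  qed (use d in auto)
  then show "Cb r f" by simp
qed

text \<open>Differentiability on a set, because the density s is differentiable off 0 only; a cover
  by two open sets then gives it for \<open>s_bar\<close> on the whole line.\<close>

definition diff_on :: "nat \<Rightarrow> real set \<Rightarrow> (real \<Rightarrow> real) \<Rightarrow> bool" where
  "diff_on r U f \<longleftrightarrow> (\<forall>k<r. \<forall>x\<in>U. (deriv ^^ k) f differentiable (at x))"

lemma differentiable_cong_open:
  fixes f g :: "real \<Rightarrow> real"
  assumes "open U" "x \<in> U" "\<And>z. z \<in> U \<Longrightarrow> f z = g z" "f differentiable (at x)"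
  shows "g differentiable (at x)"
proof -
  obtain D where "(f has_real_derivative D) (at x)"
    using assms(4) by (auto simp: real_differentiable_def)
  from has_field_derivative_transform_within_open[OF this assms(1-3)]
  show ?thesis by (auto simp: real_differentiable_def)
qed

lemma diff_on_cong:
  assumes "open U" "\<And>z. z \<in> U \<Longrightarrow> f z = g z" "diff_on r U f"
  shows "diff_on r U g"
  unfolding diff_on_def
proof (intro allI impI ballI)
  fix k x assume k: "k < r" and x: "x \<in> U"
  show "(deriv ^^ k) g differentiable (at x)"
  proof (rule differentiable_cong_open[OF assms(1) x])
    show "(deriv ^^ k) f differentiable (at x)" using assms(3) k x by (simp add: diff_on_def)
    show "(deriv ^^ k) f z = (deriv ^^ k) g z" if "z \<in> U" for z
      by (rule deriv_pow_cong_open[OF assms(1) that assms(2)])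
  qed
qed

lemma diff_on_Suc: "diff_on (Suc r) U f \<longleftrightarrow> (\<forall>x\<in>U. f differentiable (at x)) \<and> diff_on r U (deriv f)"
proof -
  have "(\<forall>k<Suc r. \<forall>x\<in>U. (deriv ^^ k) f differentiable (at x))
    \<longleftrightarrow> (\<forall>x\<in>U. (deriv ^^ 0) f differentiable (at x)) \<and> (\<forall>k<r. \<forall>x\<in>U. (deriv ^^ Suc k) f differentiable (at x))"
    using less_Suc_eq_0_disj by auto
  then show ?thesis unfolding diff_on_def by (simp only: funpow_Suc_right comp_def) simp
qed

lemma diff_on_lincomb:
  assumes "open U"
  shows "diff_on r U f \<Longrightarrow> diff_on r U g \<Longrightarrow> diff_on r U (\<lambda>x. a * f x + b * g x)"
proof (induction r arbitrary: f g)
  case (Suc r)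
  have d: "f differentiable (at x)" "g differentiable (at x)" if "x \<in> U" for x
    using Suc.prems that by (auto simp: diff_on_Suc)
  have e: "a * deriv f x + b * deriv g x = deriv (\<lambda>x. a * f x + b * g x) x" if "x \<in> U" for x
  proof (rule DERIV_imp_deriv[symmetric])
    have "(f has_real_derivative deriv f x) (at x)" "(g has_real_derivative deriv g x) (at x)"
      using d[OF that] by (simp_all add: DERIV_deriv_iff_real_differentiable)
    then show "((\<lambda>x. a * f x + b * g x) has_real_derivative a * deriv f x + b * deriv g x) (at x)"
      by (intro DERIV_add DERIV_cmult)
  qed
  have "diff_on r U (\<lambda>x. a * deriv f x + b * deriv g x)"
    using Suc by (auto simp: diff_on_Suc)
  from diff_on_cong[OF assms e this] show ?case
    using d by (auto simp: diff_on_Suc intro!: derivative_intros)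
qed (simp add: diff_on_def)

lemma diff_on_mono: "diff_on r U f \<Longrightarrow> q \<le> r \<Longrightarrow> diff_on q U f"
  by (auto simp: diff_on_def)

lemma diff_on_mult:
  assumes "open U"
  shows "diff_on r U f \<Longrightarrow> diff_on r U g \<Longrightarrow> diff_on r U (\<lambda>x. f x * g x)"
proof (induction r arbitrary: f g)
  case (Suc r)
  have d: "f differentiable (at x)" "g differentiable (at x)" if "x \<in> U" for x
    using Suc.prems that by (auto simp: diff_on_Suc)
  have e: "1 * (deriv f x * g x) + 1 * (f x * deriv g x) = deriv (\<lambda>x. f x * g x) x" if "x \<in> U" for x
  proof (rule DERIV_imp_deriv[symmetric])
    have "(f has_real_derivative deriv f x) (at x)" "(g has_real_derivative deriv g x) (at x)"
      using d[OF that] by (simp_all add: DERIV_deriv_iff_real_differentiable)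
    from DERIV_mult[OF this] show "((\<lambda>x. f x * g x) has_real_derivative 1 * (deriv f x * g x) + 1 * (f x * deriv g x)) (at x)"
      by (simp add: algebra_simps)
  qed
  have "diff_on r U f" "diff_on r U g" using Suc.prems diff_on_mono[of "Suc r" U _ r] by auto
  then have "diff_on r U (\<lambda>x. 1 * (deriv f x * g x) + 1 * (f x * deriv g x))"
    using Suc by (intro diff_on_lincomb assms) (auto simp: diff_on_Suc)
  from diff_on_cong[OF assms e this] show ?case
    using d by (auto simp: diff_on_Suc intro!: derivative_intros)
qed (simp add: diff_on_def)

lemma diff_on_const: "diff_on r U (\<lambda>x. a)"
proof -
  have "(deriv ^^ k) (\<lambda>x. a) = (\<lambda>x. if k = 0 then a else 0)" for k
    by (induction k) auto
  then show ?thesis by (auto simp: diff_on_def)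
qed

section \<open>Mollification as convolution with a probability measure\<close>

definition mollifier :: "(real \<Rightarrow> real) \<Rightarrow> nat \<Rightarrow> real measure" where
  "mollifier \<phi> m = distr (density lborel (\<lambda>v. ennreal (\<phi> v))) borel (\<lambda>v. v / real m)"

locale bump =
  fixes \<phi> :: "real \<Rightarrow> real"
  assumes bump: "bump_function \<phi>"
begin

lemma phi_sym: "\<phi> (- x) = \<phi> x" and phi_nonneg: "0 \<le> \<phi> x" and phi_int1: "(LBINT x. \<phi> x) = 1"
  using bump by (auto simp: bump_function_def)

lemma phi_zero: "1 < \<bar>x\<bar> \<Longrightarrow> \<phi> x = 0"
proof -
  assume "1 < \<bar>x\<bar>"
  then have "x \<notin> {-1..1}" by auto
  then have "x \<notin> closure {x. \<phi> x \<noteq> 0}" using bump unfolding bump_function_def by blast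
  then show ?thesis using closure_subset[of "{x. \<phi> x \<noteq> 0}"] by auto
qed

lemma phi_Cinf: "\<phi> \<in> Cinf"
  using bump phi_zero unfolding bump_function_def by (intro smooth_compact_Cinf[where R = 1]) auto

lemma phi_measurable[measurable]: "\<phi> \<in> borel_measurable borel"
  by (rule Cb_measurable[OF CinfD[OF phi_Cinf, of 0]])

lemma phi_integrable: "integrable lborel \<phi>"
  using phi_int1 by (rule_tac ccontr) (simp add: not_integrable_integral_eq)

lemma mollifier_prob: "prob_space (density lborel (\<lambda>v. ennreal (\<phi> v)))"
proof
  have "(\<integral>\<^sup>+x. ennreal (\<phi> x) \<partial>lborel) = ennreal 1"
    using nn_integral_eq_integral[OF phi_integrable] phi_nonneg phi_int1 by simp
  then show "emeasure (density lborel (\<lambda>v. ennreal (\<phi> v))) (space (density lborel (\<lambda>v. ennreal (\<phi> v)))) = 1"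
    by (simp add: emeasure_density)
qed

text \<open>True for m = 0 as well, where v / 0 = 0 turns the mollifier into the point mass at
  0.\<close>

lemma mollifier_finite: "finite_borel_measure (mollifier \<phi> m)"
  and mollifier_measure: "measure (mollifier \<phi> m) UNIV = 1"
proof -
  interpret D: prob_space "density lborel (\<lambda>v. ennreal (\<phi> v))" by (rule mollifier_prob)
  have "(\<lambda>v. v / real m) \<in> measurable (density lborel (\<lambda>v. ennreal (\<phi> v))) borel" by simp
  then interpret P: prob_space "mollifier \<phi> m" unfolding mollifier_def by (rule D.prob_space_distr)
  show "finite_borel_measure (mollifier \<phi> m)"
    by (rule finite_borel_measure.intro) (unfold_locales, simp add: finite_borel_measure_axioms_def mollifier_def)
  show "measure (mollifier \<phi> m) UNIV = 1" using P.prob_space by (simp add: mollifier_def)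
qed

lemma conv_op_mollifier:
  assumes [measurable]: "g \<in> borel_measurable borel"
  shows "conv_op (mollifier \<phi> m) g x = (LBINT v. g (x + v / real m) * \<phi> v)"
  unfolding conv_op_def mollifier_def using phi_nonneg
  by (subst integral_distr) (auto simp: integral_density mult.commute)

text \<open>The base point may move with m, because the expansion is later evaluated at 0 and at 1 /
  m.\<close>

lemma conv_op_mollifier_tendsto:
  assumes h: "Cb 0 h" and x: "x \<longlonglongrightarrow> x0"
  shows "(\<lambda>m. conv_op (mollifier \<phi> m) h (x m)) \<longlonglongrightarrow> h x0"
proof -
  note [measurable] = Cb_measurable[OF h]
  obtain B where B: "\<And>x. \<bar>h x\<bar> \<le> B" using Cb_bound[OF h] by auto
  have "(\<lambda>m. LBINT v. h (x m + v / real m) * \<phi> v) \<longlonglongrightarrow> (LBINT v. h x0 * \<phi> v)"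
  proof (rule integral_dominated_convergence[where w = "\<lambda>v. B * \<phi> v"])
    show "integrable lborel (\<lambda>v. B * \<phi> v)" using phi_integrable by simp
    show "AE v in lborel. (\<lambda>m. h (x m + v / real m) * \<phi> v) \<longlonglongrightarrow> h x0 * \<phi> v"
    proof (intro AE_I2 tendsto_intros)
      fix v
      have "(\<lambda>m. x m + v / real m) \<longlonglongrightarrow> x0 + 0" by (intro tendsto_add x lim_const_over_n)
      then show "(\<lambda>m. h (x m + v / real m)) \<longlonglongrightarrow> h x0"
        by (intro continuous_on_tendsto_compose[OF Cb_continuous[OF h]]) auto
    qed
    show "AE v in lborel. norm (h (x m + v / real m) * \<phi> v) \<le> B * \<phi> v" for m
      using B phi_nonneg by (intro AE_I2) (simp add: abs_mult mult_right_mono)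
  qed measurable
  then show ?thesis by (simp add: conv_op_mollifier phi_int1)
qed

text \<open>The substitution v = - m u and the symmetry of \<phi>: the mass of the scaled bump below
  x - y is the mass of those v with x + v / m \<ge> y.\<close>

lemma mollified_indicator_conv:
  assumes m: "0 < m"
  shows "mollified_indicator \<phi> y m x = conv_op (mollifier \<phi> m) (indicator {y..}) x"
proof -
  have "conv_op (mollifier \<phi> m) (indicator {y..}) x = (LBINT v. indicator {y..} (x + v / real m) * \<phi> v)"
    by (rule conv_op_mollifier) simp
  also have "\<dots> = \<bar>- real m\<bar> *\<^sub>R (LBINT u. indicator {y..} (x + (0 + - real m * u) / real m) * \<phi> (0 + - real m * u))"
    using m by (intro lborel_integral_real_affine) auto
  also have "\<dots> = (LBINT u. real m * (indicator {y..} (x + (0 + - real m * u) / real m) * \<phi> (0 + - real m * u)))"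
    by simp
  also have "\<dots> = (LBINT u. indicator {..x - y} u *\<^sub>R (real m * \<phi> (real m * u)))"
  proof (intro Bochner_Integration.integral_cong refl)
    fix u
    have "indicator {y..} (x + (0 + - real m * u) / real m) = (indicator {..x - y} u :: real)"
      using m by (auto simp: indicator_def)
    then show "real m * (indicator {y..} (x + (0 + - real m * u) / real m) * \<phi> (0 + - real m * u)) = indicator {..x - y} u *\<^sub>R (real m * \<phi> (real m * u))"
      using phi_sym[of "real m * u"] by simp
  qed
  finally show ?thesis by (simp only: mollified_indicator_def set_lebesgue_integral_def)
qed

text \<open>By symmetry the function is also a tail integral of the scaled bump, which is smooth
  with compact support.\<close>

lemma mollified_indicator_Cinf:
  assumes m: "0 < m"
  shows "mollified_indicator \<phi> y m \<in> Cinf"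
proof (rule CinfI)
  fix r
  have h: "Cb r (\<lambda>u. real m * \<phi> (real m * u + 0))" for r
    by (intro Cb_cmult Cb_affine CinfD phi_Cinf)
  have "integrable lborel (\<lambda>u. \<phi> (0 + real m * u))"
    using m by (subst lborel_integrable_real_affine_iff) (auto simp: phi_integrable)
  then have i: "integrable lborel (\<lambda>u. real m * \<phi> (real m * u + 0))" by simp
  have "mollified_indicator \<phi> y m x = (LBINT u:{y - x..}. real m * \<phi> (real m * u + 0))" for x
  proof -
    have "(LBINT u:{y - x..}. real m * \<phi> (real m * u + 0)) = \<bar>-1\<bar> *\<^sub>R (LBINT u. indicator {y - x..} (0 + -1 * u) *\<^sub>R (real m * \<phi> (real m * (0 + -1 * u) + 0)))"
      unfolding set_lebesgue_integral_def by (rule lborel_integral_real_affine) simp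
    also have "\<dots> = (LBINT u. indicator {..x - y} u *\<^sub>R (real m * \<phi> (real m * u)))"
    proof -
      have "indicator {y - x..} (0 + -1 * u) = (indicator {..x - y} u :: real)" for u
        by (auto simp: indicator_def)
      moreover have "\<phi> (real m * (0 + -1 * u) + 0) = \<phi> (real m * u)" for u
        using phi_sym[of "real m * u"] by simp
      ultimately show ?thesis by (simp only: abs_minus_cancel abs_one scaleR_one)
    qed
    finally show ?thesis by (simp only: mollified_indicator_def set_lebesgue_integral_def)
  qed
  then have "mollified_indicator \<phi> y m = (\<lambda>x. LBINT u:{y - x..}. real m * \<phi> (real m * u + 0))" by auto
  then have "Cb (Suc r) (mollified_indicator \<phi> y m)" using Cb_tail_integral[OF h i] by simp
  then show "Cb r (mollified_indicator \<phi> y m)" by (rule Cb_mono) simp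
qed

lemma mollified_indicator_bounds:
  assumes m: "0 < m"
  shows "0 \<le> mollified_indicator \<phi> y m x" "mollified_indicator \<phi> y m x \<le> 1"
    and "x < y - 1 / real m \<Longrightarrow> mollified_indicator \<phi> y m x = 0"
    and "y + 1 / real m \<le> x \<Longrightarrow> mollified_indicator \<phi> y m x = 1"
proof -
  note e = mollified_indicator_conv[OF m] conv_op_mollifier[of "indicator {y..}", simplified]
  have i: "integrable lborel (\<lambda>v. indicator {y..} (x + v / real m) * \<phi> v)"
    by (rule Bochner_Integration.integrable_bound[OF phi_integrable], measurable) (auto simp: indicator_def)
  show "0 \<le> mollified_indicator \<phi> y m x" unfolding e using phi_nonneg by (intro Bochner_Integration.integral_nonneg) auto
  have "(LBINT v. indicator {y..} (x + v / real m) * \<phi> v) \<le> (LBINT v. \<phi> v)"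
    using phi_nonneg by (intro integral_mono i phi_integrable) (auto simp: indicator_def)
  then show "mollified_indicator \<phi> y m x \<le> 1" unfolding e phi_int1 .
  show "mollified_indicator \<phi> y m x = 0" if "x < y - 1 / real m"
  proof -
    have z: "indicator {y..} (x + v / real m) * \<phi> v = 0" for v
    proof (cases "1 < \<bar>v\<bar>")
      case False
      then have "v / real m \<le> 1 / real m" using m by (intro divide_right_mono) auto
      then show ?thesis using that by (auto simp: indicator_def)
    qed (simp add: phi_zero)
    show ?thesis unfolding e z by simp
  qed
  show "mollified_indicator \<phi> y m x = 1" if "y + 1 / real m \<le> x"
  proof -
    have z: "indicator {y..} (x + v / real m) * \<phi> v = \<phi> v" for v
    proof (cases "1 < \<bar>v\<bar>")
      case False
      then have "- 1 / real m \<le> v / real m" using m by (intro divide_right_mono) auto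
      then show ?thesis using that by (auto simp: indicator_def)
    qed (simp add: phi_zero)
    show ?thesis unfolding e z by (rule phi_int1)
  qed
qed

end

text \<open>Fubini: the tail of a convolution is the convolution of the tail. For convolution powers
  of \<open>s_bar\<close> this is the recursion of \<open>f_hat\<close> in
  \<open>fh_Suc_Cb\<close>.\<close>

lemma convolution_tail:
  fixes h k :: "real \<Rightarrow> real"
  assumes h: "integrable lborel h" and k: "integrable lborel k"
  shows "integrable lborel (\<lambda>x. LBINT u. h (x - u) * k u)"
    and "(LBINT v:{z..}. LBINT u. h (v - u) * k u) = (LBINT u. (LBINT v:{z - u..}. h v) * k u)"
proof -
  have [measurable]: "h \<in> borel_measurable borel" "k \<in> borel_measurable borel"
    using borel_measurable_integrable[OF h] borel_measurable_integrable[OF k] by simp_all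
  have shift: "integrable lborel (\<lambda>v. h (v - u))" for u
    using lborel_integrable_real_affine[OF h, of 1 "- u"] by (simp add: algebra_simps)
  have norm_shift: "(LBINT v. \<bar>h (v - u)\<bar>) = (LBINT v. \<bar>h v\<bar>)" for u
    using lborel_integral_real_affine[of 1 "\<lambda>v. \<bar>h v\<bar>" "- u"] by (simp add: algebra_simps)
  have int: "integrable (lborel \<Otimes>\<^sub>M lborel) (\<lambda>(u, v). h (v - u) * k u)"
  proof (rule lborel_pair.Fubini_integrable)
    show "integrable lborel (\<lambda>u. LBINT v. norm (case (u, v) of (u, v) \<Rightarrow> h (v - u) * k u))"
      using k by (simp add: abs_mult norm_shift)
    show "AE u in lborel. integrable lborel (\<lambda>v. case (u, v) of (u, v) \<Rightarrow> h (v - u) * k u)"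
      using shift by simp
  qed measurable
  show "integrable lborel (\<lambda>x. LBINT u. h (x - u) * k u)"
    by (rule lborel_pair.integrable_snd[OF int])
  have int2: "integrable (lborel \<Otimes>\<^sub>M lborel) (\<lambda>(u, v). indicator {z..} v * (h (v - u) * k u))"
    by (rule Bochner_Integration.integrable_bound[OF int], measurable) (auto simp: indicator_def)
  have "(LBINT v:{z..}. LBINT u. h (v - u) * k u) = (LBINT v. LBINT u. indicator {z..} v * (h (v - u) * k u))"
    by (simp add: set_lebesgue_integral_def)
  also have "\<dots> = (LBINT u. LBINT v. indicator {z..} v * (h (v - u) * k u))"
    by (rule lborel_pair.Fubini_integral[OF int2])
  also have "\<dots> = (LBINT u. (LBINT v:{z - u..}. h v) * k u)"
  proof (intro Bochner_Integration.integral_cong refl)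
    fix u
    have "(LBINT v. indicator {z..} v * (h (v - u) * k u)) = (LBINT v. indicator {z..} v * h (v - u)) * k u"
      by (simp only: mult.assoc[symmetric] integral_mult_left_zero)
    also have "(LBINT v. indicator {z..} v * h (v - u)) = \<bar>1\<bar> *\<^sub>R (LBINT v. indicator {z..} (u + 1 * v) * h (u + 1 * v - u))"
      by (rule lborel_integral_real_affine) simp
    also have "\<dots> = (LBINT v:{z - u..}. h v)"
      unfolding set_lebesgue_integral_def
      by (simp, intro Bochner_Integration.integral_cong refl) (auto simp: indicator_def)
    finally show "(LBINT v. indicator {z..} v * (h (v - u) * k u)) = (LBINT v:{z - u..}. h v) * k u" .
  qed
  finally show "(LBINT v:{z..}. LBINT u. h (v - u) * k u) = (LBINT u. (LBINT v:{z - u..}. h v) * k u)" .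
qed

lemma conv_power_1: "conv_power h (Suc 0) = h"
  by (simp add: conv_power_def)

lemma conv_power_Suc: "conv_power h (Suc (Suc j)) = (\<lambda>x. LBINT u. conv_power h (Suc j) (x - u) * h u)"
  by (simp add: conv_power_def)

lemma bounded_family:
  assumes "finite A" "\<And>k. k \<in> A \<Longrightarrow> Cb 0 (F k)"
  shows "\<exists>B\<ge>0. \<forall>k\<in>A. \<forall>x. \<bar>F k x\<bar> \<le> B"
  using assms
proof (induction A rule: finite_induct)
  case (insert k A)
  then obtain B where B: "0 \<le> B" "\<And>j x. j \<in> A \<Longrightarrow> \<bar>F j x\<bar> \<le> B" by auto
  obtain C where C: "0 \<le> C" "\<And>x. \<bar>F k x\<bar> \<le> C" using Cb_bound[OF insert.prems[of k]] by auto
  have "\<bar>F j x\<bar> \<le> max B C" if "j \<in> insert k A" for j x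
    using that B(2)[of j x] C(2)[of x] by (auto simp: le_max_iff_disj)
  then show ?case using B(1) by (intro exI[of _ "max B C"]) auto
qed auto

lemma sum_from_1: "a 0 = 0 \<Longrightarrow> (\<Sum>p\<le>n. a p) = (\<Sum>p=1..n. a p)" for a :: "nat \<Rightarrow> real"
  by (simp add: atMost_atLeast0 sum.atLeast_Suc_atMost)

section \<open>The expansion, uniform in the mollification parameter\<close>

locale levy_expansion = levy_process_truncation M \<sigma> b \<nu> \<epsilon> c X + bump \<phi>
  for M :: "'w measure" and \<sigma> b \<nu> \<epsilon> c X \<phi> +
  fixes s :: "real \<Rightarrow> real" and n :: nat and y :: real
  assumes n1: "1 \<le> n" and y_eps: "real (n + 1) * \<epsilon> < y"
    and nu_density: "\<nu> = density lborel (\<lambda>x. ennreal (s x))" and s_nonneg: "\<And>x. x \<noteq> 0 \<Longrightarrow> 0 \<le> s x"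
    and s_diff: "\<And>k x. k < 2 * n + 1 \<Longrightarrow> x \<noteq> 0 \<Longrightarrow> (deriv ^^ k) s differentiable (at x)"
    and s_bound: "\<And>k \<delta>. k \<le> 2 * n + 1 \<Longrightarrow> 0 < \<delta> \<Longrightarrow>
           bdd_above ((\<lambda>x. \<bar>(deriv ^^ k) s x\<bar>) ` {x. \<delta> < \<bar>x\<bar>})"
begin

abbreviation "sb \<equiv> s_bar s c"
abbreviation "H \<equiv> indicator {y..} :: real \<Rightarrow> real"
abbreviation "fh \<equiv> f_hat s c y"
abbreviation "fm \<equiv> mollified_indicator \<phi> y"
abbreviation "\<kappa>M \<equiv> mollifier \<phi>"

lemma s_measurable[measurable]: "s \<in> borel_measurable borel"
proof -
  have "s differentiable (at x)" if "x \<noteq> 0" for x using s_diff[of 0 x] that by simp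
  then have "continuous_on (- {0}) s"
    by (auto intro!: continuous_at_imp_continuous_on differentiable_imp_continuous_within)
  then have "(\<lambda>x. indicator (- {0}) x *\<^sub>R s x) \<in> borel_measurable borel"
    by (intro borel_measurable_continuous_on_indicator) auto
  then have "(\<lambda>x. indicator (- {0}) x *\<^sub>R s x + s 0 * indicator {0} x) \<in> borel_measurable borel"
    by measurable
  moreover have "indicator (- {0}) x *\<^sub>R s x + s 0 * indicator {0} x = s x" for x by (auto simp: indicator_def)
  ultimately show ?thesis by simp
qed

lemma s_AE_nonneg: "AE x in lborel. 0 \<le> s x"
  using AE_lborel_singleton[of "0::real"] by eventually_elim (rule s_nonneg)

lemma nu_integral: "f \<in> borel_measurable borel \<Longrightarrow> (\<integral>x. f x \<partial>\<nu>) = (LBINT x. s x * f x)" for f :: "real \<Rightarrow> real"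
  unfolding nu_density using s_AE_nonneg by (subst integral_density) auto

lemma sb_eq: "sb x = (1 - c x) * s x"
  using c_facts(4)[of 0] eps by (simp add: s_bar_def)

lemma sb_measurable[measurable]: "sb \<in> borel_measurable borel"
  unfolding sb_eq[abs_def] by measurable

lemma sb_integrable: "integrable lborel sb"
proof -
  have "integrable \<nu> (\<lambda>x. 1 * (1 - c x))" by (intro integrable_one_minus_c[where B = 1]) auto
  then have "integrable lborel (\<lambda>x. s x *\<^sub>R (1 * (1 - c x)))"
    unfolding nu_density using s_AE_nonneg by (subst (asm) integrable_density) auto
  then show ?thesis by (simp add: sb_eq[abs_def] mult.commute)
qed

lemma conv_op_large_sb: "g \<in> borel_measurable borel \<Longrightarrow> conv_op \<kappa>I g x = (LBINT u. g (x + u) * sb u)"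
  by (simp add: conv_op_large nu_integral sb_eq mult_ac)

text \<open>By the product rule away from 0, and near 0 because 1 - c vanishes there; the two open
  sets cover the line.\<close>

lemma sb_diff_on: "diff_on (2 * n + 1) UNIV sb"
proof -
  have "diff_on (2 * n + 1) (- {0}) (\<lambda>x. 1 * 1 + (-1) * c x)"
    using trunc by (intro diff_on_lincomb diff_on_const)
      (auto simp: truncation_function_def smooth_def diff_on_def)
  then have "diff_on (2 * n + 1) (- {0}) (\<lambda>x. (1 * 1 + (-1) * c x) * s x)"
    using s_diff by (intro diff_on_mult) (auto simp: diff_on_def)
  then have "diff_on (2 * n + 1) (- {0}) (\<lambda>x. sb x)" by (simp add: sb_eq)
  moreover have "diff_on (2 * n + 1) {-\<epsilon>/2<..<\<epsilon>/2} sb"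
  proof (rule diff_on_cong[OF _ _ diff_on_const[of _ _ 0]])
    show "0 = sb z" if "z \<in> {-\<epsilon>/2<..<\<epsilon>/2}" for z
    proof -
      have "\<bar>z\<bar> \<le> \<epsilon> / 2" using that by (auto simp: abs_le_iff)
      then show ?thesis using c_facts(4)[of z] by (simp add: sb_eq)
    qed
  qed auto
  ultimately show ?thesis
    using eps unfolding diff_on_def by (metis ComplI greaterThanLessThan_iff half_gt_zero minus_divide_left neg_less_0_iff_less singletonD)
qed

text \<open>Beyond \<epsilon> the function is s, with derivatives bounded by hypothesis; on
  [-\<epsilon>, \<epsilon>] continuity suffices. Order 2 n allows n applications of a second order
  operator.\<close>

lemma sb_Cb: "Cb (2 * n) sb"
proof -
  have d: "(deriv ^^ k) sb differentiable (at x)" if "k < 2 * n + 1" for k x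
    using sb_diff_on that by (simp add: diff_on_def)
  have "Cb (2 * n) ((deriv ^^ 0) sb)"
  proof (rule Cb_by_derivs)
    show "(deriv ^^ (0 + k)) sb differentiable (at x)" if "k < Suc (2 * n)" for k x
      using d that by simp
    fix k assume k: "k \<le> 2 * n"
    have "bdd_above ((\<lambda>x. \<bar>(deriv ^^ k) s x\<bar>) ` {x. \<epsilon> < \<bar>x\<bar>})"
      using s_bound[of k \<epsilon>] k eps by simp
    then obtain B where B: "\<And>x. \<epsilon> < \<bar>x\<bar> \<Longrightarrow> \<bar>(deriv ^^ k) s x\<bar> \<le> B"
      by (auto simp: bdd_above_def)
    have op: "open {x::real. \<epsilon> < \<bar>x\<bar>}" by (intro open_Collect_less continuous_intros)
    show "bounded (range ((deriv ^^ (0 + k)) sb))"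
    proof (rule bounded_range_compact[where R = \<epsilon> and B = B])
      show "continuous_on UNIV ((deriv ^^ (0 + k)) sb)"
        using d k by (auto intro!: continuous_at_imp_continuous_on differentiable_imp_continuous_within)
      fix x assume x: "\<epsilon> < \<bar>x\<bar>"
      have "(deriv ^^ k) sb x = (deriv ^^ k) s x"
        by (rule deriv_pow_cong_open[OF op]) (use x c_facts(5) in \<open>auto simp: sb_eq\<close>)
      then show "\<bar>(deriv ^^ (0 + k)) sb x\<bar> \<le> B" using B[OF x] by simp
    qed
  qed
  then show ?thesis by simp
qed

lemma conv_power_integrable: "integrable lborel (conv_power sb (Suc j))"
  by (induction j) (simp_all add: conv_power_1 sb_integrable conv_power_Suc convolution_tail(1))

lemma fh_1: "fh (Suc 0) = conv_op \<kappa>I H"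
proof
  fix x
  have "indicator {y - x..} u = H (x + u)" for u by (auto simp: indicator_def)
  then show "fh (Suc 0) x = conv_op \<kappa>I H x"
    by (simp add: f_hat_def conv_power_1 conv_op_large_sb set_lebesgue_integral_def)
qed

lemma fh_1_Cb: "Cb (2 * n) (fh (Suc 0))"
  using Cb_Suc_D[OF Cb_tail_integral[OF sb_Cb sb_integrable, of y]]
  by (simp add: f_hat_def[abs_def] conv_power_1)

text \<open>Recursion and smoothness go together: the recursion needs \<open>fh (Suc j)\<close>
  measurable, and the smoothness of the next function comes from the recursion.\<close>

lemma fh_Suc_Cb: "fh (Suc (Suc j)) = conv_op \<kappa>I (fh (Suc j)) \<and> Cb (2 * n) (fh (Suc j))"
proof (induction j)
  have step: "fh (Suc (Suc j)) = conv_op \<kappa>I (fh (Suc j))" if "Cb (2 * n) (fh (Suc j))" for j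
  proof
    fix x
    have "fh (Suc (Suc j)) x = (LBINT u. (LBINT v:{y - x - u..}. conv_power sb (Suc j) v) * sb u)"
      unfolding f_hat_def conv_power_Suc by (rule convolution_tail(2)[OF conv_power_integrable sb_integrable])
    also have "\<dots> = (LBINT u. fh (Suc j) (x + u) * sb u)"
      by (simp add: f_hat_def diff_diff_eq)
    also have "\<dots> = conv_op \<kappa>I (fh (Suc j)) x"
      by (rule conv_op_large_sb[symmetric, OF Cb_measurable[OF that]])
    finally show "fh (Suc (Suc j)) x = conv_op \<kappa>I (fh (Suc j)) x" .
  qed
  {
    case 0
    show ?case using step[OF fh_1_Cb] fh_1_Cb by blast
  next
    case (Suc j)
    have "Cb (2 * n) (fh (Suc (Suc j)))"
      using Suc finite_borel_measure.Cb_conv_op[OF finite_large, of "2 * n" "fh (Suc j)"] by argo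
    then show ?case using step by blast
  }
qed

lemma fh_Cb: "1 \<le> i \<Longrightarrow> Cb (2 * n) (fh i)"
  using fh_Suc_Cb[of "i - 1"] by simp

lemma fm_Cinf: "0 < m \<Longrightarrow> fm m \<in> Cinf"
  by (rule mollified_indicator_Cinf)

lemma fm_conv: "0 < m \<Longrightarrow> fm m = conv_op (\<kappa>M m) H"
  using mollified_indicator_conv by blast

text \<open>Mollification commutes with I, and a single I already smooths the indicator to
  \<open>fh 1\<close>. Since mollifying does not increase suprema, bounds on \<open>fh\<close> carry
  over to these powers uniformly in m.\<close>

lemma I_pow_fm:
  assumes "0 < m"
  shows "(conv_op \<kappa>I ^^ Suc j) (fm m) = conv_op (\<kappa>M m) (fh (Suc j))"
proof (induction j)
  case 0
  have "conv_op \<kappa>I (conv_op (\<kappa>M m) H) = conv_op (\<kappa>M m) (conv_op \<kappa>I H)"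
    by (rule conv_op_commute_bounded[OF finite_large mollifier_finite, where C = 1]) (auto simp: indicator_def)
  then show ?case by (simp add: fm_conv[OF assms] fh_1)
next
  case (Suc j)
  have "(conv_op \<kappa>I ^^ Suc (Suc j)) (fm m) = conv_op \<kappa>I (conv_op (\<kappa>M m) (fh (Suc j)))"
    using Suc by simp
  also have "\<dots> = conv_op (\<kappa>M m) (conv_op \<kappa>I (fh (Suc j)))"
    by (rule conv_op_commute[OF finite_large mollifier_finite conjunct2[OF fh_Suc_Cb]])
  finally show ?case using fh_Suc_Cb[of j] by simp
qed

lemma I_pow_fm': "0 < m \<Longrightarrow> 1 \<le> i \<Longrightarrow> (conv_op \<kappa>I ^^ i) (fm m) = conv_op (\<kappa>M m) (fh i)"
  using I_pow_fm[of m "i - 1"] by simp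

lemma L_trunc_eq:
  assumes g: "Cb 2 g"
  shows "L_trunc \<sigma> b \<nu> s c g = L\<epsilon> g"
proof
  fix x
  define F where "F w = (LBINT \<beta>:{0..1}. deriv (deriv g) (x + \<beta> * w) * (1 - \<beta>)) * w\<^sup>2 * c w" for w
  have "integrable \<nu> F" unfolding F_def by (rule integrable_small[OF Cb_2D(5)[OF g]])
  then have "F \<in> borel_measurable borel" using borel_measurable_integrable by fastforce
  then have "(LBINT w. F w * s w) = (\<integral>w. F w \<partial>\<nu>)" by (simp add: nu_integral mult.commute)
  then show "L_trunc \<sigma> b \<nu> s c g x = L\<epsilon> g x"
    unfolding L_trunc_def small_jump_generator_def conv_op_small[OF Cb_2D(5)[OF g]] F_def by simp
qed

lemma L_trunc_pow: "Cb (2 * j) g \<Longrightarrow> (L_trunc \<sigma> b \<nu> s c ^^ j) g = (L\<epsilon> ^^ j) g"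
proof (induction j)
  case (Suc j)
  have "Cb (2 * j) g" by (rule Cb_mono[OF Suc.prems]) simp
  moreover have "Cb 2 ((L\<epsilon> ^^ j) g)"
    by (rule second_order_pow_Cb[OF second_order_small]) (use Suc.prems in \<open>simp del: Cb.simps\<close>)
  ultimately show ?case using Suc.IH L_trunc_eq by simp
qed simp

lemma L\<epsilon>_Cinf: "linear_on_space Cinf L\<epsilon>"
  by (rule second_order_Cinf[OF second_order_small])

text \<open>Each application moves the left end of the support by at most \<epsilon>. The case
  \<open>L\<epsilon>\<close> serves the formula for the coefficients, the case \<open>L0\<close> the
  estimate of the remainder.\<close>

lemma local_pow:
  assumes g: "g \<in> Cinf" and z: "\<And>x. x < a \<Longrightarrow> g x = 0"
    and T: "T = L\<epsilon> \<or> T = L0"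
  shows "(T ^^ p) g \<in> Cinf \<and> (\<forall>x < a - real p * \<epsilon>. (T ^^ p) g x = 0)"
proof (induction p)
  case (Suc p)
  define h where "h = (T ^^ p) g"
  have h: "h \<in> Cinf" "\<And>x. x < a - real p * \<epsilon> \<Longrightarrow> h x = 0" using Suc by (auto simp: h_def)
  have "L0 h = (\<lambda>x. 1 * L\<epsilon> h x + (- lam) * h x)" by simp
  moreover have L: "L\<epsilon> h \<in> Cinf" using linear_on_space_pow[OF L\<epsilon>_Cinf h(1), of 1] by simp
  ultimately have "L0 h \<in> Cinf" using Cinf_lincomb[OF L h(1), of 1 "- lam"] by simp
  then have "T h \<in> Cinf" using T L by auto
  moreover have "T h x = 0" if "x < a - real (Suc p) * \<epsilon>" for x
  proof -
    have x: "x < (a - real p * \<epsilon>) - \<epsilon>" using that by (simp add: algebra_simps)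
    have "L\<epsilon> h x = 0" by (rule small_generator_local[OF CinfD[OF h(1)] h(2) x])
    moreover have "h x = 0" using x eps by (intro h(2)) linarith
    ultimately show ?thesis using T by auto
  qed
  ultimately show ?case by (simp add: h_def)
qed (use assms in simp)

text \<open>Two nested binomial expansions, of L = - \<lambda> + (L\<epsilon> + I) and then of
  L\<epsilon> + I, reproduce the shape of \<open>d_coeff\<close> and \<open>c_coeff\<close>. Terms
  without I are local and vanish at x; in the others j - i \<le> n, so \<open>fh i\<close> has
  enough derivatives.\<close>

lemma L_pow_fm:
  assumes m: "0 < m" and x: "x < y - 1 / real m - real k * \<epsilon>" and k: "k \<le> Suc n"
  shows "(L ^^ k) (fm m) x = (\<Sum>j=1..k. real (k choose j) *
     (\<Sum>i=1..j. real (j choose i) * conv_op (\<kappa>M m) ((L\<epsilon> ^^ (j - i)) (fh i)) x) * (- lam) ^ (k - j))"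
proof -
  define T1 where "T1 f x = L\<epsilon> f x + conv_op \<kappa>I f x" for f x
  define A where "A f x = (- lam) * f x" for f :: "real \<Rightarrow> real" and x
  have T1: "linear_on_space Cinf T1"
    unfolding T1_def[abs_def] by (intro linear_on_space_add L\<epsilon>_Cinf conv_op_Cinf finite_large)
  have A: "linear_on_space Cinf A"
    unfolding A_def[abs_def] by (intro linear_on_space_scale linear_on_space_id)
  note f = fm_Cinf[OF m]
  have A_pow: "(A ^^ i) h = (\<lambda>x. (- lam) ^ i * h x)" for i h
    by (induction i) (auto simp: A_def)
  have 1: "(L ^^ k) (fm m) = (\<lambda>x. \<Sum>j\<le>k. real (k choose j) * (A ^^ (k - j)) ((T1 ^^ j) (fm m)) x)"
  proof (rule operator_binomial[OF A T1 Cinf_lincomb _ _ f])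
    fix g assume g: "g \<in> Cinf"
    show "L g = (\<lambda>x. A g x + T1 g x)"
      using generator_decomp[OF CinfD[OF g]] by (auto simp: A_def T1_def)
    show "A (T1 g) = T1 (A g)"
      using linear_on_space_lincomb[OF T1 g g, of "- lam" 0] by (simp add: A_def[abs_def])
  qed
  have 2: "(T1 ^^ j) (fm m) = (\<lambda>x. \<Sum>i\<le>j. real (j choose i) * (L\<epsilon> ^^ (j - i)) ((conv_op \<kappa>I ^^ i) (fm m)) x)" for j
  proof (rule operator_binomial[OF L\<epsilon>_Cinf conv_op_Cinf[OF finite_large] Cinf_lincomb _ _ f])
    fix g assume g: "g \<in> Cinf"
    show "L\<epsilon> (conv_op \<kappa>I g) = conv_op \<kappa>I (L\<epsilon> g)"
      by (rule second_order_conv_op[OF second_order_small finite_large CinfD[OF g]])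
  qed (auto simp: T1_def)
  have zero: "(L\<epsilon> ^^ j) (fm m) x = 0" if "j \<le> k" for j
  proof -
    have "\<forall>x < (y - 1 / real m) - real j * \<epsilon>. (L\<epsilon> ^^ j) (fm m) x = 0"
      using local_pow[OF f, of "y - 1 / real m" L\<epsilon> j] mollified_indicator_bounds(3)[OF m] by blast
    moreover have "real j * \<epsilon> \<le> real k * \<epsilon>" using that eps by (intro mult_right_mono) auto
    ultimately show ?thesis using x by simp
  qed
  have 3: "(T1 ^^ j) (fm m) x = (\<Sum>i=1..j. real (j choose i) * conv_op (\<kappa>M m) ((L\<epsilon> ^^ (j - i)) (fh i)) x)" if j: "j \<le> k" for j
  proof -
    have "(T1 ^^ j) (fm m) x = (L\<epsilon> ^^ j) (fm m) x + (\<Sum>i=1..j. real (j choose i) * (L\<epsilon> ^^ (j - i)) ((conv_op \<kappa>I ^^ i) (fm m)) x)"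
      unfolding 2 by (simp add: atMost_atLeast0 sum.atLeast_Suc_atMost)
    also have "\<dots> = (\<Sum>i=1..j. real (j choose i) * conv_op (\<kappa>M m) ((L\<epsilon> ^^ (j - i)) (fh i)) x)"
    proof -
      have "(L\<epsilon> ^^ (j - i)) ((conv_op \<kappa>I ^^ i) (fm m)) = conv_op (\<kappa>M m) ((L\<epsilon> ^^ (j - i)) (fh i))" if i: "i \<in> {1..j}" for i
      proof -
        have "Cb (2 * (j - i)) (fh i)" by (rule Cb_mono[OF fh_Cb]) (use i j k in auto)
        then show ?thesis
          using I_pow_fm'[OF m, of i] i second_order_pow_conv_op[OF second_order_small mollifier_finite] by simp
      qed
      then show ?thesis using zero[OF j] by simp
    qed
    finally show ?thesis .
  qed
  have "(L ^^ k) (fm m) x = (\<Sum>j\<le>k. real (k choose j) * ((- lam) ^ (k - j) * (T1 ^^ j) (fm m) x))"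
    unfolding 1 by (simp add: A_pow)
  \<comment> \<open>The term j = 0 is the value of \<open>fm m\<close> at x, which is 0.\<close>
  also have "\<dots> = (\<Sum>j=1..k. real (k choose j) * ((- lam) ^ (k - j) * (T1 ^^ j) (fm m) x))"
    using 3[of 0] by (simp add: atMost_atLeast0 sum.atLeast_Suc_atMost)
  also have "\<dots> = (\<Sum>j=1..k. real (k choose j) *
     (\<Sum>i=1..j. real (j choose i) * conv_op (\<kappa>M m) ((L\<epsilon> ^^ (j - i)) (fh i)) x) * (- lam) ^ (k - j))"
    using 3 by (intro sum.cong) auto
  finally show ?thesis .
qed

text \<open>The sequence x = 0 yields the limits that define \<open>d_hat\<close>, the sequence x =
  1 / m those needed for the tail probability.\<close>

lemma L_pow_fm_tendsto:
  assumes k: "k \<le> n" and x: "x \<longlonglongrightarrow> 0"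
  shows "(\<lambda>m. (L ^^ k) (fm m) (x m)) \<longlonglongrightarrow> d_coeff \<sigma> b \<nu> s c y k"
proof -
  define R where "R m = (\<Sum>j=1..k. real (k choose j) *
     (\<Sum>i=1..j. real (j choose i) * conv_op (\<kappa>M m) ((L\<epsilon> ^^ (j - i)) (fh i)) (x m)) * (- lam) ^ (k - j))" for m
  have "real k * \<epsilon> \<le> real (n + 1) * \<epsilon>" using k eps by (intro mult_right_mono) auto
  then have pos: "0 < y - real k * \<epsilon>" using y_eps by linarith
  have "(\<lambda>m. x m + 1 / real m) \<longlonglongrightarrow> 0 + 0" by (intro tendsto_add x lim_const_over_n)
  then have "\<forall>\<^sub>F m in sequentially. x m + 1 / real m < y - real k * \<epsilon>"
    using pos by (intro order_tendstoD(2)) auto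
  then have ev: "\<forall>\<^sub>F m in sequentially. R m = (L ^^ k) (fm m) (x m)"
    using eventually_gt_at_top[of 0]
  proof eventually_elim
    case (elim m)
    then show ?case unfolding R_def using k by (intro L_pow_fm[symmetric]) auto
  qed
  have lim: "R \<longlonglongrightarrow> d_coeff \<sigma> b \<nu> s c y k"
    unfolding R_def d_coeff_def c_coeff_def
  proof (intro tendsto_sum tendsto_mult tendsto_const)
    fix j i assume j: "j \<in> {1..k}" and i: "i \<in> {1..j}"
    have C: "Cb (2 * (j - i)) (fh i)" by (rule Cb_mono[OF fh_Cb]) (use i j k in auto)
    have C0: "Cb 0 ((L\<epsilon> ^^ (j - i)) (fh i))"
      by (rule second_order_pow_Cb[OF second_order_small]) (use C in \<open>simp del: Cb.simps\<close>)
    show "(\<lambda>m. conv_op (\<kappa>M m) ((L\<epsilon> ^^ (j - i)) (fh i)) (x m)) \<longlonglongrightarrow> (L_trunc \<sigma> b \<nu> s c ^^ (j - i)) (fh i) 0"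
      unfolding L_trunc_pow[OF C] by (rule conv_op_mollifier_tendsto[OF C0 x])
  qed
  show ?thesis by (rule Lim_transform_eventually[OF lim ev])
qed

lemma uniform_expansion:
  obtains C m0 where "0 \<le> C" "0 < m0" "\<And>m t x. m0 \<le> m \<Longrightarrow> 0 < t \<Longrightarrow> t \<le> 1 \<Longrightarrow> 0 \<le> x \<Longrightarrow> x \<le> 1 / real m \<Longrightarrow>
    \<bar>conv_op (law t) (fm m) x - (\<Sum>p\<le>n. t ^ p / fact p * (L ^^ p) (fm m) x)\<bar> \<le> C * t ^ Suc n"
proof -
  \<comment> \<open>Four widths 1 / m0 have to fit into the spare \<epsilon> between n \<epsilon>
    and y: the majorant below vanishes left of y - 3 / m0, and x \<le> 1 / m0 takes one
    more.\<close>
  obtain m0 :: nat where m0: "0 < m0" "4 / real m0 < \<epsilon>"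
  proof -
    obtain k :: nat where k: "4 / \<epsilon> < real k" using reals_Archimedean2 by blast
    have "0 < 4 / \<epsilon>" using eps by simp
    then have "0 < real k" using k by linarith
    then have "4 / real k < \<epsilon>" using k eps by (simp add: field_simps)
    then show ?thesis using that[of k] \<open>0 < real k\<close> by simp
  qed
  \<comment> \<open>Shifted to the left by 2 / m0, it equals 1 from y - 1 / m0 on, hence wherever
    \<open>fm m\<close> with m \<ge> m0 can be positive.\<close>
  define f where "f = mollified_indicator \<phi> (y - 2 / real m0) m0"
  have f: "f \<in> Cinf" unfolding f_def by (rule mollified_indicator_Cinf[OF m0(1)])
  note fb = mollified_indicator_bounds[OF m0(1), where y = "y - 2 / real m0", folded f_def]
  have m4: "4 / real m0 = 4 * (1 / real m0)" "2 / real m0 = 2 * (1 / real m0)" by simp_all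
  obtain Bf where Bf: "\<And>k z. k \<in> {..n} \<Longrightarrow> \<bar>(L ^^ (Suc (n - k))) ((conv_op \<kappa>I ^^ k) f) z\<bar> \<le> Bf"
    using bounded_family[of "{..n}" "\<lambda>k. (L ^^ (Suc (n - k))) ((conv_op \<kappa>I ^^ k) f)"]
      CinfD[OF L_pow_Cinf[OF I_pow_Cinf[OF f]]] by blast
  have fhC: "Cb 0 ((L ^^ (Suc (n - k))) (fh k))" "Cb (2 * Suc (n - k)) (fh k)" if "k \<in> {1..n}" for k
  proof -
    show C: "Cb (2 * Suc (n - k)) (fh k)" by (rule Cb_mono[OF fh_Cb]) (use that in auto)
    show "Cb 0 ((L ^^ (Suc (n - k))) (fh k))"
      by (rule second_order_pow_Cb[OF second_order_generator]) (use C in \<open>simp del: Cb.simps funpow.simps\<close>)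
  qed
  obtain Bg where Bg: "0 \<le> Bg" "\<And>k z. k \<in> {1..n} \<Longrightarrow> \<bar>(L ^^ (Suc (n - k))) (fh k) z\<bar> \<le> Bg"
    using bounded_family[of "{1..n}" "\<lambda>k. (L ^^ (Suc (n - k))) (fh k)"] fhC(1) by blast
  define C where "C = Bf + real n * Bf + real n * Bg + exp (measure \<kappa>I UNIV)"
  have Bf0: "0 \<le> Bf" using Bf[of 0 0] by (meson abs_ge_zero atMost_iff le0 order_trans)
  have C0: "0 \<le> C" unfolding C_def using Bf0 Bg(1) by simp
  have main: "\<bar>conv_op (law t) (fm m) x - (\<Sum>p\<le>n. t ^ p / fact p * (L ^^ p) (fm m) x)\<bar> \<le> C * t ^ Suc n"
    if m: "m0 \<le> m" and t: "0 < t" "t \<le> 1" and x: "0 \<le> x" "x \<le> 1 / real m" for m t x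
  proof -
    have mp: "0 < m" using m m0(1) by simp
    have mm: "1 / real m \<le> 1 / real m0" using m m0(1) by (intro divide_left_mono) auto
    note gb = mollified_indicator_bounds[OF mp, where y = y]
    have pe: "real p * \<epsilon> \<le> real n * \<epsilon>" if "p \<le> n" for p using that eps by (intro mult_right_mono) auto
    have ny: "real n * \<epsilon> + \<epsilon> < y" using y_eps by (simp add: algebra_simps)
    show ?thesis unfolding C_def
    proof (rule expansion_bound[OF f fb(1,2) fm_Cinf[OF mp] gb(1) _ _ _ _ _ Bg(1) t])
      show "fm m z \<le> f z" for z
      proof (cases "z < y - 1 / real m")
        case True
        then show ?thesis using gb(3) fb(1) by simp
      next
        case False
        then have "y - 2 / real m0 + 1 / real m0 \<le> z" using mm m4 by linarith
        then show ?thesis using gb(2) fb(4) by simp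
      qed
      show "(L0 ^^ p) f x = 0" if "p \<le> n" for p
      proof -
        have "\<forall>x < (y - 2 / real m0 - 1 / real m0) - real p * \<epsilon>. (L0 ^^ p) f x = 0"
          using local_pow[OF f, of "y - 2 / real m0 - 1 / real m0" L0 p] fb(3) by blast
        moreover have "x < (y - 2 / real m0 - 1 / real m0) - real p * \<epsilon>"
          using x mm m4 m0(2) pe[OF that] ny by linarith
        ultimately show ?thesis by blast
      qed
      show "(L0 ^^ p) (fm m) x = 0" if "p \<le> n" for p
      proof -
        have "\<forall>x < (y - 1 / real m) - real p * \<epsilon>. (L0 ^^ p) (fm m) x = 0"
          using local_pow[OF fm_Cinf[OF mp], of "y - 1 / real m" L0 p] gb(3) by blast
        moreover have "x < (y - 1 / real m) - real p * \<epsilon>"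
          using x mm m4 m0(2) pe[OF that] ny x by linarith
        ultimately show ?thesis by blast
      qed
      show "\<bar>(L ^^ (Suc (n - k))) ((conv_op \<kappa>I ^^ k) f) z\<bar> \<le> Bf" if "k \<le> n" for k z
        by (rule Bf) (use that in simp)
      show "\<bar>(L ^^ (Suc (n - k))) ((conv_op \<kappa>I ^^ k) (fm m)) z\<bar> \<le> Bg" if k: "k \<in> {1..n}" for k z
      proof -
        \<comment> \<open>Moving the generator inside the mollifier leaves the supremum of a
          function that does not depend on m.\<close>
        have "(L ^^ (Suc (n - k))) ((conv_op \<kappa>I ^^ k) (fm m)) = conv_op (\<kappa>M m) ((L ^^ (Suc (n - k))) (fh k))"
          using I_pow_fm'[OF mp, of k] k second_order_pow_conv_op[OF second_order_generator mollifier_finite fhC(2)[OF k], of m]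
          by (simp del: funpow.simps)
        then show ?thesis
          using finite_borel_measure.conv_op_bound[OF mollifier_finite Bg(2)[OF k], where x = z] by (simp add: mollifier_measure del: funpow.simps)
      qed
    qed
  qed
  show ?thesis by (rule that[OF C0 m0(1) main])
qed

section \<open>Letting the mollification parameter tend to infinity\<close>

lemma conv_op_law_fm_tendsto:
  assumes t: "0 \<le> t" and g: "g \<in> borel_measurable borel" and lim: "\<And>z. (\<lambda>m. fm (Suc m) (z + x m)) \<longlonglongrightarrow> g z"
  shows "(\<lambda>m. conv_op (law t) (fm (Suc m)) (x m)) \<longlonglongrightarrow> conv_op (law t) g 0"
proof -
  interpret finite_borel_measure "law t" by (rule law_finite[OF t])
  have [measurable]: "fm (Suc m) \<in> borel_measurable borel" for m
    by (rule Cb_measurable[OF CinfD[OF fm_Cinf, of _ 0]]) simp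
  have "(\<lambda>m. conv_op (law t) (\<lambda>z. fm (Suc m) (z + x m)) 0) \<longlonglongrightarrow> conv_op (law t) g 0"
  proof (rule conv_op_tendsto[OF _ g _ lim])
    show "(\<lambda>z. fm (Suc m) (z + x m)) \<in> borel_measurable borel" for m by measurable
    show "\<bar>fm (Suc m) (z + x m)\<bar> \<le> 1" for m z
      using mollified_indicator_bounds(1,2)[of "Suc m" y "z + x m"] by simp
  qed
  then show ?thesis by (simp add: conv_op_def add.commute)
qed

text \<open>At z = y scaling makes the value independent of m. The limit thus exists at every point,
  including one that the law of \<open>X t\<close> may charge.\<close>

lemma fm_tendsto: "(\<lambda>m. fm (Suc m) z) \<longlonglongrightarrow>
    (if z < y then 0 else if y < z then 1 else conv_op (\<kappa>M 1) (indicator {0..}) 0)"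
proof -
  have z: "(\<lambda>m. 1 / real (Suc m)) \<longlonglongrightarrow> 0" by (rule LIMSEQ_Suc[OF lim_const_over_n])
  consider "z < y" | "y < z" | "z = y" by linarith
  then show ?thesis
  proof cases
    case 1
    then have "\<forall>\<^sub>F m in sequentially. 1 / real (Suc m) < y - z" using z by (intro order_tendstoD(2)) auto
    then have "\<forall>\<^sub>F m in sequentially. fm (Suc m) z = 0"
      by eventually_elim (rule mollified_indicator_bounds(3), auto)
    then show ?thesis using 1 by (simp add: tendsto_eventually)
  next
    case 2
    then have "\<forall>\<^sub>F m in sequentially. 1 / real (Suc m) < z - y" using z by (intro order_tendstoD(2)) auto
    then have "\<forall>\<^sub>F m in sequentially. fm (Suc m) z = 1"
      by eventually_elim (rule mollified_indicator_bounds(4), auto)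
    then show ?thesis using 2 by (simp add: tendsto_eventually)
  next
    case 3
    have "indicator {y..} (y + v / real (Suc m)) = (indicator {0..} (0 + v / real 1) :: real)" for v m
      by (auto simp: indicator_def zero_le_divide_iff)
    then have "fm (Suc m) z = conv_op (\<kappa>M 1) (indicator {0..}) 0" for m
      unfolding 3 mollified_indicator_conv[OF zero_less_Suc] by (simp only: conv_op_mollifier borel_measurable_indicator atLeast_borel)
    then show ?thesis using 3 by simp
  qed
qed

text \<open>The shift compensates half the width of the transition zone: at z = y the value is
  already 1, so the limit is the indicator of the closed half-line.\<close>

lemma fm_shift_tendsto: "(\<lambda>m. fm (Suc m) (z + 1 / real (Suc m))) \<longlonglongrightarrow> indicator {y..} z"
proof (cases "y \<le> z")
  case True
  then have "fm (Suc m) (z + 1 / real (Suc m)) = 1" for m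
    by (intro mollified_indicator_bounds(4)) auto
  then show ?thesis using True by simp
next
  case False
  have "(\<lambda>m. 2 / real (Suc m)) \<longlonglongrightarrow> 0" by (rule LIMSEQ_Suc[OF lim_const_over_n])
  then have "\<forall>\<^sub>F m in sequentially. 2 / real (Suc m) < y - z" using False by (intro order_tendstoD(2)) auto
  then have "\<forall>\<^sub>F m in sequentially. fm (Suc m) (z + 1 / real (Suc m)) = 0"
  proof eventually_elim
    case (elim m)
    moreover have "2 / real (Suc m) = 1 / real (Suc m) + 1 / real (Suc m)" by (simp add: field_simps)
    ultimately have "z + 1 / real (Suc m) < y - 1 / real (Suc m)" by linarith
    then show ?case by (rule mollified_indicator_bounds(3)[OF zero_less_Suc])
  qed
  then show ?thesis using False by (simp add: tendsto_eventually)
qed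

lemma d_coeff_0: "d_coeff \<sigma> b \<nu> s c y 0 = 0"
  by (simp add: d_coeff_def)

theorem d_hat_seq_tendsto: "k \<le> n \<Longrightarrow> d_hat_seq \<sigma> b \<nu> \<phi> y k \<longlonglongrightarrow> d_coeff \<sigma> b \<nu> s c y k"
  unfolding d_hat_seq_def[abs_def] by (rule L_pow_fm_tendsto) auto

theorem tail_expansion:
  obtains C where "0 \<le> C" "\<And>t. 0 < t \<Longrightarrow> t \<le> 1 \<Longrightarrow>
    \<bar>prob {w \<in> space M. y \<le> X t w} - (\<Sum>p=1..n. d_coeff \<sigma> b \<nu> s c y p * t ^ p / fact p)\<bar> \<le> C * t ^ Suc n"
proof -
  obtain C m0 where C: "0 \<le> C" "0 < m0" "\<And>m t x. m0 \<le> m \<Longrightarrow> 0 < t \<Longrightarrow> t \<le> 1 \<Longrightarrow> 0 \<le> x \<Longrightarrow> x \<le> 1 / real m \<Longrightarrow>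
    \<bar>conv_op (law t) (fm m) x - (\<Sum>p\<le>n. t ^ p / fact p * (L ^^ p) (fm m) x)\<bar> \<le> C * t ^ Suc n"
    by (rule uniform_expansion) blast
  have "\<bar>prob {w \<in> space M. y \<le> X t w} - (\<Sum>p=1..n. d_coeff \<sigma> b \<nu> s c y p * t ^ p / fact p)\<bar> \<le> C * t ^ Suc n"
    if t: "0 < t" "t \<le> 1" for t
  proof -
    have t0: "0 \<le> t" using t by simp
    have [measurable]: "X t \<in> borel_measurable M" by (rule X_measurable[OF t0])
    have z: "(\<lambda>m. 1 / real m) \<longlonglongrightarrow> 0" by (rule lim_const_over_n)
    \<comment> \<open>The uniform expansion is evaluated at x = 1 / m, where the limit in m is the
      tail probability itself.\<close>
    have A: "(\<lambda>m. conv_op (law t) (fm (Suc m)) (1 / real (Suc m))) \<longlonglongrightarrow> conv_op (law t) (indicator {y..}) 0"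
      by (rule conv_op_law_fm_tendsto[OF t0 _ fm_shift_tendsto]) simp
    have P: "conv_op (law t) (indicator {y..}) 0 = prob {w \<in> space M. y \<le> X t w}"
    proof -
      have "conv_op (law t) (indicator {y..}) 0 = expectation (indicator {w \<in> space M. y \<le> X t w})"
        by (subst conv_op_law[OF t0], simp, intro Bochner_Integration.integral_cong refl) (auto simp: indicator_def)
      also have "\<dots> = prob ({w \<in> space M. y \<le> X t w} \<inter> space M)" by (rule Bochner_Integration.integral_indicator)
      also have "{w \<in> space M. y \<le> X t w} \<inter> space M = {w \<in> space M. y \<le> X t w}" by auto
      finally show ?thesis .
    qed
    have "(\<lambda>m. (L ^^ p) (fm (Suc m)) (1 / real (Suc m))) \<longlonglongrightarrow> d_coeff \<sigma> b \<nu> s c y p" if "p \<le> n" for p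
      by (rule LIMSEQ_Suc[OF L_pow_fm_tendsto[OF that z]])
    then have B: "(\<lambda>m. \<Sum>p\<le>n. t ^ p / fact p * (L ^^ p) (fm (Suc m)) (1 / real (Suc m))) \<longlonglongrightarrow> (\<Sum>p\<le>n. t ^ p / fact p * d_coeff \<sigma> b \<nu> s c y p)"
      by (intro tendsto_intros) auto
    have "(\<lambda>m. \<bar>conv_op (law t) (fm (Suc m)) (1 / real (Suc m)) - (\<Sum>p\<le>n. t ^ p / fact p * (L ^^ p) (fm (Suc m)) (1 / real (Suc m)))\<bar>)
      \<longlonglongrightarrow> \<bar>prob {w \<in> space M. y \<le> X t w} - (\<Sum>p\<le>n. t ^ p / fact p * d_coeff \<sigma> b \<nu> s c y p)\<bar>"
      by (rule tendsto_rabs[OF tendsto_diff[OF A[unfolded P] B]])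
    moreover have "\<exists>N. \<forall>m\<ge>N. \<bar>conv_op (law t) (fm (Suc m)) (1 / real (Suc m)) - (\<Sum>p\<le>n. t ^ p / fact p * (L ^^ p) (fm (Suc m)) (1 / real (Suc m)))\<bar> \<le> C * t ^ Suc n"
      by (intro exI[of _ m0] allI impI C(3) t) auto
    ultimately have "\<bar>prob {w \<in> space M. y \<le> X t w} - (\<Sum>p\<le>n. t ^ p / fact p * d_coeff \<sigma> b \<nu> s c y p)\<bar> \<le> C * t ^ Suc n"
      by (rule LIMSEQ_le_const2)
    then show ?thesis using sum_from_1[of "\<lambda>p. t ^ p / fact p * d_coeff \<sigma> b \<nu> s c y p"] d_coeff_0
      by (simp add: mult.commute)
  qed
  then show ?thesis using that C(1) by blast
qed

text \<open>\<open>law_taylor\<close> with N = n, up to the factor by which the two normalisations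
  of the integral differ.\<close>

lemma remainder_seq_eq:
  assumes t: "0 < t" and m: "0 < m"
  shows "remainder_seq M X \<sigma> b \<nu> \<phi> n t y m = fact n / t ^ Suc n *
     (conv_op (law t) (fm m) 0 - (\<Sum>p\<le>n. t ^ p / fact p * (L ^^ p) (fm m) 0))"
proof -
  define G where "G = (L ^^ Suc n) (fm m)"
  have G: "G \<in> Cinf" unfolding G_def by (rule L_pow_Cinf[OF fm_Cinf[OF m]])
  have "continuous_on {0..1} (\<lambda>\<alpha>. conv_op (law (\<alpha> * t)) G 0)"
    by (rule continuous_on_compose2[OF conv_op_law_continuous[OF CinfD[OF G], of t]])
      (use t in \<open>auto intro!: continuous_intros intro: mult_left_le_one_le\<close>)
  then have si: "set_integrable lborel {0..1} (\<lambda>\<alpha>. (1 - \<alpha>) ^ n * conv_op (law (\<alpha> * t)) G 0)"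
    by (intro borel_integrable_atLeastAtMost' continuous_intros)
  have "remainder_seq M X \<sigma> b \<nu> \<phi> n t y m = (LBINT \<alpha>:{0..1}. (1 - \<alpha>) ^ n * expectation (\<lambda>w. G (X (\<alpha> * t) w)))"
    by (simp add: remainder_seq_def G_def)
  also have "\<dots> = (LBINT \<alpha>:{0..1}. (1 - \<alpha>) ^ n * conv_op (law (\<alpha> * t)) G 0)"
    using t by (intro set_lebesgue_integral_cong) (auto simp: conv_op_law Cb_measurable[OF CinfD[OF G, of 0]])
  also have "\<dots> = integral {0..1} (\<lambda>\<alpha>. (1 - \<alpha>) ^ n * conv_op (law (\<alpha> * t)) G 0)"
    by (rule set_borel_integral_eq_integral(2)[OF si])
  also have "\<dots> = fact n / t ^ Suc n * (conv_op (law t) (fm m) 0 - (\<Sum>p\<le>n. t ^ p / fact p * (L ^^ p) (fm m) 0))"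
  proof (rule integral_unique)
    have "((\<lambda>\<alpha>. fact n / t ^ Suc n * ((1 - \<alpha>) ^ n / fact n * (t ^ Suc n * conv_op (law (\<alpha> * t)) G 0))) has_integral
       (fact n / t ^ Suc n * (conv_op (law t) (fm m) 0 - (\<Sum>p\<le>n. t ^ p / fact p * (L ^^ p) (fm m) 0)))) {0..1}"
      unfolding G_def by (intro has_integral_mult_right law_taylor fm_Cinf m less_imp_le t)
    moreover have "fact n / t ^ Suc n * ((1 - \<alpha>) ^ n / fact n * (t ^ Suc n * conv_op (law (\<alpha> * t)) G 0)) = (1 - \<alpha>) ^ n * conv_op (law (\<alpha> * t)) G 0" for \<alpha>
    proof -
      have "t ^ Suc n \<noteq> 0" using t by simp
      then show ?thesis by (simp del: power_Suc)
    qed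
    ultimately show "((\<lambda>\<alpha>. (1 - \<alpha>) ^ n * conv_op (law (\<alpha> * t)) G 0) has_integral
       (fact n / t ^ Suc n * (conv_op (law t) (fm m) 0 - (\<Sum>p\<le>n. t ^ p / fact p * (L ^^ p) (fm m) 0)))) {0..1}"
      by (simp only:)
  qed
  finally show ?thesis .
qed

theorem remainder_convergent:
  assumes t: "0 < t"
  shows "convergent (remainder_seq M X \<sigma> b \<nu> \<phi> n t y)"
proof -
  have t0: "0 \<le> t" using t by simp
  define g where "g z = (if z < y then 0 else if y < z then 1 else conv_op (\<kappa>M 1) (indicator {0..}) 0)" for z
  have [measurable]: "g \<in> borel_measurable borel" unfolding g_def[abs_def] by measurable
  have "(\<lambda>m. conv_op (law t) (fm (Suc m)) 0) \<longlonglongrightarrow> conv_op (law t) g 0"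
    by (rule conv_op_law_fm_tendsto[OF t0]) (use fm_tendsto in \<open>simp_all add: g_def\<close>)
  moreover have "(\<lambda>m. (L ^^ p) (fm (Suc m)) 0) \<longlonglongrightarrow> d_coeff \<sigma> b \<nu> s c y p" if "p \<le> n" for p
    by (rule LIMSEQ_Suc[OF L_pow_fm_tendsto[OF that tendsto_const]])
  ultimately have "(\<lambda>m. fact n / t ^ Suc n * (conv_op (law t) (fm (Suc m)) 0 - (\<Sum>p\<le>n. t ^ p / fact p * (L ^^ p) (fm (Suc m)) 0)))
     \<longlonglongrightarrow> fact n / t ^ Suc n * (conv_op (law t) g 0 - (\<Sum>p\<le>n. t ^ p / fact p * d_coeff \<sigma> b \<nu> s c y p))"
    by (intro tendsto_intros) auto
  \<comment> \<open>The shift skips index 0, where \<open>fm 0\<close> is identically 0 rather than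
    a mollified indicator.\<close>
  then have "(\<lambda>m. remainder_seq M X \<sigma> b \<nu> \<phi> n t y (Suc m))
     \<longlonglongrightarrow> fact n / t ^ Suc n * (conv_op (law t) g 0 - (\<Sum>p\<le>n. t ^ p / fact p * d_coeff \<sigma> b \<nu> s c y p))"
    by (simp only: remainder_seq_eq[OF t zero_less_Suc])
  then show ?thesis unfolding convergent_def using LIMSEQ_imp_Suc by blast
qed

text \<open>The bound C t^(n+1) at x = 0 cancels the power of t in \<open>remainder_seq_eq\<close>,
  and the resulting constant survives the limit in m.\<close>

theorem remainder_Limsup: "Limsup (at_right 0) (\<lambda>t. ereal \<bar>remainder M X \<sigma> b \<nu> \<phi> n t y\<bar>) < \<infinity>"
proof -
  obtain C m0 where C: "0 \<le> C" "0 < m0" "\<And>m t x. m0 \<le> m \<Longrightarrow> 0 < t \<Longrightarrow> t \<le> 1 \<Longrightarrow> 0 \<le> x \<Longrightarrow> x \<le> 1 / real m \<Longrightarrow>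
    \<bar>conv_op (law t) (fm m) x - (\<Sum>p\<le>n. t ^ p / fact p * (L ^^ p) (fm m) x)\<bar> \<le> C * t ^ Suc n"
    by (rule uniform_expansion) blast
  have "\<bar>remainder M X \<sigma> b \<nu> \<phi> n t y\<bar> \<le> fact n * C" if t: "0 < t" "t \<le> 1" for t
  proof -
    have "remainder_seq M X \<sigma> b \<nu> \<phi> n t y \<longlonglongrightarrow> remainder M X \<sigma> b \<nu> \<phi> n t y"
      using remainder_convergent[OF t(1)] by (simp add: remainder_def convergent_LIMSEQ_iff)
    then have "(\<lambda>m. \<bar>remainder_seq M X \<sigma> b \<nu> \<phi> n t y m\<bar>) \<longlonglongrightarrow> \<bar>remainder M X \<sigma> b \<nu> \<phi> n t y\<bar>"
      by (rule tendsto_rabs)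
    moreover have "\<bar>remainder_seq M X \<sigma> b \<nu> \<phi> n t y m\<bar> \<le> fact n * C" if m: "m0 \<le> m" for m
    proof -
      have mp: "0 < m" using m C(2) by simp
      have "\<bar>remainder_seq M X \<sigma> b \<nu> \<phi> n t y m\<bar> = fact n / t ^ Suc n *
         \<bar>conv_op (law t) (fm m) 0 - (\<Sum>p\<le>n. t ^ p / fact p * (L ^^ p) (fm m) 0)\<bar>"
        unfolding remainder_seq_eq[OF t(1) mp] using t by (simp add: abs_mult abs_divide del: power_Suc)
      also have "\<dots> \<le> fact n / t ^ Suc n * (C * t ^ Suc n)"
        using t by (intro mult_left_mono C(3)[OF m t]) auto
      also have "\<dots> = fact n * C"
      proof -
        have "t ^ Suc n \<noteq> 0" using t by simp
        then show ?thesis by (simp del: power_Suc)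
      qed
      finally show ?thesis .
    qed
    ultimately show ?thesis by (intro LIMSEQ_le_const2) auto
  qed
  moreover have "\<forall>\<^sub>F t in at_right 0. 0 < t \<and> t \<le> (1::real)"
    unfolding eventually_at_right_field by (intro exI[of _ 1]) auto
  ultimately have "\<forall>\<^sub>F t in at_right 0. ereal \<bar>remainder M X \<sigma> b \<nu> \<phi> n t y\<bar> \<le> ereal (fact n * C)"
    by (auto elim: eventually_mono)
  then have "Limsup (at_right 0) (\<lambda>t. ereal \<bar>remainder M X \<sigma> b \<nu> \<phi> n t y\<bar>) \<le> ereal (fact n * C)"
    by (rule Limsup_bounded)
  then show ?thesis using le_less_trans by fastforce
qed

text \<open>After division by t^k, the terms of order above k and the error C t^(n+1) are all
  absorbed in E t for t \<le> 1.\<close>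

theorem tail_coefficient_tendsto:
  assumes k: "k \<in> {1..n}"
  shows "((\<lambda>t. 1 / t ^ k * (prob {w \<in> space M. y \<le> X t w}
      - (\<Sum>j=1..k - 1. d_coeff \<sigma> b \<nu> s c y j * t ^ j / fact j))) \<longlongrightarrow> d_coeff \<sigma> b \<nu> s c y k / fact k) (at_right 0)"
proof -
  define D where "D = d_coeff \<sigma> b \<nu> s c y"
  obtain C where C: "0 \<le> C" "\<And>t. 0 < t \<Longrightarrow> t \<le> 1 \<Longrightarrow>
    \<bar>prob {w \<in> space M. y \<le> X t w} - (\<Sum>p=1..n. D p * t ^ p / fact p)\<bar> \<le> C * t ^ Suc n"
    unfolding D_def by (rule tail_expansion) blast
  define E where "E = C + (\<Sum>p\<in>{Suc k..n}. \<bar>D p\<bar>)"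
  have bound: "\<bar>1 / t ^ k * (prob {w \<in> space M. y \<le> X t w} - (\<Sum>j=1..k - 1. D j * t ^ j / fact j)) - D k / fact k\<bar> \<le> E * t"
    if t: "0 < t" "t \<le> 1" for t
  proof -
    define p where "p = prob {w \<in> space M. y \<le> X t w}"
    define a where "a j = D j * t ^ j / fact j" for j
    have tk: "t ^ k > 0" using t by simp
    have s1: "(\<Sum>j=1..n. a j) = (\<Sum>j=1..k - 1. a j) + a k + (\<Sum>j\<in>{Suc k..n}. a j)"
    proof -
      have "{1..n} = ({1..k - 1} \<union> {k}) \<union> {Suc k..n}" using k by auto
      moreover have "sum a (({1..k - 1} \<union> {k}) \<union> {Suc k..n}) = sum a ({1..k - 1} \<union> {k}) + sum a {Suc k..n}"
        by (rule sum.union_disjoint) auto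
      moreover have "sum a ({1..k - 1} \<union> {k}) = sum a {1..k - 1} + sum a {k}"
        by (rule sum.union_disjoint) (use k in auto)
      ultimately show ?thesis by simp
    qed
    have tail: "\<bar>\<Sum>j\<in>{Suc k..n}. a j\<bar> \<le> (\<Sum>j\<in>{Suc k..n}. \<bar>D j\<bar>) * t ^ Suc k"
    proof -
      have "\<bar>a j\<bar> \<le> \<bar>D j\<bar> * t ^ Suc k" if j: "j \<in> {Suc k..n}" for j
      proof -
        have "t ^ j \<le> t ^ Suc k" using t j by (intro power_decreasing) auto
        moreover have "t ^ j / fact j \<le> t ^ j"
          using t fact_ge_1[of j, where 'a = real] by (simp add: divide_le_eq mult_le_cancel_left1)
        ultimately have "t ^ j / fact j \<le> t ^ Suc k" by linarith
        then have "\<bar>D j\<bar> * (t ^ j / fact j) \<le> \<bar>D j\<bar> * t ^ Suc k" by (intro mult_left_mono) auto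
        then show ?thesis using t by (simp add: a_def abs_mult abs_divide power_abs del: power_Suc)
      qed
      then show ?thesis unfolding sum_distrib_right by (intro order_trans[OF sum_abs sum_mono]) auto
    qed
    have "t ^ Suc n \<le> t ^ Suc k" using t k by (intro power_decreasing) auto
    then have "C * t ^ Suc n \<le> C * t ^ Suc k" using C(1) by (intro mult_left_mono)
    moreover have "\<bar>p - (\<Sum>j=1..n. a j)\<bar> \<le> C * t ^ Suc n" using C(2)[OF t] by (simp add: p_def a_def)
    ultimately have "\<bar>p - (\<Sum>j=1..k - 1. a j) - a k\<bar> \<le> C * t ^ Suc k + (\<Sum>j\<in>{Suc k..n}. \<bar>D j\<bar>) * t ^ Suc k"
      using tail unfolding s1 by linarith
    also have "\<dots> = E * t * t ^ k" by (simp add: E_def algebra_simps)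
    finally have "\<bar>p - (\<Sum>j=1..k - 1. a j) - a k\<bar> / t ^ k \<le> E * t" using tk by (simp add: divide_le_eq)
    moreover have "1 / t ^ k * (p - (\<Sum>j=1..k - 1. a j)) - D k / fact k = (p - (\<Sum>j=1..k - 1. a j) - a k) / t ^ k"
      using tk t by (simp add: a_def diff_divide_distrib)
    ultimately show ?thesis using tk by (simp add: p_def a_def abs_divide)
  qed
  have "((\<lambda>t. 1 / t ^ k * (prob {w \<in> space M. y \<le> X t w} - (\<Sum>j=1..k - 1. D j * t ^ j / fact j)) - D k / fact k) \<longlongrightarrow> 0) (at_right 0)"
  proof (rule Lim_null_comparison)
    have "\<forall>\<^sub>F t in at_right 0. 0 < t \<and> t \<le> (1::real)"
      unfolding eventually_at_right_field by (intro exI[of _ 1]) auto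
    then show "\<forall>\<^sub>F t in at_right 0. norm (1 / t ^ k * (prob {w \<in> space M. y \<le> X t w} - (\<Sum>j=1..k - 1. D j * t ^ j / fact j)) - D k / fact k) \<le> E * t"
      by eventually_elim (use bound in auto)
    have "((\<lambda>t. E * t) \<longlongrightarrow> E * 0) (at_right 0)" by (intro tendsto_intros)
    then show "((\<lambda>t. E * t) \<longlongrightarrow> 0) (at_right 0)" by simp
  qed
  then show ?thesis by (simp add: D_def LIM_zero_iff)
qed

end

theorem theorem4p3:
  fixes M :: "'w measure" and X :: "real \<Rightarrow> 'w \<Rightarrow> real"
    and \<sigma> b :: real and \<nu> :: "real measure" and s \<phi> c :: "real \<Rightarrow> real"
    and y_min y \<epsilon> :: real and n :: nat
  assumes "0 < y_min" and "1 \<le> n"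
    and "0 < \<epsilon>" and "\<epsilon> < min (y_min / real (n + 1)) 1"
    and "y_min \<le> y"
    and "prob_space M"
    and "levy_triplet M X \<sigma> b \<nu>"
    and "\<nu> = density lborel (\<lambda>x. ennreal (s x))" and "\<And>x. x \<noteq> 0 \<Longrightarrow> 0 \<le> s x"
    and "\<And>k x. k < 2 * n + 1 \<Longrightarrow> x \<noteq> 0 \<Longrightarrow> (deriv ^^ k) s differentiable (at x)"
    and "\<And>k \<delta>. k \<le> 2 * n + 1 \<Longrightarrow> 0 < \<delta> \<Longrightarrow>
           bdd_above ((\<lambda>x. \<bar>(deriv ^^ k) s x\<bar>) ` {x. \<delta> < \<bar>x\<bar>})"
    and "bump_function \<phi>"
    and "truncation_function \<epsilon> c"
  shows "(\<forall>k\<in>{1..n}. convergent (d_hat_seq \<sigma> b \<nu> \<phi> y k)) \<and>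
    (\<forall>t>0. convergent (remainder_seq M X \<sigma> b \<nu> \<phi> n t y)) \<and>
    Limsup (at_right 0) (\<lambda>t. ereal \<bar>remainder M X \<sigma> b \<nu> \<phi> n t y\<bar>) < \<infinity> \<and>
    (\<forall>k\<in>{1..n}.
       d_hat \<sigma> b \<nu> \<phi> y k = d_coeff \<sigma> b \<nu> s c y k \<and>
       (\<forall>\<epsilon>' c'. 0 < \<epsilon>' \<and> \<epsilon>' < min (y_min / real (n + 1)) 1 \<and> truncation_function \<epsilon>' c' \<longrightarrow>
          d_coeff \<sigma> b \<nu> s c' y k = d_coeff \<sigma> b \<nu> s c y k) \<and>
       ((\<lambda>t. 1 / t ^ k * (measure M {w \<in> space M. y \<le> X t w}
             - (\<Sum>j=1..k - 1. d_hat \<sigma> b \<nu> \<phi> y j * t ^ j / fact j)))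
          \<longlongrightarrow> d_hat \<sigma> b \<nu> \<phi> y k / fact k) (at_right 0))"
proof -
  \<comment> \<open>Set up for every admissible truncation, not only the given one, so that the
    coefficients of two truncations can be compared.\<close>
  have expansion: "levy_expansion M \<sigma> b \<nu> \<epsilon>' c' X \<phi> s n y"
    if "0 < \<epsilon>'" "\<epsilon>' < min (y_min / real (n + 1)) 1" "truncation_function \<epsilon>' c'" for \<epsilon>' c'
  proof -
    have e: "0 < \<epsilon>'" "\<epsilon>' \<le> 1" using that by auto
    have "real (n + 1) * \<epsilon>' < y_min" using that(2) by (simp add: field_simps)
    then have y: "real (n + 1) * \<epsilon>' < y" using assms(5) by linarith
    have lev: "levy_measure \<nu>" using assms(7) by (simp add: levy_triplet_def)
    interpret prob_space M by (rule assms(6))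
    interpret LT: levy_truncation \<sigma> b \<nu> \<epsilon>' c' by unfold_locales (rule lev e that(3))+
    interpret LP: levy_process_truncation M \<sigma> b \<nu> \<epsilon>' c' X by unfold_locales (rule assms(7))
    interpret B: bump \<phi> by unfold_locales (rule assms(12))
    show ?thesis
      by unfold_locales (fact assms(2) y assms(8-11))+
  qed
  interpret levy_expansion M \<sigma> b \<nu> \<epsilon> c X \<phi> s n y
    by (rule expansion[OF assms(3,4,13)])
  \<comment> \<open>\<open>d_hat\<close> mentions neither \<epsilon> nor c; being the limit for
    every truncation, it forces their coefficients to coincide.\<close>
  have d_hat: "d_hat \<sigma> b \<nu> \<phi> y k = d_coeff \<sigma> b \<nu> s c' y k"
    if "k \<le> n" "0 < \<epsilon>'" "\<epsilon>' < min (y_min / real (n + 1)) 1" "truncation_function \<epsilon>' c'" for k \<epsilon>' c'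
    unfolding d_hat_def by (rule limI[OF levy_expansion.d_hat_seq_tendsto[OF expansion[OF that(2-4)] that(1)]])
  have d_hat_eq: "d_hat \<sigma> b \<nu> \<phi> y k = d_coeff \<sigma> b \<nu> s c y k" if "k \<le> n" for k
    by (rule d_hat[OF that assms(3,4,13)])
  have conv: "convergent (d_hat_seq \<sigma> b \<nu> \<phi> y k)" if "k \<in> {1..n}" for k
    unfolding convergent_def using d_hat_seq_tendsto[of k] that by auto
  have indep: "d_coeff \<sigma> b \<nu> s c' y k = d_coeff \<sigma> b \<nu> s c y k"
    if "k \<in> {1..n}" "0 < \<epsilon>'" "\<epsilon>' < min (y_min / real (n + 1)) 1" "truncation_function \<epsilon>' c'" for k \<epsilon>' c'
    using d_hat[OF _ that(2-4), of k] d_hat_eq[of k] that(1) by simp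
  have lim: "((\<lambda>t. 1 / t ^ k * (measure M {w \<in> space M. y \<le> X t w}
             - (\<Sum>j=1..k - 1. d_hat \<sigma> b \<nu> \<phi> y j * t ^ j / fact j)))
          \<longlongrightarrow> d_hat \<sigma> b \<nu> \<phi> y k / fact k) (at_right 0)" if k: "k \<in> {1..n}" for k
  proof -
    have "(\<Sum>j=1..k - 1. d_hat \<sigma> b \<nu> \<phi> y j * t ^ j / fact j) = (\<Sum>j=1..k - 1. d_coeff \<sigma> b \<nu> s c y j * t ^ j / fact j)" for t
      using k by (intro sum.cong refl) (auto simp: d_hat_eq)
    then show ?thesis using tail_coefficient_tendsto[OF k] d_hat_eq[of k] k by simp
  qed
  show ?thesis
    by (intro conjI ballI allI impI conv remainder_convergent remainder_Limsup lim)
      (auto intro: d_hat_eq indep)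
qed

end
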